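(* Let $\pi$ be the probability measure on $\mathbf{\Delta}$ with density $\rho(x^1,\dots,x^m,y)=\frac1Z y^{-1/2}$, where $Z$ is a normalizing constant. For every $\mathbf{x}\in\mathbf{\Delta}$ and every $\gamma>0$, $$\lim_{t\to\infty}\ t^{2-\gamma}\,\|P^t(\mathbf{x},\cdot)-\pi\|_{TV}=0,$$ where $\|\cdot\|_{TV}$ is the total variation norm.
   Context: Fix a positive integer $m$ and a constant $\bar E>0$. Superscripts are indices, not powers, on the coordinates $x^i$. The state space is the open simplex $$\mathbf{\Delta}=\Big\{(x^{1},\dots,x^{m},y)\in\mathbb{R}^{m+1}_{+}\ :\ y+\sum_{i=1}^{m}x^{i}=\bar E\Big\},$$ (all coordinates strictly positive). Densities are with respect to Lebesgue measure on $\mathbf{\Delta}$ (e.g. in the coordinates $x^1,\dots,x^m$). The process $\mathbf{x}_t=(x^1_t,\dots,x^m_t,y_t)$, $t\ge 0$, is the time-homogeneous Markov jump process on $\mathbf{\Delta}$ defined as follows: $x^i_t$ is the energy of particle $i$ and $y_t$ the energy of a tank. Particle $i$ carries a clock that rings at exponential rate $\sqrt{x^i_t}$ (the rate changes whenever $x^i_t$ changes); the clocks are independent of one another and of history. When the clock of particle $i$ rings at time $t$, the state immediately after is $$x^i_{t^+}=y_t+(1-u^2)x^i_t,\qquad y_{t^+}=u^2x^i_t,\qquad x^j_{t^+}=x^j_t\ \ (j\ne i),$$ where $u$ is a random variable uniform on $(0,1)$, drawn independently at each ring. $P^t(\mathbf{x},\cdot)$ denotes the transition probabilities of $\mathbf{x}_t$: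 the law of the state at time $t$ given initial condition $\mathbf{x}$. *)

theory Defs
  imports "HOL-Probability.Probability"
begin

text \<open>
  A state is a pair \<open>(x, y)\<close> of the particle energies \<open>x $ i\<close> and the energy \<open>y\<close> of the tank;
  the particles are indexed by a finite type \<open>'m\<close>, so that \<open>m = CARD('m) \<ge> 1\<close>.
\<close>

type_synonym 'm state = "(real ^ 'm) \<times> real"

definition energy_simplex :: "real \<Rightarrow> 'm::finite state set" where
  "energy_simplex E = {(x, y). (\<forall>i. 0 < x $ i) \<and> 0 < y \<and> y + (\<Sum>i\<in>UNIV. x $ i) = E}"

definition ring_update :: "'m \<Rightarrow> real \<Rightarrow> 'm::finite state \<Rightarrow> 'm state" where
  "ring_update i u = (\<lambda>(x, y). (\<chi> j. if j = i then y + (1 - u\<^sup>2) * x $ i else x $ j, u\<^sup>2 * x $ i))"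

text \<open>
  The randomness consumed between two successive rings: a unit exponential variable for every
  clock and the uniform variable of the ring.  The clock of particle \<open>i\<close> needs time
  \<open>e i / sqrt (x $ i)\<close> to ring, which is exponential with rate \<open>sqrt (x $ i)\<close>.
  As exponential clocks are memoryless, all of them may be restarted at every ring.
\<close>

type_synonym 'm noise = "('m \<Rightarrow> real) \<times> real"

definition noise_measure :: "'m::finite noise measure" where
  "noise_measure =
     (\<Pi>\<^sub>M i\<in>UNIV. density lborel (exponential_density 1)) \<Otimes>\<^sub>M uniform_measure lborel {0<..<1}"

definition ring_delay :: "('m \<Rightarrow> real) \<Rightarrow> 'm::finite state \<Rightarrow> 'm \<Rightarrow> real" where
  "ring_delay e s i = e i / sqrt (fst s $ i)"

definition ringing_particle :: "('m \<Rightarrow> real) \<Rightarrow> 'm::finite state \<Rightarrow> 'm" where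
  "ringing_particle e s = (ARG_MIN (ring_delay e s) i. True)"

text \<open>The state immediately after the \<open>n\<close>-th ring, and the time of the \<open>n\<close>-th ring.\<close>

primrec ring_chain :: "'m::finite state \<Rightarrow> 'm noise stream \<Rightarrow> nat \<Rightarrow> 'm state \<times> real" where
  "ring_chain s \<omega> 0 = (s, 0)"
| "ring_chain s \<omega> (Suc n) =
     (let (s', \<tau>) = ring_chain s \<omega> n; (e, u) = \<omega> !! n; i = ringing_particle e s'
      in (ring_update i u s', \<tau> + ring_delay e s' i))"

text \<open>
  The \<open>LEAST\<close> is the number of rings up to time \<open>t\<close>.  It is a junk value only where the ring
  times are bounded by \<open>t\<close>; the total ring rate is bounded on the simplex, so this is a null event.
\<close>

definition state_at :: "'m::finite state \<Rightarrow> 'm noise stream \<Rightarrow> real \<Rightarrow> 'm state" where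
  "state_at s \<omega> t = fst (ring_chain s \<omega> (LEAST n. t < snd (ring_chain s \<omega> (Suc n))))"

text \<open>
  Laws on the simplex are represented by Borel measures on the ambient space that are
  concentrated on it.
\<close>

definition transition_prob :: "real \<Rightarrow> 'm::finite state \<Rightarrow> 'm state measure" where
  "transition_prob t s = distr (stream_space noise_measure) borel (\<lambda>\<omega>. state_at s \<omega> t)"

definition simplex_chart :: "real \<Rightarrow> real ^ 'm \<Rightarrow> 'm::finite state" where
  "simplex_chart E x = (x, E - (\<Sum>i\<in>UNIV. x $ i))"

definition simplex_lebesgue :: "real \<Rightarrow> 'm::finite state measure" where
  "simplex_lebesgue E =
     distr (restrict_space lborel (simplex_chart E -` energy_simplex E)) borel (simplex_chart E)"

definition equilibrium :: "real \<Rightarrow> 'm::finite state measure" where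
  "equilibrium E =
     (let Z = (LINT s|simplex_lebesgue E. snd (s :: 'm state) powr (-1/2))
      in density (simplex_lebesgue E) (\<lambda>(x, y). ennreal (1 / Z * y powr (-1/2))))"

text \<open>
  The total variation norm of the real-valued set function \<open>\<nu>\<close> on the measurable sets of \<open>M\<close>;
  for a difference of probability measures it is twice the supremum of \<open>\<bar>\<nu> A\<bar>\<close>.
\<close>

definition tv_norm :: "'a measure \<Rightarrow> ('a set \<Rightarrow> real) \<Rightarrow> real" where
  "tv_norm M \<nu> =
     (SUP \<A>\<in>{\<A>. finite \<A> \<and> \<A> \<subseteq> sets M \<and> partition_on (space M) \<A>}. \<Sum>A\<in>\<A>. \<bar>\<nu> A\<bar>)"

end

theory Submission
  imports Defs
begin

text \<open>
  A particle of energy \<open>\<epsilon>\<close> waits for a time of order \<open>\<epsilon> powr (-1/2)\<close> before it rings, and at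
  equilibrium some particle has energy below \<open>\<epsilon>\<close> with probability of order \<open>\<epsilon>\<close>. Slow
  particles therefore leave a trace of order \<open>t powr (-2)\<close> in the distance to equilibrium. The
  proof shows that nothing else is slower.

  The total ring rate is at most \<open>\<Lambda> = m * sqrt E\<close>, so the process is a discrete chain with
  transition operator \<open>uniformised \<Lambda>\<close>, observed after a Poisson number of steps with mean
  \<open>\<Lambda> * t\<close> (\<open>transition_prob_eq_semigroup\<close>). As a Poisson variable \<open>N\<close> with mean \<open>\<mu>\<close> has
  \<open>E ((N + 1) powr - p)\<close> of order \<open>\<mu> powr - p\<close>, it suffices to show that this chain is within
  distance of order \<open>k powr - (2 * a)\<close> of equilibrium after \<open>k\<close> steps, for each \<open>a < 1\<close>
  (\<open>uniformised_polynomial_ergodicity\<close>). Three properties of the chain give this.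

  Drift: \<open>V = 1 + (\<Sum>i. x i powr - a) + K * y powr - (a - 1/2)\<close> decreases on average by a multiple
  of \<open>V powr (1 - 1 / (2 * a))\<close>, up to a constant (\<open>lyapunov_drift\<close>). A slow particle loses its
  term \<open>x i powr - a\<close> when it rings, because it receives the energy of the tank. This fails only if
  the tank is even emptier than the particle; but an empty tank is refilled at a rate bounded below,
  and the term in \<open>y\<close> pays for these states.

  Minorisation: where \<open>V\<close> is bounded all energies are bounded below. If each particle in turn rings
  twice, it attains all sufficiently small energies with a density bounded below. Hence the laws
  of the chain after \<open>2 * m\<close> steps from these states all dominate a multiple of one fixed
  probability measure (\<open>lyapunov_minorisation\<close>).

  Invariance: the rings of each single particle already leave the measure with density proportional
  to \<open>y powr (-1/2)\<close> invariant (\<open>equilibrium_ring_balance\<close>). \<open>V\<close> is integrable for it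
  (\<open>equilibrium_lyapunov_finite\<close>), since its terms are singular along different faces of the
  simplex, or along the face \<open>y = 0\<close> together with the density, with exponents less than \<open>1\<close>.

  From drift and minorisation, \<open>polynomial_contraction\<close> bounds the distance between the chains
  started at \<open>x\<close> and \<open>x'\<close> by a multiple of \<open>(V x + V x') * k powr - (2 * a)\<close>: until both are in
  the region where \<open>V\<close> is bounded the drift controls the time that is lost, and there the
  minorisation removes a fixed proportion of the distance. Averaging \<open>x'\<close> over the equilibrium
  replaces the second chain by the equilibrium itself.
\<close>

section \<open>Polynomial contraction of Markov operators\<close>

text \<open>
  The function \<open>w \<mapsto> (w powr (1/p) + h) powr p\<close> is concave, so its tangent at \<open>w0\<close> lies above it.
  An affine bound can be averaged by an operator of which only the value at \<open>V\<close> is known; this is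
  how Jensen's inequality enters. That the intercept \<open>a\<close> is nonnegative allows computations in
  the extended nonnegative reals.
\<close>
lemma tangent_of_shifted_power:
  fixes p h w0 :: real
  assumes "p > 1" "h \<ge> 0" "w0 > 0"
  obtains a k where "a \<ge> 0" "k \<ge> 0" "a + k * w0 = (w0 powr (1/p) + h) powr p"
    "\<And>w. w > 0 \<Longrightarrow> (w powr (1/p) + h) powr p \<le> a + k * w"
proof -
  define G where "G w = (w powr (1/p) + h) powr p" for w
  define G' where "G' w = (1 + h * w powr (-1/p)) powr (p - 1)" for w
  have pos: "w powr (1/p) + h > 0" if "w > 0" for w
    using that assms by (intro add_pos_nonneg) auto
  have G'_eq: "G' w = (w powr (1/p) + h) powr (p - 1) * w powr (1/p - 1)" if "w > 0" for w
  proof -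
    have "1 + h * w powr (-1/p) = (w powr (1/p) + h) * w powr (-1/p)"
      using that by (simp add: distrib_right flip: powr_add)
    then have "G' w = (w powr (1/p) + h) powr (p - 1) * (w powr (-1/p)) powr (p - 1)"
      unfolding G'_def using pos[OF that] by (simp add: powr_mult)
    also have "(w powr (-1/p)) powr (p - 1) = w powr (1/p - 1)"
      using assms by (simp add: powr_powr diff_divide_distrib algebra_simps)
    finally show ?thesis .
  qed
  have der: "(G has_real_derivative G' w) (at w)" if "w > 0" for w
  proof -
    have "(G has_real_derivative (p * (w powr (1/p) + h) powr (p - 1)) * ((1/p) * w powr (1/p - 1))) (at w)"
      unfolding G_def using that pos[OF that] assms by (auto intro!: derivative_eq_intros)
    then show ?thesis using G'_eq[OF that] assms by (simp add: field_simps)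
  qed
  have "convex_on {0<..} (\<lambda>w. - G w)"
  proof (rule convex_on_realI)
    show "((\<lambda>w. - G w) has_real_derivative - G' w) (at w)" if "w \<in> {0<..}" for w
      using der that by (auto intro: DERIV_minus)
    show "- G' v \<le> - G' w" if "v \<in> {0<..}" "w \<in> {0<..}" "v \<le> w" for v w
    proof -
      have "w powr (-1/p) \<le> v powr (-1/p)"
        using that assms by (intro powr_mono2') auto
      then have "1 + h * w powr (-1/p) \<le> 1 + h * v powr (-1/p)"
        using assms by (simp add: mult_left_mono)
      moreover have "0 \<le> 1 + h * w powr (-1/p)" using assms by simp
      ultimately show ?thesis unfolding G'_def using assms by (simp add: powr_mono2)
    qed
  qed simp
  then have above: "- G w - (- G w0) \<ge> - G' w0 * (w - w0)" if "w > 0" for w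
    using that assms DERIV_minus[OF der[of w0]]
    by (intro convex_on_imp_above_tangent[where A = "{0<..}"]) (auto simp: interior_open has_field_derivative_at_within)
  have "G w0 - G' w0 * w0 = (w0 powr (1/p) + h) powr (p - 1) * h"
  proof -
    have "G w0 = (w0 powr (1/p) + h) powr (p - 1) * (w0 powr (1/p) + h)"
      unfolding G_def using pos[OF assms(3)] by (simp add: powr_diff)
    moreover have "G' w0 * w0 = (w0 powr (1/p) + h) powr (p - 1) * w0 powr (1/p)"
      using G'_eq[OF assms(3)] assms by (simp add: powr_diff)
    ultimately show ?thesis by (simp add: algebra_simps)
  qed
  then have "G w0 - G' w0 * w0 \<ge> 0" using assms by simp
  then show ?thesis
    using above by (intro that[of "G w0 - G' w0 * w0" "G' w0"]) (force simp: G_def G'_def algebra_simps)+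
qed

text \<open>
  Along the flow \<open>w' = - c * w powr (1 - 1/p)\<close> the root \<open>w powr (1/p)\<close> decreases at the constant
  speed \<open>c / p\<close>; by Bernoulli's inequality a single step of size one loses at least as much.
\<close>
lemma powr_root_decrement:
  fixes p c w :: real
  assumes "p > 1" "0 \<le> c" "c * w powr (1 - 1/p) < w" "w > 0"
  shows "(w - c * w powr (1 - 1/p)) powr (1/p) + c/p \<le> w powr (1/p)"
proof -
  define t where "t = c * w powr (-1/p)"
  have w: "w - c * w powr (1 - 1/p) = w * (1 - t)"
    using assms powr_add[of w 1 "-1/p"] by (simp add: t_def algebra_simps)
  have t: "0 \<le> t" "t < 1" using assms w by (auto simp: t_def) (smt (verit) mult_nonneg_nonpos)
  have "1 - t > 0" using t by simp
  have "(1 - t) powr (1/p) \<le> 1 - t/p"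
  proof -
    have "convex_on {0<..} (\<lambda>x::real. x powr p)"
    proof (rule convex_on_realI)
      show "((\<lambda>x. x powr p) has_real_derivative p * x powr (p - 1)) (at x)" if "x \<in> {0<..}" for x
        using that by (auto intro!: derivative_eq_intros)
    qed (use assms in \<open>auto intro!: mult_left_mono powr_mono2\<close>)
    then have "(1 - t/p) powr p - 1 powr p \<ge> (p * 1 powr (p - 1)) * ((1 - t/p) - 1)"
      using t assms
      by (intro convex_on_imp_above_tangent[where A = "{0<..}"])
         (auto simp: interior_open field_simps has_field_derivative_at_within intro!: derivative_eq_intros)
    then have "1 - t \<le> (1 - t/p) powr p" using assms by simp
    then have "(1 - t) powr (1/p) \<le> ((1 - t/p) powr p) powr (1/p)"
      using t assms by (intro powr_mono2) auto
    also have "\<dots> = 1 - t/p"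
      using t assms by (simp add: powr_powr field_simps)
    finally show ?thesis .
  qed
  then have "w powr (1/p) * (1 - t) powr (1/p) \<le> w powr (1/p) * (1 - t/p)"
    by (intro mult_left_mono) auto
  also have "\<dots> = w powr (1/p) - c/p"
    using assms by (simp add: t_def algebra_simps flip: powr_add)
  finally show ?thesis using w t assms by (simp add: powr_mult)
qed

text \<open>
  A Markov kernel on \<open>S\<close>, represented by its action on nonnegative functions. All comparisons below
  are inequalities between averages of functions, for which this is more convenient than measures.
  Values outside \<open>S\<close> are arbitrary.
\<close>
locale markov_operator =
  fixes S :: "'a set" and M :: "'a measure" and P :: "('a \<Rightarrow> ennreal) \<Rightarrow> 'a \<Rightarrow> ennreal"
  assumes measurable_op: "f \<in> borel_measurable M \<Longrightarrow> P f \<in> borel_measurable M"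
    and mono_op: "(\<And>z. z \<in> S \<Longrightarrow> f z \<le> g z) \<Longrightarrow> x \<in> S \<Longrightarrow> P f x \<le> P g x"
    and add_op: "f \<in> borel_measurable M \<Longrightarrow> g \<in> borel_measurable M \<Longrightarrow> x \<in> S
      \<Longrightarrow> P (\<lambda>z. f z + g z) x = P f x + P g x"
    and cmult_op: "f \<in> borel_measurable M \<Longrightarrow> x \<in> S \<Longrightarrow> P (\<lambda>z. k * f z) x = k * P f x"
    and one_op: "x \<in> S \<Longrightarrow> P (\<lambda>_. 1) x = 1"
begin

lemma const_op: "x \<in> S \<Longrightarrow> P (\<lambda>_. k) x = k"
  using cmult_op[of "\<lambda>_. 1" x k] one_op by simp

lemma cong_op: "(\<And>z. z \<in> S \<Longrightarrow> f z = g z) \<Longrightarrow> x \<in> S \<Longrightarrow> P f x = P g x"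
  by (intro antisym mono_op) auto

text \<open>
  The bound is a function of \<open>z\<close> plus a function of \<open>z'\<close>, so the two starting points can be averaged
  one after the other. This takes the place of a coupling of the two chains.
\<close>
lemma pair_step:
  fixes V :: "'a \<Rightarrow> ennreal"
  assumes [measurable]: "g \<in> borel_measurable M" "V \<in> borel_measurable M"
    and le: "\<And>z z'. z \<in> S \<Longrightarrow> z' \<in> S \<Longrightarrow> g z \<le> g z' + a + k * V z + k * V z'"
    and x: "x \<in> S" "x' \<in> S"
  shows "P g x \<le> P g x' + a + k * P V x + k * P V x'"
proof -
  have 1: "P g x \<le> g z' + a + k * V z' + k * P V x" if "z' \<in> S" for z'
  proof -
    have "P g x \<le> P (\<lambda>z. (g z' + a + k * V z') + k * V z) x"
      using le that x by (intro mono_op) (auto simp: ac_simps)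
    also have "\<dots> = g z' + a + k * V z' + k * P V x"
      using x by (simp add: add_op cmult_op const_op)
    finally show ?thesis .
  qed
  have "P g x = P (\<lambda>_. P g x) x'" using x by (simp add: const_op)
  also have "\<dots> \<le> P (\<lambda>z'. g z' + ((a + k * P V x) + k * V z')) x'"
    using 1 x by (intro mono_op) (auto simp: ac_simps)
  also have "\<dots> = P g x' + a + k * P V x + k * P V x'"
    using x by (simp add: add_op cmult_op const_op ac_simps)
  finally show ?thesis .
qed

text \<open>
  The component \<open>\<nu>\<close> that the two transitions share cancels in the difference and so removes the
  proportion \<open>\<eta>\<close> of the distance \<open>r\<close>. To see this, the hypothesis is separated by a constant \<open>c\<close> into
  \<open>g - k V - r \<le> c \<le> g + k V\<close>; the minorisation is then applied to the two gaps, whose sum is at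
  least \<open>r\<close>.
\<close>
lemma minorised_pair_step:
  fixes V :: "'a \<Rightarrow> ennreal" and \<eta> r k v v' :: real
  assumes [measurable]: "g \<in> borel_measurable M" "V \<in> borel_measurable M"
    and le: "\<And>z z'. z \<in> S \<Longrightarrow> z' \<in> S \<Longrightarrow> g z \<le> g z' + ennreal r + ennreal k * V z + ennreal k * V z'"
    and g1: "\<And>z. z \<in> S \<Longrightarrow> g z \<le> 1"
    and x: "x \<in> S" "x' \<in> S" and r: "r \<ge> 0" "k \<ge> 0"
    and nu: "prob_space \<nu>" "sets \<nu> = sets M" "AE z in \<nu>. z \<in> S" and eta: "0 < \<eta>" "\<eta> \<le> 1"
    and minor: "\<And>f. f \<in> borel_measurable M \<Longrightarrow> ennreal \<eta> * (\<integral>\<^sup>+z. f z \<partial>\<nu>) \<le> P f x"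
      "\<And>f. f \<in> borel_measurable M \<Longrightarrow> ennreal \<eta> * (\<integral>\<^sup>+z. f z \<partial>\<nu>) \<le> P f x'"
    and PV: "P V x \<le> ennreal v" "P V x' \<le> ennreal v'" "v \<ge> 0" "v' \<ge> 0"
    and Vfin: "\<And>z. z \<in> S \<Longrightarrow> V z < \<top>"
  shows "P g x \<le> P g x' + ennreal ((1 - \<eta>) * r + k * (v + v'))"
proof -
  interpret nu: prob_space \<nu> by fact
  have [measurable_cong]: "sets \<nu> = sets M" by fact
  \<comment> \<open>a constant separating \<open>g - k V - r\<close> from \<open>g + k V\<close>\<close>
  define c where "c = (INF z\<in>S. g z + ennreal k * V z)"
  have c_le: "c \<le> g z + ennreal k * V z" if "z \<in> S" for z
    unfolding c_def using that by (rule INF_lower)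
  have le_c: "g z \<le> c + ennreal r + ennreal k * V z" if "z \<in> S" for z
  proof -
    have "g z - (ennreal r + ennreal k * V z) \<le> g z' + ennreal k * V z'" if "z' \<in> S" for z'
      using le[OF \<open>z \<in> S\<close> that] ennreal_mult_less_top[of "ennreal k" "V z"] Vfin[OF \<open>z \<in> S\<close>]
      by (subst ennreal_minus_le_iff) (auto simp: ac_simps)
    then have "g z - (ennreal r + ennreal k * V z) \<le> c" unfolding c_def by (rule INF_greatest)
    then show ?thesis using ennreal_mult_less_top[of "ennreal k" "V z"] Vfin[OF that]
      by (subst (asm) ennreal_minus_le_iff) (auto simp: ac_simps)
  qed
  have fin_left: "u < \<top>" if "u + v = w" "w < \<top>" for u v w :: ennreal
    using that by (cases "u = \<top>") (auto simp: less_top)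
  have gx: "g x < \<top>" using le_less_trans[OF g1[OF x(1)]] by simp
  have c_fin: "c < \<top>"
    by (rule le_less_trans[OF c_le[OF x(1)]])
      (use gx Vfin[OF x(1)] in \<open>simp add: ennreal_mult_less_top\<close>)
  define F where "F z = c + ennreal r + ennreal k * V z - g z" for z
  define H where "H z = g z + ennreal k * V z - c" for z
  have [measurable]: "F \<in> borel_measurable M" "H \<in> borel_measurable M"
    unfolding F_def H_def by measurable
  have Fg: "F z + g z = (c + ennreal r) + ennreal k * V z" if "z \<in> S" for z
    unfolding F_def using le_c[OF that] by (simp add: diff_add_cancel_ennreal)
  have Hc: "H z + c = g z + ennreal k * V z" if "z \<in> S" for z
    unfolding H_def using c_le[OF that] by (simp add: diff_add_cancel_ennreal)
  have PF: "P F x + P g x = (c + ennreal r) + ennreal k * P V x"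
  proof -
    have "P F x + P g x = P (\<lambda>z. F z + g z) x" using x by (simp add: add_op)
    also have "\<dots> = P (\<lambda>z. (c + ennreal r) + ennreal k * V z) x"
      using x Fg by (intro cong_op) auto
    finally show ?thesis using x by (simp add: add_op cmult_op const_op)
  qed
  have PH: "P H x' + c = P g x' + ennreal k * P V x'"
  proof -
    have "P H x' + c = P (\<lambda>z. H z + c) x'" using x by (simp add: add_op const_op)
    also have "\<dots> = P (\<lambda>z. g z + ennreal k * V z) x'"
      using x Hc by (intro cong_op) auto
    finally show ?thesis using x by (simp add: add_op cmult_op)
  qed
  have nF: "(\<integral>\<^sup>+z. F z \<partial>\<nu>) + (\<integral>\<^sup>+z. g z \<partial>\<nu>) = (c + ennreal r) + ennreal k * (\<integral>\<^sup>+z. V z \<partial>\<nu>)"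
  proof -
    have "(\<integral>\<^sup>+z. F z \<partial>\<nu>) + (\<integral>\<^sup>+z. g z \<partial>\<nu>) = (\<integral>\<^sup>+z. F z + g z \<partial>\<nu>)" by (simp add: nn_integral_add)
    also have "\<dots> = (\<integral>\<^sup>+z. (c + ennreal r) + ennreal k * V z \<partial>\<nu>)"
      using nu(3) by (intro nn_integral_cong_AE) (auto simp: Fg)
    finally show ?thesis by (simp add: nn_integral_add nn_integral_cmult nu.emeasure_space_1)
  qed
  have nH: "(\<integral>\<^sup>+z. H z \<partial>\<nu>) + c = (\<integral>\<^sup>+z. g z \<partial>\<nu>) + ennreal k * (\<integral>\<^sup>+z. V z \<partial>\<nu>)"
  proof -
    have "(\<integral>\<^sup>+z. H z \<partial>\<nu>) + c = (\<integral>\<^sup>+z. H z + c \<partial>\<nu>)" by (simp add: nn_integral_add nu.emeasure_space_1)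
    also have "\<dots> = (\<integral>\<^sup>+z. g z + ennreal k * V z \<partial>\<nu>)"
      using nu(3) by (intro nn_integral_cong_AE) (auto simp: Hc)
    finally show ?thesis by (simp add: nn_integral_add nn_integral_cmult)
  qed
  have fin: "P g x \<le> 1" "P g x' \<le> 1"
    using mono_op[of g "\<lambda>_. 1" x] mono_op[of g "\<lambda>_. 1" x'] g1 x one_op by auto
  have fin_nV: "(\<integral>\<^sup>+z. V z \<partial>\<nu>) < \<top>"
  proof -
    have "ennreal \<eta> * (\<integral>\<^sup>+z. V z \<partial>\<nu>) \<le> ennreal v" using minor(1)[of V] PV(1) by simp
    then have "ennreal \<eta> * (\<integral>\<^sup>+z. V z \<partial>\<nu>) < \<top>" by (rule le_less_trans) simp
    then show ?thesis using eta by (auto simp: ennreal_mult_less_top)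
  qed
  have fin_ng: "(\<integral>\<^sup>+z. g z \<partial>\<nu>) < \<top>"
  proof -
    have "(\<integral>\<^sup>+z. g z \<partial>\<nu>) \<le> (\<integral>\<^sup>+z. 1 \<partial>\<nu>)"
      using nu(3) by (intro nn_integral_mono_AE) (auto simp: g1)
    also have "\<dots> < \<top>" by (simp add: nu.emeasure_space_1)
    finally show ?thesis .
  qed
  have PV': "P V x < \<top>" "P V x' < \<top>"
    by (rule le_less_trans[OF PV(1)], simp) (rule le_less_trans[OF PV(2)], simp)
  have Pg: "P g x < \<top>" "P g x' < \<top>"
    by (rule le_less_trans[OF fin(1)], simp) (rule le_less_trans[OF fin(2)], simp)
  have fin': "(\<integral>\<^sup>+z. F z \<partial>\<nu>) < \<top>" "(\<integral>\<^sup>+z. H z \<partial>\<nu>) < \<top>" "P F x < \<top>" "P H x' < \<top>"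
    by (rule fin_left[OF nF] fin_left[OF nH] fin_left[OF PF] fin_left[OF PH];
        use fin_nV fin_ng PV' Pg c_fin in \<open>simp add: ennreal_mult_less_top\<close>)+
  have real: "\<exists>r\<ge>0. t = ennreal r" if "t < \<top>" for t :: ennreal
    using that by (cases t) auto
  obtain c' where c': "c' \<ge> 0" "c = ennreal c'" using real[OF c_fin] by auto
  obtain A where A: "A \<ge> 0" "P g x = ennreal A" using real[OF Pg(1)] by auto
  obtain B where B: "B \<ge> 0" "P g x' = ennreal B" using real[OF Pg(2)] by auto
  obtain nV where nV: "nV \<ge> 0" "(\<integral>\<^sup>+z. V z \<partial>\<nu>) = ennreal nV" using real[OF fin_nV] by auto
  obtain ng where ng: "ng \<ge> 0" "(\<integral>\<^sup>+z. g z \<partial>\<nu>) = ennreal ng" using real[OF fin_ng] by auto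
  obtain nF' where nF': "nF' \<ge> 0" "(\<integral>\<^sup>+z. F z \<partial>\<nu>) = ennreal nF'" using real[OF fin'(1)] by auto
  obtain nH' where nH': "nH' \<ge> 0" "(\<integral>\<^sup>+z. H z \<partial>\<nu>) = ennreal nH'" using real[OF fin'(2)] by auto
  obtain PF' where PF': "PF' \<ge> 0" "P F x = ennreal PF'" using real[OF fin'(3)] by auto
  obtain PH' where PH': "PH' \<ge> 0" "P H x' = ennreal PH'" using real[OF fin'(4)] by auto
  obtain a where a: "a \<ge> 0" "P V x = ennreal a" using real[OF PV'(1)] by auto
  obtain b where b: "b \<ge> 0" "P V x' = ennreal b" using real[OF PV'(2)] by auto
  note reals = c' A B nV ng nF' nH' PF' PH' a b
  have e: "PF' + A = c' + r + k * a" "PH' + c' = B + k * b" "nF' + ng = c' + r + k * nV"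
    "nH' + c' = ng + k * nV" "\<eta> * nF' \<le> PF'" "\<eta> * nH' \<le> PH'" "a \<le> v" "b \<le> v'"
    using PF PH nF nH minor(1)[of F] minor(2)[of H] PV reals r eta
    by (auto simp: ennreal_plus[symmetric] ennreal_mult[symmetric] simp del: ennreal_plus)
  have "k * nV \<ge> 0" using r nV by simp
  then have "\<eta> * r \<le> \<eta> * (nF' + nH')" using e eta by (intro mult_left_mono) linarith+
  moreover have "k * a \<le> k * v" "k * b \<le> k * v'" using e r by (auto intro: mult_left_mono)
  ultimately have "A \<le> B + ((1 - \<eta>) * r + k * (v + v'))" using e by (simp add: algebra_simps)
  moreover have "(1 - \<eta>) * r + k * (v + v') \<ge> 0" using r eta PV by auto
  ultimately show ?thesis using B A by (simp add: ennreal_plus[symmetric] del: ennreal_plus)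
qed

lemma markov_operator_iterate: "markov_operator S M (P ^^ n)"
proof (induction n)
  case 0
  then show ?case by unfold_locales auto
next
  case (Suc n)
  interpret n: markov_operator S M "P ^^ n" by fact
  show ?case
  proof
    show "(P ^^ Suc n) f x \<le> (P ^^ Suc n) g x" if "\<And>z. z \<in> S \<Longrightarrow> f z \<le> g z" "x \<in> S" for f g x
      using that by (auto intro!: mono_op n.mono_op)
    show "(P ^^ Suc n) (\<lambda>z. f z + g z) x = (P ^^ Suc n) f x + (P ^^ Suc n) g x"
      if "f \<in> borel_measurable M" "g \<in> borel_measurable M" "x \<in> S" for f g x
    proof -
      have "(P ^^ Suc n) (\<lambda>z. f z + g z) x = P (\<lambda>z. (P ^^ n) f z + (P ^^ n) g z) x"
        using that by (auto intro!: cong_op n.add_op)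
      then show ?thesis using that by (simp add: add_op n.measurable_op)
    qed
    show "(P ^^ Suc n) (\<lambda>z. k * f z) x = k * (P ^^ Suc n) f x"
      if "f \<in> borel_measurable M" "x \<in> S" for f k x
    proof -
      have "(P ^^ Suc n) (\<lambda>z. k * f z) x = P (\<lambda>z. k * (P ^^ n) f z) x"
        using that by (auto intro!: cong_op n.cmult_op)
      then show ?thesis using that by (simp add: cmult_op n.measurable_op)
    qed
    show "(P ^^ Suc n) (\<lambda>_. 1) x = 1" if "x \<in> S" for x
      using that cong_op[of "(P ^^ n) (\<lambda>_. 1)" "\<lambda>_. 1" x] by (simp add: n.one_op one_op)
    show "(P ^^ Suc n) f \<in> borel_measurable M" if "f \<in> borel_measurable M" for f
      using that by (simp add: measurable_op n.measurable_op)
  qed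
qed

lemma iterate_le_1: "(\<And>z. z \<in> S \<Longrightarrow> f z \<le> 1) \<Longrightarrow> x \<in> S \<Longrightarrow> (P ^^ n) f x \<le> 1"
  using markov_operator.mono_op[OF markov_operator_iterate, of f "\<lambda>_. 1" x n]
    markov_operator.one_op[OF markov_operator_iterate, of x n] by simp

end

text \<open>
  The drift is that of \<open>w' = - c * w powr (1 - 1/p)\<close>, whose solutions reach bounded values in time of
  order \<open>w powr (1/p)\<close>; return times then have a moment of order \<open>p\<close>.
\<close>
locale polynomial_drift = markov_operator +
  fixes V :: "'a \<Rightarrow> real" and p c d :: real
  assumes V_measurable: "(\<lambda>z. ennreal (V z)) \<in> borel_measurable M"
    and V_ge_1: "x \<in> S \<Longrightarrow> V x \<ge> 1"
    and p_gt_1: "p > 1" and c_bounds: "0 < c" "c \<le> 1" and d_pos: "d > 0"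
    and drift: "x \<in> S \<Longrightarrow> P (\<lambda>z. ennreal (V z)) x \<le> ennreal (V x - c * V x powr (1 - 1/p) + d)"
    and minorisation: "\<exists>n \<eta> \<nu>. 0 < \<eta> \<and> \<eta> < 1 \<and> prob_space \<nu> \<and> sets \<nu> = sets M \<and> (AE z in \<nu>. z \<in> S) \<and>
      (\<forall>x\<in>S. V x \<le> R \<longrightarrow> (\<forall>f\<in>borel_measurable M. ennreal \<eta> * (\<integral>\<^sup>+z. f z \<partial>\<nu>) \<le> (P ^^ n) f x))"
begin

text \<open>
  The level of \<open>V x + V x'\<close> above which the drift dominates the constants \<open>d\<close> of both points.
\<close>
definition "threshold = max 1 ((8 * d / c) powr (1 / (1 - 1/p)))"

text \<open>
  Although one of the two points may lie where \<open>V\<close> is small and tends to increase, the larger of \<open>V x\<close>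
  and \<open>V x'\<close> is at least half of the sum and its drift decides.
\<close>
lemma pair_drift:
  assumes "x \<in> S" "x' \<in> S" and big: "V x + V x' > threshold"
  defines "w \<equiv> V x + V x'"
  shows "P (\<lambda>z. ennreal (V z)) x + P (\<lambda>z. ennreal (V z)) x' \<le> ennreal (w - c/4 * w powr (1 - 1/p))"
    and "c/4 * w powr (1 - 1/p) < w" and "w > 0"
proof -
  define q where "q = 1 - 1/p"
  have q: "0 < q" "q < 1" using p_gt_1 by (auto simp: q_def)
  have V1: "V x \<ge> 1" "V x' \<ge> 1" using V_ge_1 assms by auto
  then have w: "w \<ge> 1" unfolding w_def by linarith
  then show "w > 0" by simp
  have "w powr q \<le> w" using w q powr_mono[of q 1 w] by simp
  then have "c/4 * w powr q \<le> 1/4 * w"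
    using c_bounds by (intro mult_mono) auto
  then show "c/4 * w powr (1 - 1/p) < w" using w unfolding q_def by linarith
  have sub: "w powr q \<le> 2 * (V x powr q + V x' powr q)"
  proof -
    define m where "m = max (V x) (V x')"
    have "w powr q \<le> (2 * m) powr q"
      unfolding w_def m_def using V1 q by (intro powr_mono2) auto
    also have "\<dots> = 2 powr q * m powr q" by (simp add: powr_mult)
    also have "\<dots> \<le> 2 * m powr q"
      using q powr_mono[of q 1 2] by (intro mult_right_mono) auto
    also have "m powr q \<le> V x powr q + V x' powr q" by (auto simp: m_def max_def)
    finally show ?thesis by simp
  qed
  have "8 * d / c = ((8 * d / c) powr (1/q)) powr q"
    using q d_pos c_bounds by (simp add: powr_powr)
  also have "\<dots> \<le> w powr q"
    using big q by (intro powr_mono2) (auto simp: threshold_def w_def q_def)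
  finally have "8 * d \<le> c * w powr q" using c_bounds by (simp add: field_simps)
  moreover have "c * (w powr q) \<le> c * (2 * (V x powr q + V x' powr q))"
    using sub c_bounds by (intro mult_left_mono) auto
  ultimately have le: "(V x - c * V x powr q + d) + (V x' - c * V x' powr q + d) \<le> w - c/4 * w powr q"
    by (simp add: w_def algebra_simps)
  have nn: "V y - c * V y powr q + d \<ge> 0" if "y \<in> S" for y
  proof -
    have "c * V y powr q \<le> 1 * V y powr 1"
      using V_ge_1[OF that] q c_bounds by (intro mult_mono powr_mono) auto
    then show ?thesis using V_ge_1[OF that] d_pos by simp
  qed
  have "P (\<lambda>z. ennreal (V z)) x + P (\<lambda>z. ennreal (V z)) x' \<le>
      ennreal (V x - c * V x powr q + d) + ennreal (V x' - c * V x' powr q + d)"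
    using drift assms by (intro add_mono) (auto simp: q_def)
  also have "\<dots> \<le> ennreal (w - c/4 * w powr q)"
    unfolding ennreal_plus[OF nn[OF assms(1)] nn[OF assms(2)], symmetric] using le by (rule ennreal_leI)
  finally show "P (\<lambda>z. ennreal (V z)) x + P (\<lambda>z. ennreal (V z)) x' \<le> ennreal (w - c/4 * w powr (1 - 1/p))"
    unfolding q_def .
qed

lemma iterate_V_le:
  assumes "x \<in> S"
  shows "(P ^^ n) (\<lambda>z. ennreal (V z)) x \<le> ennreal (V x + n * d)"
  using assms
proof (induction n arbitrary: x)
  case (Suc n)
  have "(P ^^ Suc n) (\<lambda>z. ennreal (V z)) x \<le> P (\<lambda>z. ennreal (V z) + ennreal (n * d)) x"
    using Suc V_ge_1 d_pos by (force intro!: mono_op simp: ennreal_plus[symmetric] simp del: ennreal_plus)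
  also have "\<dots> = P (\<lambda>z. ennreal (V z)) x + ennreal (n * d)"
    using Suc.prems V_measurable by (simp add: add_op const_op)
  also have "\<dots> \<le> ennreal (V x + d) + ennreal (n * d)"
    using c_bounds by (intro add_right_mono order_trans[OF drift[OF Suc.prems]] ennreal_leI) simp
  also have "\<dots> = ennreal (V x + Suc n * d)"
    using V_ge_1[OF Suc.prems] d_pos by (simp add: ennreal_plus[symmetric] algebra_simps del: ennreal_plus)
  finally show ?case .
qed simp

text \<open>
  A bound \<open>r\<close> on the total variation distance after \<open>k\<close> steps, uniform over the pairs of starting
  points below the threshold.
\<close>
definition close_after :: "nat \<Rightarrow> real \<Rightarrow> bool" where
  "close_after k r \<longleftrightarrow> (\<forall>f\<in>borel_measurable M. (\<forall>z\<in>S. f z \<le> 1) \<longrightarrow>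
     (\<forall>x\<in>S. \<forall>x'\<in>S. V x + V x' \<le> threshold \<longrightarrow> (P ^^ k) f x \<le> (P ^^ k) f x' + ennreal r))"

text \<open>
  Total variation distances do not increase in time: the additional steps can be absorbed into the
  test function.
\<close>
lemma close_after_mono:
  assumes "close_after k r" "k \<le> l" "r \<le> r'"
  shows "close_after l r'"
proof -
  have eq: "(P ^^ l) f = (P ^^ k) ((P ^^ (l - k)) f)" for f
    using assms by (simp add: funpow_add[symmetric, THEN fun_cong, unfolded o_def])
  have "(P ^^ k) ((P ^^ (l - k)) f) x \<le> (P ^^ k) ((P ^^ (l - k)) f) x' + ennreal r'"
    if "f \<in> borel_measurable M" "\<forall>z\<in>S. f z \<le> 1" "x \<in> S" "x' \<in> S" "V x + V x' \<le> threshold" for f x x'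
  proof -
    have "(P ^^ (l - k)) f \<in> borel_measurable M" "\<forall>z\<in>S. (P ^^ (l - k)) f z \<le> 1"
      using that iterate_le_1 by (auto intro: markov_operator.measurable_op[OF markov_operator_iterate])
    then have "(P ^^ k) ((P ^^ (l - k)) f) x \<le> (P ^^ k) ((P ^^ (l - k)) f) x' + ennreal r"
      using assms(1) that unfolding close_after_def by blast
    also have "\<dots> \<le> (P ^^ k) ((P ^^ (l - k)) f) x' + ennreal r'"
      using assms by (intro add_left_mono ennreal_leI)
    finally show ?thesis .
  qed
  then show ?thesis unfolding close_after_def eq by blast
qed

text \<open>
  Above the threshold, the drift of \<open>w = V x + V x'\<close> makes \<open>(w powr (1/p) + \<kappa> * l) powr p\<close> a
  supermartingale, where \<open>l\<close> counts the steps. A pair that stays above the threshold for \<open>j\<close> steps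
  has made it at least \<open>(\<kappa> * j) powr p\<close>, which by Markov's inequality has probability at most
  \<open>w / (\<kappa> * j) powr p\<close>; a pair that goes below the threshold earlier has \<open>k\<close> steps left to get
  \<open>r\<close>-close. The induction over the number \<open>i\<close> of remaining steps expresses this without stopping times.
\<close>
lemma return_estimate:
  assumes close: "close_after k r" and r: "r \<ge> 0" and j: "j \<ge> 1"
    and f[measurable]: "f \<in> borel_measurable M" and f1: "\<And>z. z \<in> S \<Longrightarrow> f z \<le> 1"
    and x: "x \<in> S" "x' \<in> S"
  shows "(P ^^ (k + j)) f x \<le> (P ^^ (k + j)) f x' + ennreal (r + (V x + V x') / (c / (4 * p) * j) powr p)"
proof -
  define \<kappa> where "\<kappa> = c / (4 * p)"
  define D where "D = (\<kappa> * j) powr p"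
  have \<kappa>: "\<kappa> > 0" using c_bounds p_gt_1 by (simp add: \<kappa>_def)
  have D: "D > 0" using \<kappa> j by (simp add: D_def)
  note [measurable] = V_measurable markov_operator.measurable_op[OF markov_operator_iterate]
  have "(P ^^ (k + i)) f x \<le> (P ^^ (k + i)) f x' +
      ennreal (r + ((V x + V x') powr (1/p) + \<kappa> * (real j - real i)) powr p / D)"
    if "i \<le> j" "x \<in> S" "x' \<in> S" for i x x'
    using that
  proof (induction i arbitrary: x x')
    case 0
    have "D \<le> ((V x + V x') powr (1/p) + \<kappa> * real j) powr p"
      unfolding D_def using \<kappa> p_gt_1 by (intro powr_mono2) auto
    then have "1 \<le> r + ((V x + V x') powr (1/p) + \<kappa> * real j) powr p / D"
      using r D by (simp add: field_simps) (smt (verit) mult_nonneg_nonneg)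
    then have "1 \<le> ennreal (r + ((V x + V x') powr (1/p) + \<kappa> * real j) powr p / D)"
      by simp
    moreover have "(P ^^ k) f x \<le> 1" using iterate_le_1[of f x k] f1 0 by auto
    ultimately show ?case by (simp add: order_trans[OF _ add_increasing])
  next
    case (Suc i)
    have pos: "((V x + V x') powr (1/p) + \<kappa> * (real j - real (Suc i))) powr p / D \<ge> 0" using D by simp
    show ?case
    proof (cases "V x + V x' \<le> threshold")
      case True
      have "(P ^^ (k + Suc i)) f x \<le> (P ^^ (k + Suc i)) f x' + ennreal r"
        using close_after_mono[OF close, of "k + Suc i" r] True Suc.prems f f1
        unfolding close_after_def by auto
      also have "\<dots> \<le> (P ^^ (k + Suc i)) f x' +
          ennreal (r + ((V x + V x') powr (1/p) + \<kappa> * (real j - real (Suc i))) powr p / D)"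
        using pos by (intro add_left_mono ennreal_leI) linarith
      finally show ?thesis .
    next
      case False
      define w where "w = V x + V x'"
      define w0 where "w0 = w - c/4 * w powr (1 - 1/p)"
      define h where "h = \<kappa> * (real j - real i)"
      have pd: "P (\<lambda>z. ennreal (V z)) x + P (\<lambda>z. ennreal (V z)) x' \<le> ennreal w0" "w0 > 0" "w > 0"
        using pair_drift[of x x'] False Suc.prems by (auto simp: w0_def w_def)
      have h: "h \<ge> 0" using Suc.prems \<kappa> by (auto simp: h_def)
      obtain a b where ab: "a \<ge> 0" "b \<ge> 0" "a + b * w0 = (w0 powr (1/p) + h) powr p"
        "\<And>w. w > 0 \<Longrightarrow> (w powr (1/p) + h) powr p \<le> a + b * w"
        using tangent_of_shifted_power[OF p_gt_1 h pd(2)] by blast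
      let ?g = "(P ^^ (k + i)) f"
      have "P ?g x \<le> P ?g x' + ennreal (r + a/D) + ennreal (b/D) * P (\<lambda>z. ennreal (V z)) x
          + ennreal (b/D) * P (\<lambda>z. ennreal (V z)) x'"
      proof (rule pair_step)
        fix z z' assume z: "z \<in> S" "z' \<in> S"
        have "((V z + V z') powr (1/p) + h) powr p \<le> a + b * (V z + V z')"
          using V_ge_1[OF z(1)] V_ge_1[OF z(2)] by (intro ab) auto
        then have "r + ((V z + V z') powr (1/p) + h) powr p / D \<le> r + (a + b * (V z + V z')) / D"
          using D by (simp add: divide_right_mono)
        then have "ennreal (r + ((V z + V z') powr (1/p) + h) powr p / D) \<le> ennreal (r + (a + b * (V z + V z')) / D)"
          by (rule ennreal_leI)
        also have "\<dots> = ennreal (r + a/D) + ennreal (b/D) * ennreal (V z) + ennreal (b/D) * ennreal (V z')"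
          using V_ge_1[OF z(1)] V_ge_1[OF z(2)] ab D r
          by (simp add: ennreal_plus[symmetric] ennreal_mult[symmetric] add_divide_distrib distrib_left algebra_simps del: ennreal_plus)
        finally show "?g z \<le> ?g z' + ennreal (r + a/D) + ennreal (b/D) * ennreal (V z) + ennreal (b/D) * ennreal (V z')"
          using Suc.IH[OF _ z] Suc.prems unfolding h_def by (auto simp: add.assoc intro: order_trans add_left_mono)
      qed (use Suc.prems in measurable)
      also have "\<dots> = P ?g x' + (ennreal (r + a/D) + ennreal (b/D) * (P (\<lambda>z. ennreal (V z)) x
          + P (\<lambda>z. ennreal (V z)) x'))"
        by (simp add: distrib_left add.assoc)
      also have "\<dots> \<le> P ?g x' + (ennreal (r + a/D) + ennreal (b/D) * ennreal w0)"
        using pd by (intro add_left_mono mult_left_mono) auto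
      also have "ennreal (r + a/D) + ennreal (b/D) * ennreal w0 = ennreal (r + (a + b * w0) / D)"
        using ab(1,2) pd D r by (simp add: ennreal_plus[symmetric] ennreal_mult[symmetric] add_divide_distrib algebra_simps del: ennreal_plus)
      also have "\<dots> \<le> ennreal (r + (w powr (1/p) + \<kappa> * (real j - real (Suc i))) powr p / D)"
      proof -
        have "w0 powr (1/p) + (c/4)/p \<le> w powr (1/p)"
          unfolding w0_def using c_bounds pd p_gt_1
          by (intro powr_root_decrement) (auto simp: w0_def)
        then have "w0 powr (1/p) + h \<le> w powr (1/p) + \<kappa> * (real j - real (Suc i))"
        proof -
          have "\<kappa> * (real j - real (Suc i)) = h - \<kappa>" by (simp add: h_def algebra_simps)
          moreover have "\<kappa> = c/4/p" by (simp add: \<kappa>_def)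
          ultimately have "\<kappa> * (real j - real (Suc i)) = h - c/4/p" by simp
          with \<open>w0 powr (1/p) + (c/4)/p \<le> w powr (1/p)\<close> show ?thesis by linarith
        qed
        then have "(w0 powr (1/p) + h) powr p \<le> (w powr (1/p) + \<kappa> * (real j - real (Suc i))) powr p"
          using p_gt_1 h by (intro powr_mono2) auto
        then show ?thesis unfolding ab using D
          by (intro ennreal_leI add_left_mono divide_right_mono) auto
      qed
      finally show ?thesis by (simp add: w_def)
    qed
  qed
  from this[of j x x'] show ?thesis
    using x p_gt_1 V_ge_1[OF x(1)] V_ge_1[OF x(2)] by (simp add: D_def \<kappa>_def powr_powr)
qed


text \<open>
  From below the threshold, \<open>n\<close> steps remove the proportion \<open>\<eta>\<close> of the distance; the next \<open>j\<close> steps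
  serve to return below the threshold, and \<open>k\<close> steps remain.
\<close>
lemma contraction_step:
  obtains n \<eta> C where "0 < \<eta>" "\<eta> < 1" "C \<ge> 0"
    "\<And>k r j. close_after k r \<Longrightarrow> r \<ge> 0 \<Longrightarrow> j \<ge> 1 \<Longrightarrow> close_after (n + (k + j)) ((1 - \<eta>) * r + C / real j powr p)"
proof -
  obtain n \<eta> \<nu> where nu: "0 < \<eta>" "\<eta> < 1" "prob_space \<nu>" "sets \<nu> = sets M" "AE z in \<nu>. z \<in> S"
    "\<And>x f. x \<in> S \<Longrightarrow> V x \<le> threshold \<Longrightarrow> f\<in>borel_measurable M \<Longrightarrow> ennreal \<eta> * (\<integral>\<^sup>+z. f z \<partial>\<nu>) \<le> (P ^^ n) f x"
    using minorisation[of threshold] by blast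
  define \<kappa> where "\<kappa> = c / (4 * p)"
  have \<kappa>: "\<kappa> > 0" using c_bounds p_gt_1 by (simp add: \<kappa>_def)
  define C where "C = (threshold + 2 * n * d) / \<kappa> powr p"
  have t1: "threshold \<ge> 1" by (simp add: threshold_def)
  interpret n: markov_operator S M "P ^^ n" by (rule markov_operator_iterate)
  note [measurable] = V_measurable markov_operator.measurable_op[OF markov_operator_iterate]
  show ?thesis
  proof (rule that[of \<eta> C n])
    show "C \<ge> 0" using t1 d_pos \<kappa> by (simp add: C_def)
    fix k r j assume close: "close_after k r" and r: "r \<ge> (0::real)" and j: "j \<ge> (1::nat)"
    define D where "D = (\<kappa> * j) powr p"
    have D: "D > 0" using \<kappa> j by (simp add: D_def)
    have DC: "(threshold + 2 * n * d) / D = C / real j powr p"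
      using \<kappa> by (simp add: C_def D_def powr_mult)
    show "close_after (n + (k + j)) ((1 - \<eta>) * r + C / real j powr p)"
      unfolding close_after_def
    proof (intro ballI impI)
      fix f :: "'a \<Rightarrow> ennreal" and x x' assume f[measurable]: "f \<in> borel_measurable M" and f1: "\<forall>z\<in>S. f z \<le> 1"
        and x: "x \<in> S" "x' \<in> S" and small: "V x + V x' \<le> threshold"
      have small': "V x \<le> threshold" "V x' \<le> threshold"
        using small V_ge_1[OF x(1)] V_ge_1[OF x(2)] by auto
      let ?g = "(P ^^ (k + j)) f"
      have le: "?g z \<le> ?g z' + ennreal r + ennreal (1/D) * ennreal (V z) + ennreal (1/D) * ennreal (V z')"
        if z: "z \<in> S" "z' \<in> S" for z z'
      proof -
        have "?g z \<le> ?g z' + ennreal (r + (V z + V z') / D)"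
          using return_estimate[OF close r j f _ z] f1 by (simp add: D_def \<kappa>_def)
        also have "ennreal (r + (V z + V z') / D) = ennreal r + ennreal (1/D) * ennreal (V z) + ennreal (1/D) * ennreal (V z')"
          using V_ge_1[OF z(1)] V_ge_1[OF z(2)] D r
          by (simp add: ennreal_plus[symmetric] ennreal_mult[symmetric] add_divide_distrib algebra_simps del: ennreal_plus)
        finally show ?thesis by (simp add: add.assoc)
      qed
      have "(P ^^ n) ?g x \<le> (P ^^ n) ?g x' + ennreal ((1 - \<eta>) * r + (1/D) * ((V x + n * d) + (V x' + n * d)))"
        using le f1 x r D nu small' V_ge_1[OF x(1)] V_ge_1[OF x(2)] d_pos
        by (intro n.minorised_pair_step[where V = "\<lambda>z. ennreal (V z)" and \<nu> = \<nu>])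
          (auto intro!: iterate_V_le iterate_le_1 V_measurable simp del: ennreal_plus)
      also have "(1/D) * ((V x + n * d) + (V x' + n * d)) \<le> C / real j powr p"
      proof -
        have "(1/D) * ((V x + n * d) + (V x' + n * d)) = (V x + V x' + 2 * n * d) / D"
          by (simp add: algebra_simps add_divide_distrib)
        also have "\<dots> \<le> (threshold + 2 * n * d) / D"
          using small D by (intro divide_right_mono) auto
        finally show ?thesis unfolding DC .
      qed
      then have "ennreal ((1 - \<eta>) * r + (1/D) * ((V x + n * d) + (V x' + n * d))) \<le> ennreal ((1 - \<eta>) * r + C / real j powr p)"
        by (intro ennreal_leI) linarith
      finally show "(P ^^ (n + (k + j))) f x \<le> (P ^^ (n + (k + j))) f x' + ennreal ((1 - \<eta>) * r + C / real j powr p)"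
        by (simp add: funpow_add o_def add_left_mono)
    qed
  qed (use nu in auto)
qed

text \<open>
  With \<open>j\<close> a small fraction of \<open>k\<close>, the recursion of \<open>contraction_step\<close> is solved by a multiple of
  \<open>(k + 1) powr - p\<close>.
\<close>
lemma close_after_polynomial:
  obtains A where "A \<ge> 0" "\<And>k. close_after k (A * real (k + 1) powr - p)"
proof -
  obtain n \<eta> C where step: "0 < \<eta>" "\<eta> < 1" "C \<ge> 0"
    "\<And>k r j. close_after k r \<Longrightarrow> r \<ge> 0 \<Longrightarrow> j \<ge> 1 \<Longrightarrow> close_after (n + (k + j)) ((1 - \<eta>) * r + C / real j powr p)"
    by (rule contraction_step) blast
  \<comment> \<open>\<open>\<epsilon>\<close> is so small that shrinking the time by the factor \<open>1 - 2 \<epsilon>\<close> costs only half the gain \<open>\<eta>\<close>\<close>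
  define q where "q = ((1 - \<eta>) / (1 - \<eta>/2)) powr (1/p)"
  define \<epsilon> where "\<epsilon> = (1 - q) / 2"
  have "0 < (1 - \<eta>) / (1 - \<eta>/2)" "(1 - \<eta>) / (1 - \<eta>/2) < 1" using step by (auto simp: field_simps)
  then have q: "0 < q" "q < 1" using p_gt_1 by (auto simp: q_def powr01_less_one)
  then have \<epsilon>: "0 < \<epsilon>" "\<epsilon> < 1" "1 - 2 * \<epsilon> = q" by (auto simp: \<epsilon>_def field_simps)
  have qp: "(1 - \<eta>) * q powr - p = 1 - \<eta>/2"
  proof -
    have "q powr p = (1 - \<eta>) / (1 - \<eta>/2)" using step p_gt_1 by (simp add: q_def powr_powr)
    moreover have "1 - \<eta> \<noteq> 0" "1 - \<eta>/2 \<noteq> 0" using step by auto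
    ultimately show ?thesis by (simp add: powr_minus)
  qed
  define C' where "C' = C * (\<epsilon>/2) powr - p"
  \<comment> \<open>up to time \<open>M0\<close> the claim holds because \<open>A\<close> is at least \<open>M0 powr p\<close>\<close>
  define M0 where "M0 = nat \<lceil>2 * (n + 1) / \<epsilon>\<rceil> + 1"
  define A where "A = max (M0 powr p) (2 * C' / \<eta>)"
  have A0: "A \<ge> 0" by (simp add: A_def le_max_iff_disj)
  have "close_after k (A * real (k + 1) powr - p)" for k
  proof (induction k rule: less_induct)
    case (less k)
    show ?case
    proof (cases "k + 1 < M0")
      case True
      have "real (k + 1) powr p \<le> M0 powr p" using True p_gt_1 by (intro powr_mono2) auto
      then have "real (k + 1) powr p \<le> A" by (simp add: A_def)
      then have "1 \<le> A * real (k + 1) powr - p" by (simp add: powr_minus field_simps)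
      then have "1 \<le> ennreal (A * real (k + 1) powr - p)" by simp
      then show ?thesis unfolding close_after_def
        using iterate_le_1 by (meson add_increasing order_trans zero_le)
    next
      case False
      define L where "L = real (k + 1)"
      have L: "L \<ge> 2 * (n + 1) / \<epsilon>" "L > 0"
      proof -
        have "2 * (n + 1) / \<epsilon> \<le> real M0" unfolding M0_def by linarith
        also have "\<dots> \<le> L" using False by (simp add: L_def)
        finally show "L \<ge> 2 * (n + 1) / \<epsilon>" .
      qed (simp add: L_def)
      have eL: "\<epsilon> * L \<ge> 2 * (n + 1)" using L \<epsilon> by (simp add: field_simps)
      define j where "j = nat \<lfloor>\<epsilon> * L\<rfloor>"
      have j: "real j \<le> \<epsilon> * L" "real j > \<epsilon> * L - 1"
        unfolding j_def using eL by (auto; linarith)+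
      have j2: "real j \<ge> \<epsilon> * L / 2" "j \<ge> 1" using j eL by (auto simp: field_simps; linarith)+
      have "real (n + j) \<le> 2 * \<epsilon> * L" using j eL by auto
      also have "\<dots> < L" using \<epsilon> q L by (simp add: algebra_simps)
      finally have nj: "n + j < k + 1" by (simp add: L_def)
      define k' where "k' = k - (n + j)"
      have k': "k = n + (k' + j)" "k' < k" using nj j2 by (auto simp: k'_def)
      have Lk': "real (k' + 1) \<ge> q * L"
      proof -
        have "real (k' + 1) = L - real (n + j)" using k' by (simp add: L_def)
        also have "\<dots> \<ge> L - 2 * \<epsilon> * L" using \<open>real (n + j) \<le> 2 * \<epsilon> * L\<close> by simp
        finally show ?thesis using \<epsilon>(3) by (simp add: algebra_simps flip: \<epsilon>(3))
      qed
      have "close_after k ((1 - \<eta>) * (A * real (k' + 1) powr - p) + C / real j powr p)"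
        using step(4)[OF less.IH[OF k'(2)] _ j2(2)] A0 k' by auto
      moreover have "(1 - \<eta>) * (A * real (k' + 1) powr - p) + C / real j powr p \<le> A * L powr - p"
      proof -
        have "real (k' + 1) powr - p \<le> (q * L) powr - p"
          using Lk' q L p_gt_1 by (intro powr_mono2') auto
        also have "\<dots> = q powr - p * L powr - p" using q L by (simp add: powr_mult)
        finally have "(1 - \<eta>) * (A * real (k' + 1) powr - p) \<le> (1 - \<eta>) * (A * (q powr - p * L powr - p))"
          using step A0 by (intro mult_left_mono) auto
        also have "\<dots> = A * (1 - \<eta>/2) * L powr - p" by (simp add: qp[symmetric])
        finally have 1: "(1 - \<eta>) * (A * real (k' + 1) powr - p) \<le> A * (1 - \<eta>/2) * L powr - p" .
        have "real j powr - p \<le> ((\<epsilon>/2) * L) powr - p"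
          using j2 \<epsilon> L p_gt_1 by (intro powr_mono2') auto
        also have "\<dots> = (\<epsilon>/2) powr - p * L powr - p" by (simp only: powr_mult)
        finally have "C * real j powr - p \<le> C * ((\<epsilon>/2) powr - p * L powr - p)"
          using step by (intro mult_left_mono) auto
        then have 2: "C / real j powr p \<le> C' * L powr - p"
          by (simp add: C'_def powr_minus field_simps)
        have "2 * C' / \<eta> \<le> A" by (simp add: A_def)
        then have "C' \<le> A * (\<eta>/2)" using step by (simp add: field_simps)
        then have "C' * L powr - p \<le> A * (\<eta>/2) * L powr - p" by (intro mult_right_mono) auto
        with 1 2 show ?thesis by (simp add: algebra_simps)
      qed
      ultimately show ?thesis by (auto simp: L_def elim!: close_after_mono)
    qed
  qed
  with A0 show ?thesis by (rule that)
qed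

text \<open>
  The first half of the time is used for returning below the threshold, the second half for the
  contraction there.
\<close>
theorem polynomial_contraction:
  obtains C where "C \<ge> 0" "\<And>f k x x'. f \<in> borel_measurable M \<Longrightarrow> \<forall>z\<in>S. f z \<le> 1 \<Longrightarrow> x \<in> S \<Longrightarrow> x' \<in> S \<Longrightarrow>
    (P ^^ k) f x \<le> (P ^^ k) f x' + ennreal (C * (V x + V x') * real (k + 1) powr - p)"
proof -
  obtain A where A: "A \<ge> 0" "\<And>k. close_after k (A * real (k + 1) powr - p)"
    by (rule close_after_polynomial) blast
  define \<kappa> where "\<kappa> = c / (4 * p)"
  have \<kappa>: "\<kappa> > 0" using c_bounds p_gt_1 by (simp add: \<kappa>_def)
  define C where "C = 1 + (A + \<kappa> powr - p) * (1/4) powr - p"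
  have C: "C \<ge> 1" using A by (simp add: C_def)
  have "(P ^^ k) f x \<le> (P ^^ k) f x' + ennreal (C * (V x + V x') * real (k + 1) powr - p)"
    if f: "f \<in> borel_measurable M" and f1: "\<forall>z\<in>S. f z \<le> 1" and x: "x \<in> S" "x' \<in> S" for f k x x'
  proof (cases "k = 0")
    case True
    have "1 * 1 \<le> C * (V x + V x')"
      using C V_ge_1[OF x(1)] V_ge_1[OF x(2)] by (intro mult_mono) auto
    then have "1 \<le> ennreal (C * (V x + V x'))" by simp
    moreover have "f x \<le> 1" using f1 x(1) by blast
    ultimately show ?thesis using True by (simp add: order_trans[OF _ add_increasing])
  next
    case False
    define L where "L = real (k + 1)"
    define l where "l = k div 2"
    define j where "j = k - l"
    have j: "j \<ge> 1" "k = l + j" "real j \<ge> 1/4 * L" "real (l + 1) \<ge> 1/4 * L"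
      using False by (auto simp: j_def l_def L_def)
    have L: "L > 0" by (simp add: L_def)
    have mono: "t powr - p \<le> (1/4) powr - p * L powr - p" if "t \<ge> 1/4 * L" for t
    proof -
      have "t powr - p \<le> (1/4 * L) powr - p" using that L p_gt_1 by (intro powr_mono2') auto
      also have "\<dots> = (1/4) powr - p * L powr - p" by (simp only: powr_mult)
      finally show ?thesis .
    qed
    have W: "V x + V x' \<ge> 1" using V_ge_1[OF x(1)] V_ge_1[OF x(2)] by simp
    have "(P ^^ k) f x \<le> (P ^^ k) f x' + ennreal (A * real (l + 1) powr - p + (V x + V x') / (\<kappa> * j) powr p)"
      unfolding j(2) \<kappa>_def by (rule return_estimate[OF A(2) _ j(1) f _ x]) (use A(1) f1 in auto)
    also have "A * real (l + 1) powr - p + (V x + V x') / (\<kappa> * j) powr p \<le> C * (V x + V x') * L powr - p"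
    proof -
      have 1: "A * real (l + 1) powr - p \<le> A * (V x + V x') * ((1/4) powr - p * L powr - p)"
        using A W mono[OF j(4)] by (intro mult_mono) (auto intro: mult_nonneg_nonneg mult_left_mono[of 1 _ A, simplified])
      have "(V x + V x') / (\<kappa> * j) powr p = (V x + V x') * \<kappa> powr - p * real j powr - p"
        using \<kappa> by (simp add: powr_mult powr_minus field_simps)
      also have "\<dots> \<le> (V x + V x') * \<kappa> powr - p * ((1/4) powr - p * L powr - p)"
        using W mono[OF j(3)] by (intro mult_left_mono) auto
      finally have "A * real (l + 1) powr - p + (V x + V x') / (\<kappa> * j) powr p
          \<le> (C - 1) * (V x + V x') * L powr - p" using 1 by (simp add: C_def algebra_simps)
      also have "\<dots> \<le> C * (V x + V x') * L powr - p"
        using W by (intro mult_right_mono) auto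
      finally show ?thesis .
    qed
    then have "ennreal (A * real (l + 1) powr - p + (V x + V x') / (\<kappa> * j) powr p) \<le> ennreal (C * (V x + V x') * L powr - p)"
      by (rule ennreal_leI)
    finally show ?thesis by (simp add: L_def add_left_mono)
  qed
  with C show ?thesis by (intro that[of C]) auto
qed

end

section \<open>The process as a uniformised jump chain\<close>

definition unit_uniform :: "real measure" where
  "unit_uniform = uniform_measure lborel {0<..<1}"

definition ring_average :: "'m::finite \<Rightarrow> ('m state \<Rightarrow> ennreal) \<Rightarrow> 'm state \<Rightarrow> ennreal" where
  "ring_average i f s = (\<integral>\<^sup>+u. f (ring_update i u s) \<partial>unit_uniform)"

definition total_rate :: "'m::finite state \<Rightarrow> real" where
  "total_rate s = (\<Sum>i\<in>UNIV. sqrt (fst s $ i))"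

text \<open>
  One step of the jump chain whose total ring rate is brought up to the constant \<open>\<Lambda>\<close> by idle rings,
  which leave the state unchanged.
\<close>
definition uniformised :: "real \<Rightarrow> ('m::finite state \<Rightarrow> ennreal) \<Rightarrow> 'm state \<Rightarrow> ennreal" where
  "uniformised \<Lambda> f s = ennreal (1 - total_rate s / \<Lambda>) * f s
     + (\<Sum>i\<in>UNIV. ennreal (sqrt (fst s $ i) / \<Lambda>) * ring_average i f s)"

lemma unit_uniform_prob [simp]: "prob_space unit_uniform"
  unfolding unit_uniform_def by (rule prob_space_uniform_measure) auto

lemma sets_unit_uniform [simp, measurable_cong]: "sets unit_uniform = sets borel"
  by (simp add: unit_uniform_def)

lemma space_unit_uniform [simp]: "space unit_uniform = UNIV"
  by (simp add: unit_uniform_def)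

lemma AE_unit_uniform: "AE u in unit_uniform. 0 < u \<and> u < 1"
  unfolding unit_uniform_def by (rule AE_uniform_measureI) auto

lemma nn_integral_unit_uniform:
  "f \<in> borel_measurable borel \<Longrightarrow> (\<integral>\<^sup>+u. f u \<partial>unit_uniform) = (\<integral>\<^sup>+u. f u * indicator {0<..<1} u \<partial>lborel)"
  unfolding unit_uniform_def by (subst nn_integral_uniform_measure) (auto simp: divide_ennreal_def)

lemma ring_update_simps [simp]:
  "fst (ring_update i u s) $ j = (if j = i then snd s + (1 - u\<^sup>2) * fst s $ i else fst s $ j)"
  "snd (ring_update i u s) = u\<^sup>2 * fst s $ i"
  by (auto simp: ring_update_def split: prod.split)

lemma energy_simplex_iff:
  "s \<in> energy_simplex E \<longleftrightarrow> (\<forall>i. 0 < fst s $ i) \<and> 0 < snd s \<and> snd s + (\<Sum>i\<in>UNIV. fst s $ i) = E"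
  by (cases s) (simp add: energy_simplex_def)

lemma ring_update_in_simplex:
  assumes "s \<in> energy_simplex E" "0 < u" "u < 1"
  shows "ring_update i u s \<in> energy_simplex E"
proof -
  have u2: "0 < u\<^sup>2" "u\<^sup>2 < 1" using assms by (auto simp: power_less_one_iff)
  have "(\<Sum>j\<in>UNIV. fst (ring_update i u s) $ j)
      = (\<Sum>j\<in>UNIV. fst s $ j + (if j = i then snd s - u\<^sup>2 * fst s $ i else 0))"
    by (intro sum.cong) (auto simp: algebra_simps)
  then have "(\<Sum>j\<in>UNIV. fst (ring_update i u s) $ j) = (\<Sum>j\<in>UNIV. fst s $ j) + (snd s - u\<^sup>2 * fst s $ i)"
    by (simp add: sum.distrib)
  moreover have "0 < snd s + (1 - u\<^sup>2) * fst s $ i"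
    using assms u2 by (intro add_pos_nonneg mult_nonneg_nonneg) (auto simp: energy_simplex_iff less_imp_le)
  ultimately show ?thesis using assms u2 by (auto simp: energy_simplex_iff)
qed

lemma measurable_ring_update [measurable]:
  "(\<lambda>(u, s). ring_update i u s) \<in> borel \<Otimes>\<^sub>M borel \<rightarrow>\<^sub>M (borel :: 'm::finite state measure)"
proof -
  have "continuous_on UNIV (\<lambda>z::real \<times> 'm state. if j = i then snd (snd z) + (1 - (fst z)\<^sup>2) * fst (snd z) $ i
      else fst (snd z) $ j)" for j
    by (cases "j = i") (auto intro!: continuous_intros)
  then have "continuous_on UNIV (\<lambda>z::real \<times> 'm state. ring_update i (fst z) (snd z))"
    unfolding ring_update_def case_prod_unfold
    by (intro continuous_on_Pair continuous_on_vec_lambda) (auto intro!: continuous_intros)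
  then show ?thesis
    unfolding borel_prod case_prod_unfold by (rule borel_measurable_continuous_onI)
qed

lemma measurable_coord [measurable]: "(\<lambda>s::'m::finite state. fst s $ i) \<in> borel_measurable borel"
  by (intro borel_measurable_continuous_onI continuous_intros)

lemma measurable_snd_state [measurable]: "(snd :: 'm::finite state \<Rightarrow> real) \<in> borel_measurable borel"
  by (intro borel_measurable_continuous_onI continuous_intros)

lemma measurable_total_rate [measurable]: "total_rate \<in> borel_measurable borel"
  unfolding total_rate_def by measurable

lemma energy_simplex_measurable [measurable]: "(energy_simplex E :: 'm::finite state set) \<in> sets borel"
proof -
  have "(energy_simplex E :: 'm state set) =
      {s \<in> space borel. (\<forall>i. 0 < fst s $ i) \<and> 0 < snd s \<and> snd s + (\<Sum>i\<in>UNIV. fst s $ i) = E}"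
    by (auto simp: energy_simplex_iff)
  also have "\<dots> \<in> sets borel" by measurable
  finally show ?thesis .
qed

lemma measurable_ring_average [measurable]:
  assumes [measurable]: "f \<in> borel_measurable borel"
  shows "ring_average i f \<in> borel_measurable borel"
proof -
  interpret prob_space unit_uniform by simp
  show ?thesis unfolding ring_average_def by measurable
qed

lemma ring_average_mono:
  assumes "\<And>z. z \<in> energy_simplex E \<Longrightarrow> f z \<le> g z" "s \<in> energy_simplex E"
  shows "ring_average i f s \<le> ring_average i g s"
  unfolding ring_average_def
proof (rule nn_integral_mono_AE)
  show "AE u in unit_uniform. f (ring_update i u s) \<le> g (ring_update i u s)"
    using AE_unit_uniform by eventually_elim (use assms ring_update_in_simplex in blast)
qed

lemma measurable_ring_update' [measurable]: "(\<lambda>u. ring_update i u s) \<in> borel \<rightarrow>\<^sub>M borel"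
  using measurable_compose[OF measurable_Pair2'[of s borel borel] measurable_ring_update, of i] by simp

lemma ring_average_add:
  "f \<in> borel_measurable borel \<Longrightarrow> g \<in> borel_measurable borel \<Longrightarrow>
    ring_average i (\<lambda>z. f z + g z) s = ring_average i f s + ring_average i g s"
  unfolding ring_average_def by (rule nn_integral_add) auto

lemma ring_average_cmult:
  "f \<in> borel_measurable borel \<Longrightarrow> ring_average i (\<lambda>z. k * f z) s = k * ring_average i f s"
  unfolding ring_average_def by (rule nn_integral_cmult) auto

lemma ring_average_one: "ring_average i (\<lambda>_. 1) s = 1"
  unfolding ring_average_def using prob_space.emeasure_space_1[OF unit_uniform_prob] by simp

lemma uniformised_weights:
  assumes "s \<in> energy_simplex E" "total_rate s \<le> \<Lambda>" "\<Lambda> > 0"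
  shows "ennreal (1 - total_rate s / \<Lambda>) + (\<Sum>i\<in>UNIV. ennreal (sqrt (fst s $ i) / \<Lambda>)) = 1"
proof -
  have "(\<Sum>i\<in>UNIV. ennreal (sqrt (fst s $ i) / \<Lambda>)) = ennreal (total_rate s / \<Lambda>)"
    unfolding total_rate_def using assms
    by (subst sum_ennreal) (auto simp: energy_simplex_iff sum_divide_distrib less_imp_le)
  moreover have "total_rate s / \<Lambda> \<ge> 0"
    unfolding total_rate_def using assms
    by (intro divide_nonneg_pos sum_nonneg real_sqrt_ge_zero) (auto simp: energy_simplex_iff less_imp_le)
  ultimately show ?thesis using assms
    by (simp add: ennreal_plus[symmetric] del: ennreal_plus)
qed

lemma markov_operator_uniformised:
  assumes "\<And>s::'m::finite state. s \<in> energy_simplex E \<Longrightarrow> total_rate s \<le> \<Lambda>" "\<Lambda> > 0"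
  shows "markov_operator (energy_simplex E :: 'm state set) borel (uniformised \<Lambda>)"
proof
  show "uniformised \<Lambda> f \<in> borel_measurable borel" if [measurable]: "f \<in> borel_measurable borel"
    for f :: "'m state \<Rightarrow> ennreal"
    unfolding uniformised_def by measurable
  show "uniformised \<Lambda> f s \<le> uniformised \<Lambda> g s"
    if "\<And>z. z \<in> energy_simplex E \<Longrightarrow> f z \<le> g z" "s \<in> energy_simplex E" for f g and s :: "'m state"
    unfolding uniformised_def
    by (intro add_mono sum_mono mult_left_mono that ring_average_mono[OF that]) auto
  show "uniformised \<Lambda> (\<lambda>z. f z + g z) s = uniformised \<Lambda> f s + uniformised \<Lambda> g s"
    if "f \<in> borel_measurable borel" "g \<in> borel_measurable borel" for f g and s :: "'m state"
    using that by (simp add: uniformised_def ring_average_add distrib_left sum.distrib)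
  show "uniformised \<Lambda> (\<lambda>z. k * f z) s = k * uniformised \<Lambda> f s"
    if "f \<in> borel_measurable borel" for f k and s :: "'m state"
    using that by (simp add: uniformised_def ring_average_cmult distrib_left sum_distrib_left mult.left_commute)
  show "uniformised \<Lambda> (\<lambda>_. 1) s = 1" if "s \<in> energy_simplex E" for s :: "'m state"
    using uniformised_weights[OF that assms(1)[OF that] assms(2)]
    by (simp add: uniformised_def ring_average_one)
qed

lemma coord_le_energy:
  assumes "s \<in> energy_simplex E"
  shows "fst s $ i < E" "snd s < E" "fst s $ i + snd s \<le> E"
proof -
  have pos: "\<forall>j. 0 < fst s $ j" "0 < snd s" "snd s + (\<Sum>j\<in>UNIV. fst s $ j) = E"
    using assms unfolding energy_simplex_iff by blast+
  have "(\<Sum>j\<in>UNIV. fst s $ j) \<ge> fst s $ i"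
    by (rule member_le_sum) (use pos in \<open>auto intro: less_imp_le\<close>)
  moreover have "0 < fst s $ i" using pos by blast
  ultimately show "fst s $ i < E" "snd s < E" "fst s $ i + snd s \<le> E"
    using pos(2,3) by linarith+
qed

lemma total_rate_le:
  fixes s :: "'m::finite state"
  assumes "s \<in> energy_simplex E"
  shows "total_rate s \<le> CARD('m) * sqrt E"
proof -
  have "total_rate s \<le> (\<Sum>i\<in>(UNIV::'m set). sqrt E)"
    unfolding total_rate_def using coord_le_energy[OF assms] by (intro sum_mono) (auto intro: less_imp_le)
  then show ?thesis by simp
qed

section \<open>A Lyapunov function\<close>

lemma nn_integral_powr_from_0:
  fixes a c :: real
  assumes "a > -1" "c \<ge> 0"
  shows "(\<integral>\<^sup>+x. ennreal (x powr a) * indicator {0<..<c} x \<partial>lborel) = ennreal (c powr (a + 1) / (a + 1))"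
proof -
  have "((\<lambda>x. x powr a) has_integral (c powr (a + 1) / (a + 1))) {0..c}"
    using has_integral_powr_from_0[of a c] assms by simp
  then have "((\<lambda>x. x powr a) has_integral (c powr (a + 1) / (a + 1))) {0<..<c}"
    by (rule has_integral_Icc_iff_Ioo[THEN iffD1])
  then have "((\<lambda>x. if x \<in> {0<..<c} then x powr a else 0) has_integral (c powr (a + 1) / (a + 1))) UNIV"
    by (subst has_integral_restrict_UNIV)
  then have "(\<integral>\<^sup>+x. ennreal (if x \<in> {0<..<c} then x powr a else 0) \<partial>lborel) = ennreal (c powr (a + 1) / (a + 1))"
    by (intro nn_integral_has_integral_lborel) auto
  also have "(\<lambda>x. ennreal (if x \<in> {0<..<c} then x powr a else 0)) = (\<lambda>x. ennreal (x powr a) * indicator {0<..<c} x)"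
    by (auto simp: indicator_def)
  finally show ?thesis .
qed

lemma nn_integral_reflect:
  fixes f :: "real \<Rightarrow> ennreal" and c :: real
  assumes [measurable]: "f \<in> borel_measurable borel"
  shows "(\<integral>\<^sup>+x. f (c - x) \<partial>lborel) = (\<integral>\<^sup>+x. f x \<partial>lborel)"
  using nn_integral_real_affine[of f "-1" c] assms by simp

lemma nn_integral_powr_upto:
  fixes a c :: real
  assumes "a > -1" "c \<ge> 0"
  shows "(\<integral>\<^sup>+x. ennreal ((c - x) powr a) * indicator {0<..<c} x \<partial>lborel) = ennreal (c powr (a + 1) / (a + 1))"
proof -
  have "(\<integral>\<^sup>+x. ennreal ((c - x) powr a) * indicator {0<..<c} x \<partial>lborel)
      = (\<integral>\<^sup>+x. (\<lambda>x. ennreal (x powr a) * indicator {0<..<c} x) (c - x) \<partial>lborel)"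
    by (intro nn_integral_cong) (auto simp: indicator_def)
  also have "\<dots> = (\<integral>\<^sup>+x. ennreal (x powr a) * indicator {0<..<c} x \<partial>lborel)"
    by (rule nn_integral_reflect) measurable
  finally show ?thesis using nn_integral_powr_from_0[OF assms] by simp
qed

text \<open>
  The exponent of \<open>y\<close> is such that its term controls the possible increase of the particle terms,
  which is of order \<open>x i powr - (a - 1/2)\<close>. The summand \<open>1\<close> only keeps the function away from \<open>0\<close>.
\<close>
definition lyapunov :: "real \<Rightarrow> real \<Rightarrow> 'm::finite state \<Rightarrow> real" where
  "lyapunov a K s = 1 + (\<Sum>i\<in>UNIV. fst s $ i powr - a) + K * snd s powr - (a - 1/2)"

lemma lyapunov_ge_1: "K \<ge> 0 \<Longrightarrow> lyapunov a K s \<ge> 1"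
  unfolding lyapunov_def by (simp add: add_nonneg_nonneg sum_nonneg)

lemma measurable_lyapunov [measurable]: "lyapunov a K \<in> borel_measurable borel"
  unfolding lyapunov_def by measurable

text \<open>
  After the ring, the energy \<open>y + (1 - u\<^sup>2) * x\<close> of the particle is at least \<open>y\<close> and at least \<open>(1 - u) * x\<close>,
  and \<open>(1 - u) powr - a\<close> has a finite mean since \<open>a < 1\<close>; the energy \<open>u\<^sup>2 * x\<close> of the tank contributes
  \<open>u powr - (2 * b)\<close>, which has a finite mean since \<open>2 * b < 1\<close>.
\<close>
lemma ring_average_lyapunov:
  fixes s :: "'m::finite state" and i :: 'm
  assumes s: "s \<in> energy_simplex E" and a: "1/2 < a" "a < 1" and K: "K \<ge> 0"
  defines "x \<equiv> fst s $ i" and "y \<equiv> snd s" and "b \<equiv> a - 1/2"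
  shows "ring_average i (\<lambda>z. ennreal (lyapunov a K z)) s \<le>
    ennreal (lyapunov a K s + (min (y powr - a) (x powr - a / (1 - a)) - x powr - a)
      + K * (x powr - b / (1 - 2 * b) - y powr - b))"
proof -
  have pos: "x > 0" "y > 0" using s by (auto simp: energy_simplex_iff x_def y_def)
  have b: "0 < b" "b < 1/2" using a by (auto simp: b_def)
  define R where "R = 1 + (\<Sum>j\<in>UNIV - {i}. fst s $ j powr - a)"
  have R: "R \<ge> 0" by (auto simp: R_def intro!: add_nonneg_nonneg sum_nonneg)
  have Vs: "lyapunov a K s = R + x powr - a + K * y powr - b"
    unfolding lyapunov_def R_def x_def y_def b_def by (subst sum.remove[of UNIV i]) auto
  have Vu: "lyapunov a K (ring_update i u s) = R + (y + (1 - u\<^sup>2) * x) powr - a + K * (u\<^sup>2 * x) powr - b" for u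
    unfolding lyapunov_def R_def x_def y_def b_def
    by (subst sum.remove[of UNIV i]) (auto intro!: sum.cong)
  have iu: "(\<integral>\<^sup>+u. ennreal (u powr - (2 * b)) \<partial>unit_uniform) = ennreal (1 / (1 - 2 * b))"
    using nn_integral_powr_from_0[of "- (2 * b)" 1] b by (subst nn_integral_unit_uniform) auto
  have iu': "(\<integral>\<^sup>+u. ennreal ((1 - u) powr - a) \<partial>unit_uniform) = ennreal (1 / (1 - a))"
    using nn_integral_powr_upto[of "- a" 1] a by (subst nn_integral_unit_uniform) auto
  have U1: "emeasure unit_uniform UNIV = 1"
    using prob_space.emeasure_space_1[OF unit_uniform_prob] by simp
  have gen: "ring_average i (\<lambda>z. ennreal (lyapunov a K z)) s \<le>
      ennreal (R + B + K * (x powr - b / (1 - 2 * b)))"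
    if [measurable]: "g \<in> borel_measurable borel" and g: "\<And>u. 0 < u \<Longrightarrow> u < 1 \<Longrightarrow> (y + (1 - u\<^sup>2) * x) powr - a \<le> g u"
      and gi: "(\<integral>\<^sup>+u. ennreal (g u) \<partial>unit_uniform) = ennreal B" and B: "B \<ge> 0" for g B
  proof -
    have "ring_average i (\<lambda>z. ennreal (lyapunov a K z)) s \<le>
        (\<integral>\<^sup>+u. ennreal R + ennreal (g u) + ennreal (K * x powr - b) * ennreal (u powr - (2 * b)) \<partial>unit_uniform)"
      unfolding ring_average_def
    proof (rule nn_integral_mono_AE)
      show "AE u in unit_uniform. ennreal (lyapunov a K (ring_update i u s))
          \<le> ennreal R + ennreal (g u) + ennreal (K * x powr - b) * ennreal (u powr - (2 * b))"
        using AE_unit_uniform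
      proof eventually_elim
        case (elim u)
        have "(u\<^sup>2 * x) powr - b = x powr - b * u powr - (2 * b)"
          using elim pos by (simp add: powr_mult powr_powr flip: powr_numeral)
        moreover have "0 \<le> g u" using g[of u] elim by (meson order_trans powr_ge_zero)
        ultimately show ?case unfolding Vu using R K g[of u] elim
          by (simp add: ennreal_mult[symmetric] ennreal_plus[symmetric] mult.assoc del: ennreal_plus)
      qed
    qed
    also have "\<dots> = ennreal R + ennreal B + ennreal (K * x powr - b) * ennreal (1 / (1 - 2 * b))"
      by (simp add: nn_integral_add nn_integral_cmult U1 gi iu)
    also have "\<dots> = ennreal (R + B + K * (x powr - b / (1 - 2 * b)))"
      using R B K b by (simp add: ennreal_mult[symmetric] ennreal_plus[symmetric] del: ennreal_plus)
    finally show ?thesis .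
  qed
  have "ring_average i (\<lambda>z. ennreal (lyapunov a K z)) s \<le>
      ennreal (R + y powr - a + K * (x powr - b / (1 - 2 * b)))"
  proof (rule gen)
    show "(y + (1 - u\<^sup>2) * x) powr - a \<le> y powr - a" if "0 < u" "u < 1" for u
    proof (rule powr_mono2')
      have "0 \<le> (1 - u\<^sup>2) * x" using that pos by (intro mult_nonneg_nonneg) (auto simp: power_le_one)
      then show "y \<le> y + (1 - u\<^sup>2) * x" by simp
    qed (use a pos in auto)
  qed (auto simp: U1)
  moreover have "ring_average i (\<lambda>z. ennreal (lyapunov a K z)) s \<le>
      ennreal (R + x powr - a * (1 / (1 - a)) + K * (x powr - b / (1 - 2 * b)))"
  proof (rule gen)
    show "(y + (1 - u\<^sup>2) * x) powr - a \<le> x powr - a * (1 - u) powr - a" if "0 < u" "u < 1" for u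
    proof -
      have "u\<^sup>2 \<le> u" using that by (simp add: power2_eq_square mult_left_le_one_le)
      then have "x * (1 - u) \<le> (1 - u\<^sup>2) * x" using pos by (simp add: mult.commute)
      then have "x * (1 - u) \<le> y + (1 - u\<^sup>2) * x" using pos by linarith
      then have "(y + (1 - u\<^sup>2) * x) powr - a \<le> (x * (1 - u)) powr - a"
        using that pos a by (intro powr_mono2') auto
      then show ?thesis by (simp only: powr_mult)
    qed
    show "(\<integral>\<^sup>+u. ennreal (x powr - a * (1 - u) powr - a) \<partial>unit_uniform) = ennreal (x powr - a * (1 / (1 - a)))"
      using a by (simp add: ennreal_mult nn_integral_cmult iu' del: times_divide_eq_right mult_1_right)
  qed (use a in auto)
  ultimately have "ring_average i (\<lambda>z. ennreal (lyapunov a K z)) s \<le>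
      ennreal (R + min (y powr - a) (x powr - a / (1 - a)) + K * (x powr - b / (1 - 2 * b)))"
    by (auto simp: min_def)
  then show ?thesis unfolding Vs by (simp add: algebra_simps)
qed

text \<open>
  If \<open>y\<close> is at least a fixed multiple of \<open>x\<close>, then the ring at least halves \<open>x powr - a\<close>. Otherwise the
  possible increase, of order \<open>sqrt x * x powr - a = x powr - (a - 1/2)\<close>, is bounded by the same power of \<open>y\<close>.
\<close>
lemma particle_drift:
  fixes a x y :: real
  assumes "x > 0" "y > 0" "1/2 < a" "a < 1"
  shows "sqrt x * (min (y powr - a) (x powr - a / (1 - a)) - x powr - a)
    \<le> - (1/2) * x powr - (a - 1/2) + 2 / (1 - a) * y powr - (a - 1/2)"
proof -
  define b where "b = a - 1/2"
  have b: "0 < b" "b < 1/2" "b < a" using assms by (auto simp: b_def)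
  have sx: "sqrt x * x powr - a = x powr - b"
    using assms by (simp add: b_def powr_half_sqrt[symmetric] flip: powr_add)
  show ?thesis
  proof (cases "x powr - a \<ge> 2 * y powr - a")
    case True
    have "sqrt x * (min (y powr - a) (x powr - a / (1 - a)) - x powr - a) \<le> sqrt x * (- (1/2) * x powr - a)"
      using True assms by (intro mult_left_mono) auto
    also have "\<dots> = - (1/2) * x powr - b" using sx by simp
    also have "\<dots> \<le> - (1/2) * x powr - b + 2 / (1 - a) * y powr - b" using assms by simp
    finally show ?thesis by (simp add: b_def)
  next
    case False
    have "x powr - b = (x powr - a) powr (b/a)" using assms by (simp add: powr_powr)
    also have "\<dots> \<le> (2 * y powr - a) powr (b/a)" using False assms b by (intro powr_mono2) auto
    also have "\<dots> = 2 powr (b/a) * y powr - b" using assms by (simp add: powr_mult powr_powr)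
    also have "\<dots> \<le> 2 powr 1 * y powr - b" using b assms by (intro mult_right_mono powr_mono) auto
    finally have xy: "x powr - b \<le> 2 * y powr - b" by simp
    have "sqrt x * (min (y powr - a) (x powr - a / (1 - a)) - x powr - a)
        \<le> sqrt x * (x powr - a / (1 - a) - x powr - a)"
      using assms by (intro mult_left_mono) auto
    also have "\<dots> = (sqrt x * x powr - a) * (1 / (1 - a) - 1)"
      by (simp add: algebra_simps)
    also have "\<dots> \<le> - (1/2) * x powr - b + 1 / (1 - a) * x powr - b"
      unfolding sx by (simp add: algebra_simps)
    also have "\<dots> \<le> - (1/2) * x powr - b + 1 / (1 - a) * (2 * y powr - b)"
      using xy assms by (intro add_left_mono mult_left_mono) auto
    finally show ?thesis by (simp add: b_def)
  qed
qed

text \<open>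
  Every ring refills the tank, and while \<open>y \<le> E/2\<close> the total rate is at least
  \<open>sqrt (E - y) \<ge> sqrt (E/2)\<close>.
\<close>
lemma tank_drift:
  fixes s :: "'m::finite state"
  assumes s: "s \<in> energy_simplex E" and b: "0 < b" "b < 1/2"
  shows "(\<Sum>i\<in>UNIV. sqrt (fst s $ i) * (fst s $ i powr - b / (1 - 2 * b) - snd s powr - b))
    \<le> CARD('m) * E powr (1/2 - b) / (1 - 2 * b) + sqrt (E/2) * (E/2) powr - b - sqrt (E/2) * snd s powr - b"
proof -
  define y where "y = snd s"
  have pos: "\<And>i. fst s $ i > 0" "y > 0" "y + (\<Sum>i\<in>UNIV. fst s $ i) = E"
    using s by (auto simp: energy_simplex_iff y_def)
  have E: "E > 0" using pos coord_le_energy(2)[OF s] by (simp add: y_def)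
  have 1: "(\<Sum>i\<in>UNIV. sqrt (fst s $ i) * (fst s $ i powr - b / (1 - 2 * b))) \<le> (\<Sum>i\<in>(UNIV::'m set). E powr (1/2 - b) / (1 - 2 * b))"
  proof (rule sum_mono)
    fix i :: 'm
    have "sqrt (fst s $ i) * fst s $ i powr - b = fst s $ i powr (1/2 - b)"
      using pos(1)[of i] by (simp add: powr_half_sqrt[symmetric] flip: powr_add)
    also have "\<dots> \<le> E powr (1/2 - b)"
      using pos(1)[of i] b coord_le_energy(1)[OF s, of i] by (intro powr_mono2) auto
    finally show "sqrt (fst s $ i) * (fst s $ i powr - b / (1 - 2 * b)) \<le> E powr (1/2 - b) / (1 - 2 * b)"
      using b by (simp add: divide_right_mono)
  qed
  have rate: "sqrt (E - y) \<le> total_rate s"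
  proof -
    have "E - y = (\<Sum>i\<in>UNIV. fst s $ i)" using pos by simp
    moreover have "sqrt (\<Sum>i\<in>A. fst s $ i) \<le> (\<Sum>i\<in>A. sqrt (fst s $ i))" for A
    proof (induction A rule: infinite_finite_induct)
      case (insert i A)
      have "sqrt (fst s $ i + (\<Sum>i\<in>A. fst s $ i)) \<le> sqrt (fst s $ i) + sqrt (\<Sum>i\<in>A. fst s $ i)"
        using pos(1) by (intro sqrt_add_le_add_sqrt) (auto intro!: sum_nonneg intro: less_imp_le)
      with insert show ?case by simp
    qed auto
    ultimately show ?thesis by (simp add: total_rate_def)
  qed
  have 2: "sqrt (E/2) * y powr - b - sqrt (E/2) * (E/2) powr - b \<le> total_rate s * y powr - b"
  proof (cases "y \<le> E/2")
    case True
    have "sqrt (E/2) \<le> sqrt (E - y)" using True by simp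
    then have "sqrt (E/2) * y powr - b \<le> total_rate s * y powr - b"
      using order_trans[OF _ rate] by (intro mult_right_mono) auto
    moreover have "sqrt (E/2) * (E/2) powr - b \<ge> 0" using E by simp
    ultimately show ?thesis by linarith
  next
    case False
    then have "y powr - b \<le> (E/2) powr - b" using b E by (intro powr_mono2') auto
    then have "sqrt (E/2) * y powr - b \<le> sqrt (E/2) * (E/2) powr - b" using E by (intro mult_left_mono) auto
    moreover have "total_rate s * y powr - b \<ge> 0"
      unfolding total_rate_def using pos
      by (intro mult_nonneg_nonneg sum_nonneg real_sqrt_ge_zero) (auto simp: less_imp_le)
    ultimately show ?thesis by linarith
  qed
  have "(\<Sum>i\<in>UNIV. sqrt (fst s $ i) * (fst s $ i powr - b / (1 - 2 * b) - y powr - b))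
      = (\<Sum>i\<in>UNIV. sqrt (fst s $ i) * (fst s $ i powr - b / (1 - 2 * b))) - total_rate s * y powr - b"
    by (simp add: total_rate_def right_diff_distrib sum_subtractf sum_distrib_right)
  then show ?thesis using 1 2 by (simp add: y_def)
qed


text \<open>
  Converts the dissipation, a sum of powers with exponent \<open>-b\<close>, into a power of the Lyapunov function:
  with \<open>m\<close> the right-hand sum, each term of \<open>lyapunov a K s\<close> is at most a multiple of \<open>m powr (a/b)\<close>.
\<close>
lemma lyapunov_power_le:
  fixes s :: "'m::finite state"
  assumes s: "s \<in> energy_simplex E" and a: "1/2 < a" "a < 1" and K: "K \<ge> 0"
  defines "b \<equiv> a - 1/2"
  shows "lyapunov a K s powr (b/a) \<le> (E powr a + CARD('m) + K * sqrt E) powr (b/a) *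
    ((\<Sum>i\<in>UNIV. fst s $ i powr - b) + snd s powr - b)"
proof -
  have pos: "\<And>i. fst s $ i > 0" "snd s > 0"
    using s by (auto simp: energy_simplex_iff)
  have E: "E > 0" using pos coord_le_energy(2)[OF s] by simp
  have b: "0 < b" "b < a" using a by (auto simp: b_def)
  define m where "m = (\<Sum>i\<in>UNIV. fst s $ i powr - b) + snd s powr - b"
  have x_le: "fst s $ i powr - b \<le> m" for i
    unfolding m_def using member_le_sum[of i UNIV "\<lambda>i. fst s $ i powr - b"] by (simp add: add_increasing2)
  have y_le: "snd s powr - b \<le> m" unfolding m_def by (simp add: sum_nonneg)
  have "E powr - b \<le> snd s powr - b"
    using pos coord_le_energy(2)[OF s] b by (intro powr_mono2') auto
  then have E_le: "E powr - b \<le> m" using y_le by simp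
  have m: "m > 0" by (rule less_le_trans[OF _ E_le]) (use E in simp)
  have up: "t powr - a \<le> m powr (a/b)" if "t powr - b \<le> m" for t
  proof -
    have "t powr - a = (t powr - b) powr (a/b)" using b by (simp add: powr_powr)
    also have "\<dots> \<le> m powr (a/b)" using that b a by (intro powr_mono2) auto
    finally show ?thesis .
  qed
  have "E powr a * E powr - a \<le> E powr a * m powr (a/b)" using up[OF E_le] by (intro mult_left_mono) auto
  then have 1: "1 \<le> E powr a * m powr (a/b)" using E by (simp flip: powr_add)
  have 2: "(\<Sum>i\<in>UNIV. fst s $ i powr - a) \<le> CARD('m) * m powr (a/b)"
    using sum_mono[of UNIV "\<lambda>i. fst s $ i powr - a" "\<lambda>_. m powr (a/b)"] up[OF x_le] by simp
  have 3: "snd s powr - b \<le> sqrt E * m powr (a/b)"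
  proof -
    have "E powr - (a - b) \<le> m powr ((a - b)/b)"
    proof -
      have "E powr - (a - b) = (E powr - b) powr ((a - b)/b)" using b by (simp add: powr_powr)
      also have "\<dots> \<le> m powr ((a - b)/b)" using E_le b by (intro powr_mono2) auto
      finally show ?thesis .
    qed
    then have "m * (E powr (a - b) * E powr - (a - b)) \<le> m * (E powr (a - b) * m powr ((a - b)/b))"
      using m by (intro mult_left_mono) auto
    moreover have "m * m powr ((a - b)/b) = m powr (a/b)"
    proof -
      have "m powr 1 * m powr ((a - b)/b) = m powr (1 + (a - b)/b)" by (simp only: powr_add)
      also have "1 + (a - b)/b = a/b" using b by (simp add: field_simps)
      finally show ?thesis using m by simp
    qed
    moreover have "E powr (a - b) * E powr - (a - b) = 1" using E by (simp flip: powr_add)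
    moreover have "E powr (a - b) = sqrt E" using E by (simp add: b_def powr_half_sqrt)
    ultimately have "m \<le> sqrt E * m powr (a/b)" by (metis mult.left_commute mult_1_right)
    with y_le show ?thesis by linarith
  qed
  have "lyapunov a K s \<le> E powr a * m powr (a/b) + CARD('m) * m powr (a/b) + K * (sqrt E * m powr (a/b))"
    unfolding lyapunov_def using 1 2 mult_left_mono[OF 3 K] by (simp add: b_def)
  also have "\<dots> = (E powr a + CARD('m) + K * sqrt E) * m powr (a/b)" by (simp add: algebra_simps)
  finally have "lyapunov a K s powr (b/a) \<le> ((E powr a + CARD('m) + K * sqrt E) * m powr (a/b)) powr (b/a)"
    using b a lyapunov_ge_1[OF K, of a s] by (intro powr_mono2) auto
  also have "\<dots> = (E powr a + CARD('m) + K * sqrt E) powr (b/a) * m"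
    using a b m by (simp add: powr_mult powr_powr)
  finally show ?thesis by (simp add: m_def)
qed

text \<open>
  The constant \<open>K\<close> is chosen so that the decrease of the tank term exceeds all that the particle
  terms may gain by \<open>particle_drift\<close>.
\<close>
lemma lyapunov_drift:
  fixes E a \<Lambda> :: real
  assumes E: "E > 0" and a: "1/2 < a" "a < 1" and \<Lambda>: "\<Lambda> > 0"
    and rate: "\<And>s::'m::finite state. s \<in> energy_simplex E \<Longrightarrow> total_rate s \<le> \<Lambda>"
  obtains K c d where "K > 0" "0 < c" "c \<le> 1" "d > 0"
    "\<And>s::'m state. s \<in> energy_simplex E \<Longrightarrow> uniformised \<Lambda> (\<lambda>z. ennreal (lyapunov a K z)) s
      \<le> ennreal (lyapunov a K s - c * lyapunov a K s powr (1 - 1 / (2 * a)) + d)"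
proof -
  define b where "b = a - 1/2"
  have b: "0 < b" "b < 1/2" "b < a" "b / a = 1 - 1 / (2 * a)" using a by (auto simp: b_def field_simps)
  define C1 where "C1 = CARD('m) * (2 / (1 - a))"
  define C2 where "C2 = CARD('m) * E powr (1/2 - b) / (1 - 2 * b) + sqrt (E/2) * (E/2) powr - b"
  define K where "K = (C1 + 1/2) / sqrt (E/2)"
  have C1: "C1 \<ge> 0" using a by (auto simp: C1_def)
  have C2: "C2 \<ge> 0" using E b by (auto simp: C2_def intro!: add_nonneg_nonneg)
  have K: "K > 0" using C1 E by (auto simp: K_def intro!: divide_pos_pos add_nonneg_pos)
  have KE: "K * sqrt (E/2) = C1 + 1/2" using E by (simp add: K_def)
  define C3 where "C3 = (E powr a + CARD('m) + K * sqrt E) powr (b/a)"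
  have C3: "C3 > 0"
  proof -
    have "E powr a + CARD('m) + K * sqrt E > 0" using E K by (intro add_pos_nonneg add_pos_nonneg) auto
    then show ?thesis by (simp add: C3_def)
  qed
  define c where "c = min 1 (1 / (2 * C3 * \<Lambda>))"
  define d where "d = K * C2 / \<Lambda> + 1"
  have c: "0 < c" "c \<le> 1" "c * C3 \<le> 1 / (2 * \<Lambda>)"
  proof -
    have "c * C3 \<le> 1 / (2 * C3 * \<Lambda>) * C3" using C3 by (intro mult_right_mono) (auto simp: c_def)
    then show "c * C3 \<le> 1 / (2 * \<Lambda>)" using C3 by simp
  qed (use C3 \<Lambda> in \<open>auto simp: c_def\<close>)
  have "d > 0" using K C2 \<Lambda> by (auto simp: d_def intro!: add_nonneg_pos divide_nonneg_pos mult_nonneg_nonneg)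
  moreover have "uniformised \<Lambda> (\<lambda>z. ennreal (lyapunov a K z)) s
      \<le> ennreal (lyapunov a K s - c * lyapunov a K s powr (1 - 1 / (2 * a)) + d)"
    if s: "s \<in> energy_simplex E" for s :: "'m state"
  proof -
    have pos: "\<And>i. fst s $ i > 0" "snd s > 0" using s by (auto simp: energy_simplex_iff)
    define y where "y = snd s"
    define V where "V = lyapunov a K s"
    have V1: "V \<ge> 1" using lyapunov_ge_1[of K a s] K by (simp add: V_def)
    define P where "P i = min (y powr - a) (fst s $ i powr - a / (1 - a)) - fst s $ i powr - a" for i
    define T where "T i = fst s $ i powr - b / (1 - 2 * b) - y powr - b" for i
    have RA: "ring_average i (\<lambda>z. ennreal (lyapunov a K z)) s \<le> ennreal (V + P i + K * T i)" for i
      using ring_average_lyapunov[OF s a, of K i] K by (simp add: V_def P_def T_def y_def b_def)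
    have nn: "V + P i + K * T i \<ge> 0" for i
    proof -
      have "fst s $ i powr - a \<le> (\<Sum>i\<in>UNIV. fst s $ i powr - a)" by (rule member_le_sum) auto
      moreover have "0 \<le> min (y powr - a) (fst s $ i powr - a / (1 - a))" using a by simp
      ultimately have "0 \<le> 1 + (\<Sum>i\<in>UNIV. fst s $ i powr - a) + P i" unfolding P_def by linarith
      moreover have "0 \<le> K * y powr - b + K * T i" using K b by (simp add: T_def right_diff_distrib)
      ultimately show ?thesis unfolding V_def lyapunov_def by (simp add: y_def b_def)
    qed
    have sq: "sqrt (fst s $ i) / \<Lambda> \<ge> 0" for i using pos(1)[of i] \<Lambda> by simp
    have w: "1 - total_rate s / \<Lambda> \<ge> 0" using rate[OF s] \<Lambda> by simp
    have "uniformised \<Lambda> (\<lambda>z. ennreal (lyapunov a K z)) s \<le>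
        ennreal (1 - total_rate s / \<Lambda>) * ennreal V + (\<Sum>i\<in>UNIV. ennreal (sqrt (fst s $ i) / \<Lambda>) * ennreal (V + P i + K * T i))"
      unfolding uniformised_def V_def[symmetric] by (intro add_left_mono sum_mono mult_left_mono RA) simp
    also have "\<dots> = ennreal ((1 - total_rate s / \<Lambda>) * V + (\<Sum>i\<in>UNIV. (sqrt (fst s $ i) / \<Lambda>) * (V + P i + K * T i)))"
    proof -
      have "(\<Sum>i\<in>UNIV. ennreal (sqrt (fst s $ i) / \<Lambda>) * ennreal (V + P i + K * T i))
          = ennreal (\<Sum>i\<in>UNIV. (sqrt (fst s $ i) / \<Lambda>) * (V + P i + K * T i))"
        unfolding ennreal_mult[OF sq nn, symmetric]
        by (rule sum_ennreal) (rule mult_nonneg_nonneg[OF sq nn])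
      moreover have "0 \<le> (\<Sum>i\<in>UNIV. (sqrt (fst s $ i) / \<Lambda>) * (V + P i + K * T i))"
        using sq nn by (intro sum_nonneg mult_nonneg_nonneg) auto
      ultimately show ?thesis using w V1 by (simp add: ennreal_mult[symmetric] ennreal_plus[symmetric] del: ennreal_plus)
    qed
    also have "\<dots> \<le> ennreal (V - c * V powr (b/a) + d)"
    proof (rule ennreal_leI)
      have eq: "(1 - total_rate s / \<Lambda>) * V + (\<Sum>i\<in>UNIV. (sqrt (fst s $ i) / \<Lambda>) * (V + P i + K * T i))
          = V + ((\<Sum>i\<in>UNIV. sqrt (fst s $ i) * P i) + K * (\<Sum>i\<in>UNIV. sqrt (fst s $ i) * T i)) / \<Lambda>"
      proof -
        have "(\<Sum>i\<in>UNIV. (sqrt (fst s $ i) / \<Lambda>) * (V + P i + K * T i))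
            = (\<Sum>i\<in>UNIV. sqrt (fst s $ i) * (V + P i + K * T i)) / \<Lambda>"
          by (simp add: sum_divide_distrib)
        also have "(\<Sum>i\<in>UNIV. sqrt (fst s $ i) * (V + P i + K * T i))
            = total_rate s * V + (\<Sum>i\<in>UNIV. sqrt (fst s $ i) * P i) + K * (\<Sum>i\<in>UNIV. sqrt (fst s $ i) * T i)"
          by (simp add: total_rate_def distrib_left sum.distrib sum_distrib_right sum_distrib_left mult.left_commute)
        finally show ?thesis using \<Lambda> by (simp add: field_simps)
      qed
      define X where "X = (\<Sum>i\<in>UNIV. fst s $ i powr - b)"
      have "(\<Sum>i\<in>UNIV. sqrt (fst s $ i) * P i) \<le> (\<Sum>i\<in>UNIV. - (1/2) * fst s $ i powr - b + 2 / (1 - a) * y powr - b)"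
        unfolding P_def b_def y_def using pos a by (intro sum_mono particle_drift) auto
      also have "\<dots> = - (1/2) * X + C1 * y powr - b"
        unfolding X_def C1_def sum.distrib sum_distrib_left[symmetric] by simp
      finally have 1: "(\<Sum>i\<in>UNIV. sqrt (fst s $ i) * P i) \<le> - (1/2) * X + C1 * y powr - b" .
      have "(\<Sum>i\<in>UNIV. sqrt (fst s $ i) * T i) \<le> C2 - sqrt (E/2) * y powr - b"
        using tank_drift[OF s b(1,2)] by (simp add: T_def C2_def y_def)
      then have "K * (\<Sum>i\<in>UNIV. sqrt (fst s $ i) * T i) \<le> K * (C2 - sqrt (E/2) * y powr - b)"
        using K by (intro mult_left_mono) auto
      also have "\<dots> = K * C2 - (C1 + 1/2) * y powr - b" by (simp add: right_diff_distrib KE[symmetric])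
      finally have "(\<Sum>i\<in>UNIV. sqrt (fst s $ i) * P i) + K * (\<Sum>i\<in>UNIV. sqrt (fst s $ i) * T i)
          \<le> K * C2 - (1/2) * (X + y powr - b)" using 1 by (simp add: algebra_simps)
      then have "((\<Sum>i\<in>UNIV. sqrt (fst s $ i) * P i) + K * (\<Sum>i\<in>UNIV. sqrt (fst s $ i) * T i)) / \<Lambda>
          \<le> (K * C2 - (1/2) * (X + y powr - b)) / \<Lambda>"
        using \<Lambda> by (intro divide_right_mono) auto
      also have "\<dots> = d - 1 - 1 / (2 * \<Lambda>) * (X + y powr - b)"
        using \<Lambda> by (simp add: d_def field_simps)
      finally have 2: "((\<Sum>i\<in>UNIV. sqrt (fst s $ i) * P i) + K * (\<Sum>i\<in>UNIV. sqrt (fst s $ i) * T i)) / \<Lambda>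
          \<le> d - 1 - 1 / (2 * \<Lambda>) * (X + y powr - b)" .
      have "V powr (b/a) \<le> C3 * (X + y powr - b)"
        using lyapunov_power_le[OF s a, of K] K by (simp add: V_def C3_def X_def y_def b_def)
      then have "c * V powr (b/a) \<le> c * (C3 * (X + y powr - b))" using c by (intro mult_left_mono) auto
      also have "\<dots> = (c * C3) * (X + y powr - b)" by simp
      also have "\<dots> \<le> 1 / (2 * \<Lambda>) * (X + y powr - b)"
        using c by (intro mult_right_mono) (auto simp: X_def intro!: add_nonneg_nonneg sum_nonneg)
      finally show "(1 - total_rate s / \<Lambda>) * V + (\<Sum>i\<in>UNIV. (sqrt (fst s $ i) / \<Lambda>) * (V + P i + K * T i))
          \<le> V - c * V powr (b/a) + d" unfolding eq using 2 by linarith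
    qed
    finally show ?thesis by (simp add: V_def b)
  qed
  ultimately show ?thesis using K c by (intro that[of K c d]) auto
qed

section \<open>Minorisation on compact sets\<close>

lemma measurable_vec:
  assumes g: "\<And>j. g j \<in> borel_measurable M"
  shows "(\<lambda>x. (\<chi> j. g j x) :: real ^ 'm::finite) \<in> borel_measurable M"
proof (rule borel_measurable_euclidean_space[THEN iffD2], rule ballI)
  fix b :: "real ^ 'm" assume "b \<in> Basis"
  then obtain j where b: "b = axis j 1" unfolding Basis_vec_def by auto
  have "(\<chi> j. g j x) \<bullet> b = g j x" for x
    unfolding b cart_eq_inner_axis[symmetric] vec_lambda_beta ..
  then show "(\<lambda>x. (\<chi> j. g j x) \<bullet> b) \<in> borel_measurable M" by (simp only: g)
qed

text \<open>
  The variable \<open>u\<^sup>2 * x\<close> has density \<open>1 / (2 * sqrt (x * z))\<close> on the interval from \<open>0\<close> to \<open>x\<close>.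
\<close>
lemma nn_integral_square_law:
  fixes h :: "real \<Rightarrow> ennreal" and x :: real
  assumes [measurable]: "h \<in> borel_measurable borel" and x: "x > 0"
  shows "(\<integral>\<^sup>+u. h (u\<^sup>2 * x) \<partial>unit_uniform)
    = (\<integral>\<^sup>+z. h z * ennreal (1 / (2 * sqrt (x * z))) * indicator {0<..<x} z \<partial>lborel)"
proof -
  have "(\<integral>\<^sup>+z. (h z * ennreal (1 / (2 * sqrt (x * z)))) * indicator {0\<^sup>2 * x..1\<^sup>2 * x} z \<partial>lborel)
      = (\<integral>\<^sup>+u. (h (u\<^sup>2 * x) * ennreal (1 / (2 * sqrt (x * (u\<^sup>2 * x))))) * ennreal (2 * u * x) * indicator {0..1} u \<partial>lborel)"
    using x by (intro nn_integral_substitution_aux) (auto intro!: derivative_eq_intros continuous_intros)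
  also have "\<dots> = (\<integral>\<^sup>+u. h (u\<^sup>2 * x) * indicator {0<..<1} u \<partial>lborel)"
  proof (rule nn_integral_cong_AE)
    show "AE u in lborel. (h (u\<^sup>2 * x) * ennreal (1 / (2 * sqrt (x * (u\<^sup>2 * x))))) * ennreal (2 * u * x) * indicator {0..1} u
        = h (u\<^sup>2 * x) * indicator {0<..<1} u"
      using AE_lborel_singleton[of 0] AE_lborel_singleton[of 1]
    proof eventually_elim
      case (elim u)
      show ?case
      proof (cases "u \<in> {0<..<1}")
        case True
        have "sqrt (x * (u\<^sup>2 * x)) = u * x"
          using True x real_sqrt_abs[of "u * x"] by (simp add: power2_eq_square mult_ac)
        then have "ennreal (1 / (2 * sqrt (x * (u\<^sup>2 * x)))) * ennreal (2 * u * x) = 1"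
          using True x by (simp add: ennreal_mult[symmetric])
        with True show ?thesis by (simp add: mult.assoc)
      qed (use elim in \<open>auto simp: indicator_def\<close>)
    qed
  qed
  also have "\<dots> = (\<integral>\<^sup>+u. h (u\<^sup>2 * x) \<partial>unit_uniform)"
    by (subst nn_integral_unit_uniform) auto
  finally have "(\<integral>\<^sup>+u. h (u\<^sup>2 * x) \<partial>unit_uniform)
      = (\<integral>\<^sup>+z. (h z * ennreal (1 / (2 * sqrt (x * z)))) * indicator {0\<^sup>2 * x..1\<^sup>2 * x} z \<partial>lborel)" by simp
  also have "\<dots> = (\<integral>\<^sup>+z. h z * ennreal (1 / (2 * sqrt (x * z))) * indicator {0<..<x} z \<partial>lborel)"
  proof (rule nn_integral_cong_AE)
    show "AE z in lborel. (h z * ennreal (1 / (2 * sqrt (x * z)))) * indicator {0\<^sup>2 * x..1\<^sup>2 * x} z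
        = h z * ennreal (1 / (2 * sqrt (x * z))) * indicator {0<..<x} z"
      using AE_lborel_singleton[of 0] AE_lborel_singleton[of x]
      by eventually_elim (auto simp: indicator_def)
  qed
  finally show ?thesis .
qed

text \<open>
  The particles in \<open>I\<close> get the energies \<open>w\<close> and the tank balances the account.
\<close>
definition reset_particles :: "'m set \<Rightarrow> ('m \<Rightarrow> real) \<Rightarrow> 'm::finite state \<Rightarrow> 'm state" where
  "reset_particles I w s = ((\<chi> j. if j \<in> I then w j else fst s $ j), snd s + (\<Sum>j\<in>I. fst s $ j - w j))"

lemma reset_particles_simps [simp]:
  "fst (reset_particles I w s) $ j = (if j \<in> I then w j else fst s $ j)"
  "snd (reset_particles I w s) = snd s + (\<Sum>j\<in>I. fst s $ j - w j)"
  by (auto simp: reset_particles_def)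

lemma state_eqI: "(\<And>j. fst s $ j = fst t $ j) \<Longrightarrow> snd s = snd t \<Longrightarrow> s = t"
  by (cases s; cases t) (simp add: vec_eq_iff)

lemma ring_update_eq_reset: "ring_update i u s = reset_particles {i} (\<lambda>_. fst s $ i + snd s - u\<^sup>2 * fst s $ i) s"
  by (rule state_eqI) (auto simp: algebra_simps)

lemma reset_particles_in_simplex:
  assumes s: "s \<in> energy_simplex E" and w: "\<And>j. j \<in> I \<Longrightarrow> 0 < w j" "snd s + (\<Sum>j\<in>I. fst s $ j - w j) > 0"
  shows "reset_particles I w s \<in> energy_simplex E"
proof -
  have "(\<Sum>j\<in>UNIV. fst (reset_particles I w s) $ j) = (\<Sum>j\<in>UNIV. fst s $ j + (if j \<in> I then w j - fst s $ j else 0))"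
    by (intro sum.cong) auto
  also have "\<dots> = (\<Sum>j\<in>UNIV. fst s $ j) + (\<Sum>j\<in>I. w j - fst s $ j)"
    by (simp add: sum.distrib sum.If_cases)
  finally have total: "snd (reset_particles I w s) + (\<Sum>j\<in>UNIV. fst (reset_particles I w s) $ j) = E"
    using s by (simp add: energy_simplex_iff sum_subtractf del: reset_particles_simps(1))
  have "0 < fst (reset_particles I w s) $ j" for j
    using s w(1) by (simp add: energy_simplex_iff)
  then show ?thesis unfolding energy_simplex_iff[of "reset_particles I w s"] using total w(2) by simp
qed

lemma measurable_reset_particles:
  "(\<lambda>w. reset_particles I w s) \<in> Pi\<^sub>M I (\<lambda>_. borel) \<rightarrow>\<^sub>M (borel :: 'm::finite state measure)"
proof -
  have c: "(\<lambda>w. w j) \<in> borel_measurable (Pi\<^sub>M I (\<lambda>_. borel))" if "j \<in> I" for j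
    using that by (rule measurable_component_singleton)
  have "(\<lambda>w. \<chi> j. if j \<in> I then w j else fst s $ j) \<in> borel_measurable (Pi\<^sub>M I (\<lambda>_. borel))"
  proof (rule measurable_vec)
    show "(\<lambda>w. if j \<in> I then w j else fst s $ j) \<in> borel_measurable (Pi\<^sub>M I (\<lambda>_. borel))" for j
      by (cases "j \<in> I") (simp_all only: c if_True if_False borel_measurable_const)
  qed
  moreover have "(\<lambda>w. snd s + (\<Sum>j\<in>I. fst s $ j - w j)) \<in> borel_measurable (Pi\<^sub>M I (\<lambda>_. borel))"
    by (intro borel_measurable_add borel_measurable_const borel_measurable_sum borel_measurable_diff c)
  ultimately show ?thesis unfolding reset_particles_def by (rule borel_measurable_Pair)
qed

lemma measurable_reset_particle [measurable]:
  "(\<lambda>w. reset_particles {i} (\<lambda>_. w) s) \<in> borel \<rightarrow>\<^sub>M (borel :: 'm::finite state measure)"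
proof -
  have "(\<lambda>w. \<chi> j. if j \<in> {i} then w else fst s $ j) \<in> borel_measurable borel"
  proof (rule measurable_vec)
    show "(\<lambda>w. if j \<in> {i} then w else fst s $ j) \<in> borel_measurable borel" for j
      by (cases "j \<in> {i}") auto
  qed
  moreover have "(\<lambda>w. snd s + (\<Sum>j\<in>{i}. fst s $ j - w)) \<in> borel_measurable borel"
    by measurable
  ultimately show ?thesis unfolding reset_particles_def by (rule borel_measurable_Pair)
qed

lemma ring_average_ge:
  fixes s :: "'m::finite state"
  assumes s: "s \<in> energy_simplex E" and [measurable]: "f \<in> borel_measurable borel"
  shows "ennreal (1 / (2 * E)) * (\<integral>\<^sup>+w. f (reset_particles {i} (\<lambda>_. w) s) * indicator {snd s<..<snd s + fst s $ i} w \<partial>lborel)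
    \<le> ring_average i f s"
proof -
  define x S where "x = fst s $ i" and "S = fst s $ i + snd s"
  have pos: "x > 0" "snd s > 0" using s by (auto simp: energy_simplex_iff x_def)
  have xE: "x < E" using coord_le_energy(1,3)[OF s, of i] by (simp add: x_def)
  have "ring_average i f s = (\<integral>\<^sup>+u. (\<lambda>z. f (reset_particles {i} (\<lambda>_. S - z) s)) (u\<^sup>2 * x) \<partial>unit_uniform)"
    by (simp add: ring_average_def ring_update_eq_reset S_def x_def)
  also have "\<dots> = (\<integral>\<^sup>+z. f (reset_particles {i} (\<lambda>_. S - z) s) * ennreal (1 / (2 * sqrt (x * z))) * indicator {0<..<x} z \<partial>lborel)"
    by (rule nn_integral_square_law[OF _ pos(1)]) measurable
  also have "\<dots> \<ge> (\<integral>\<^sup>+z. ennreal (1 / (2 * E)) * (f (reset_particles {i} (\<lambda>_. S - z) s) * indicator {0<..<x} z) \<partial>lborel)"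
  proof (rule nn_integral_mono)
    fix z :: real
    have "1 / (2 * E) \<le> 1 / (2 * sqrt (x * z))" if "z \<in> {0<..<x}"
    proof -
      have "x * z \<le> E * E" using that xE pos by (intro mult_mono) auto
      then have "sqrt (x * z) \<le> E" using pos xE by (intro real_le_lsqrt) (auto simp: power2_eq_square)
      moreover have "0 < sqrt (x * z)" "0 < E" using that pos xE by auto
      ultimately show ?thesis by (intro divide_left_mono) auto
    qed
    then have "ennreal (1 / (2 * E)) * indicator {0<..<x} z \<le> ennreal (1 / (2 * sqrt (x * z))) * indicator {0<..<x} z"
      by (auto simp: indicator_def intro!: ennreal_leI)
    then have "f (reset_particles {i} (\<lambda>_. S - z) s) * (ennreal (1 / (2 * E)) * indicator {0<..<x} z)
        \<le> f (reset_particles {i} (\<lambda>_. S - z) s) * (ennreal (1 / (2 * sqrt (x * z))) * indicator {0<..<x} z)"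
      by (rule mult_left_mono) simp
    then show "ennreal (1 / (2 * E)) * (f (reset_particles {i} (\<lambda>_. S - z) s) * indicator {0<..<x} z)
        \<le> f (reset_particles {i} (\<lambda>_. S - z) s) * ennreal (1 / (2 * sqrt (x * z))) * indicator {0<..<x} z"
      by (simp add: mult_ac)
  qed
  also have "(\<integral>\<^sup>+z. ennreal (1 / (2 * E)) * (f (reset_particles {i} (\<lambda>_. S - z) s) * indicator {0<..<x} z) \<partial>lborel)
      = ennreal (1 / (2 * E)) * (\<integral>\<^sup>+z. f (reset_particles {i} (\<lambda>_. S - z) s) * indicator {0<..<x} z \<partial>lborel)"
    by (rule nn_integral_cmult) measurable
  also have "(\<integral>\<^sup>+z. f (reset_particles {i} (\<lambda>_. S - z) s) * indicator {0<..<x} z \<partial>lborel)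
      = (\<integral>\<^sup>+z. (\<lambda>w. f (reset_particles {i} (\<lambda>_. w) s) * indicator {snd s<..<snd s + x} w) (S - z) \<partial>lborel)"
    by (intro nn_integral_cong) (auto simp: indicator_def S_def x_def)
  also have "\<dots> = (\<integral>\<^sup>+w. f (reset_particles {i} (\<lambda>_. w) s) * indicator {snd s<..<snd s + x} w \<partial>lborel)"
    by (rule nn_integral_reflect) measurable
  finally show ?thesis by (simp add: x_def)
qed

lemma uniformised_ge_ring:
  assumes "\<Lambda> > 0"
  shows "ennreal (sqrt (fst s $ i) / \<Lambda>) * ring_average i f s \<le> uniformised \<Lambda> f s"
proof -
  have "ennreal (sqrt (fst s $ i) / \<Lambda>) * ring_average i f s
      \<le> (\<Sum>i\<in>UNIV. ennreal (sqrt (fst s $ i) / \<Lambda>) * ring_average i f s)"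
    by (rule member_le_sum) auto
  then show ?thesis unfolding uniformised_def by (rule add_increasing[rotated]) simp
qed

text \<open>
  A single ring leaves the particle with at least the energy of the tank. But if \<open>u\<close> is small at the first
  ring, the particle takes almost everything, and the second ring can then leave it with any energy
  between \<open>\<delta>/2\<close> and \<open>\<delta>\<close>, with a density bounded below by \<open>ring_average_ge\<close>.
\<close>
lemma double_ring_ge:
  fixes \<delta> E \<Lambda> :: real
  assumes E: "0 < \<delta>" "\<delta> \<le> E" and \<Lambda>: "\<Lambda> > 0"
  obtains c where "0 < c"
    "\<And>s f i. s \<in> energy_simplex E \<Longrightarrow> fst (s :: 'm::finite state) $ i \<ge> \<delta> \<Longrightarrow> snd s \<ge> \<delta> \<Longrightarrow> f \<in> borel_measurable borel \<Longrightarrow>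
      ennreal c * (\<integral>\<^sup>+w. f (reset_particles {i} (\<lambda>_. w) s) \<partial>uniform_measure lborel {\<delta>/2<..<\<delta>})
      \<le> uniformised \<Lambda> (uniformised \<Lambda> f) s"
proof -
  define c1 where "c1 = sqrt \<delta> / \<Lambda> * (1 / (2 * E)) * (\<delta>/2)"
  \<comment> \<open>a first ring with \<open>u < v\<close> leaves at most \<open>\<delta>/2\<close> in the tank\<close>
  define v where "v = sqrt (\<delta> / (2 * E))"
  define c where "c = sqrt \<delta> / \<Lambda> * (v * c1)"
  have v: "0 < v" "v < 1" "v\<^sup>2 = \<delta> / (2 * E)" using E by (auto simp: v_def)
  have c1: "c1 > 0" using E \<Lambda> by (auto simp: c1_def)
  have c: "c > 0" using E \<Lambda> v c1 by (auto simp: c_def)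
  have "ennreal c * (\<integral>\<^sup>+w. f (reset_particles {i} (\<lambda>_. w) s) \<partial>uniform_measure lborel {\<delta>/2<..<\<delta>})
      \<le> uniformised \<Lambda> (uniformised \<Lambda> f) s"
    if s: "s \<in> energy_simplex E" and big: "fst s $ i \<ge> \<delta>" "snd s \<ge> \<delta>" and [measurable]: "f \<in> borel_measurable borel"
    for s :: "'m state" and f i
  proof -
    define J where "J = (\<integral>\<^sup>+w. f (reset_particles {i} (\<lambda>_. w) s) \<partial>uniform_measure lborel {\<delta>/2<..<\<delta>})"
    define x S where "x = fst s $ i" and "S = fst s $ i + snd s"
    have xE: "x < E" "S \<le> E" using coord_le_energy(1,3)[OF s, of i] by (auto simp: x_def S_def)
    have tri: "ennreal p * (ennreal q * (ennreal r * J)) = ennreal (p * q * r) * J"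
      if "p \<ge> 0" "q \<ge> 0" "r \<ge> 0" for p q r :: real
      using that by (simp add: ennreal_mult mult.assoc)
    have J: "ennreal (\<delta>/2) * J = (\<integral>\<^sup>+w. f (reset_particles {i} (\<lambda>_. w) s) * indicator {\<delta>/2<..<\<delta>} w \<partial>lborel)"
    proof -
      have "J = (\<integral>\<^sup>+w. f (reset_particles {i} (\<lambda>_. w) s) * indicator {\<delta>/2<..<\<delta>} w \<partial>lborel) / ennreal (\<delta>/2)"
        unfolding J_def using E by (subst nn_integral_uniform_measure) auto
      then show ?thesis
        using E by (simp add: ennreal_times_divide mult.commute[of "ennreal (\<delta>/2)"] mult_divide_eq_ennreal)
    qed
    have low: "ennreal c1 * J \<le> uniformised \<Lambda> f (ring_update i u s)" if u: "0 < u" "u < v" for u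
    proof -
      define s1 where "s1 = ring_update i u s"
      have s1: "s1 \<in> energy_simplex E" unfolding s1_def using s u v by (intro ring_update_in_simplex) auto
      have "u\<^sup>2 < v\<^sup>2" using u by (intro power_strict_mono) auto
      then have "u\<^sup>2 * x \<le> v\<^sup>2 * E" using xE big E by (intro mult_mono) (auto simp: x_def)
      then have y1: "snd s1 \<le> \<delta>/2" using v E by (simp add: s1_def x_def)
      have sum1: "fst s1 $ i + snd s1 = S" by (simp add: s1_def S_def algebra_simps)
      have x1: "fst s1 $ i \<ge> \<delta>" using sum1 y1 big E by (simp add: S_def)
      have re: "reset_particles {i} (\<lambda>_. w) s1 = reset_particles {i} (\<lambda>_. w) s" for w
        by (rule state_eqI) (use sum1 in \<open>auto simp: s1_def S_def algebra_simps\<close>)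
      have "ennreal (\<delta>/2) * J \<le> (\<integral>\<^sup>+w. f (reset_particles {i} (\<lambda>_. w) s1) * indicator {snd s1<..<snd s1 + fst s1 $ i} w \<partial>lborel)"
        unfolding J re using y1 sum1 big E
        by (intro nn_integral_mono mult_left_mono) (auto simp: indicator_def S_def)
      then have "ennreal (1 / (2 * E)) * (ennreal (\<delta>/2) * J) \<le> ring_average i f s1"
        by (intro order_trans[OF mult_left_mono ring_average_ge[OF s1]]) auto
      then have "ennreal (sqrt \<delta> / \<Lambda>) * (ennreal (1 / (2 * E)) * (ennreal (\<delta>/2) * J))
          \<le> ennreal (sqrt (fst s1 $ i) / \<Lambda>) * ring_average i f s1"
        using x1 \<Lambda> by (intro mult_mono ennreal_leI divide_right_mono) auto
      also have "\<dots> \<le> uniformised \<Lambda> f s1" by (rule uniformised_ge_ring[OF \<Lambda>])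
      also have "ennreal (sqrt \<delta> / \<Lambda>) * (ennreal (1 / (2 * E)) * (ennreal (\<delta>/2) * J)) = ennreal c1 * J"
        unfolding c1_def by (rule tri) (use E \<Lambda> in auto)
      finally show ?thesis by (simp add: s1_def)
    qed
    have "ennreal v * (ennreal c1 * J) = (\<integral>\<^sup>+u. (ennreal c1 * J) * indicator {0<..<v} u \<partial>lborel)"
      using v by (simp add: nn_integral_cmult_indicator mult.commute)
    also have "\<dots> \<le> (\<integral>\<^sup>+u. uniformised \<Lambda> f (ring_update i u s) * indicator {0<..<1} u \<partial>lborel)"
      using low v by (intro nn_integral_mono) (auto simp: indicator_def)
    also have "\<dots> = ring_average i (uniformised \<Lambda> f) s"
      unfolding ring_average_def by (subst nn_integral_unit_uniform) (auto simp: uniformised_def)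
    finally have "ennreal (sqrt \<delta> / \<Lambda>) * (ennreal v * (ennreal c1 * J))
        \<le> ennreal (sqrt (fst s $ i) / \<Lambda>) * ring_average i (uniformised \<Lambda> f) s"
      using big \<Lambda> by (intro mult_mono ennreal_leI divide_right_mono) auto
    also have "\<dots> \<le> uniformised \<Lambda> (uniformised \<Lambda> f) s" by (rule uniformised_ge_ring[OF \<Lambda>])
    also have "ennreal (sqrt \<delta> / \<Lambda>) * (ennreal v * (ennreal c1 * J)) = ennreal c * J"
      unfolding c_def mult.assoc[symmetric, of "sqrt \<delta> / \<Lambda>" v c1] by (rule tri) (use E \<Lambda> v c1 in auto)
    finally show ?thesis unfolding J_def .
  qed
  with c show ?thesis by (rule that)
qed


text \<open>
  Resetting a particle to an energy below \<open>\<delta>\<close> adds to the tank, so the hypotheses of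
  \<open>double_ring_ge\<close> persist for the remaining particles.
\<close>
lemma sweep_ge:
  fixes \<delta> E \<Lambda> :: real
  assumes E: "0 < \<delta>" "\<delta> \<le> E" and \<Lambda>: "\<Lambda> > 0"
    and rate: "\<And>s::'m::finite state. s \<in> energy_simplex E \<Longrightarrow> total_rate s \<le> \<Lambda>"
  obtains c where "0 < c"
    "\<And>I s f. s \<in> energy_simplex E \<Longrightarrow> \<forall>i\<in>I. fst (s :: 'm state) $ i \<ge> \<delta> \<Longrightarrow> snd s \<ge> \<delta> \<Longrightarrow> f \<in> borel_measurable borel \<Longrightarrow>
      ennreal (c ^ card I) * (\<integral>\<^sup>+w. f (reset_particles I w s) \<partial>Pi\<^sub>M I (\<lambda>_. uniform_measure lborel {\<delta>/2<..<\<delta>}))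
      \<le> (uniformised \<Lambda> ^^ (2 * card I)) f s"
proof -
  define U where "U = uniform_measure lborel {\<delta>/2<..<\<delta>}"
  interpret U: prob_space U unfolding U_def using E by (intro prob_space_uniform_measure) auto
  interpret PU: product_sigma_finite "\<lambda>_::'m. U" by standard
  have sets_U [measurable_cong]: "sets U = sets borel" by (simp add: U_def)
  have AE_U: "AE w in U. \<delta>/2 < w \<and> w < \<delta>" unfolding U_def by (rule AE_uniform_measureI) auto
  interpret Q: markov_operator "energy_simplex E :: 'm state set" borel "uniformised \<Lambda>"
    using rate \<Lambda> by (rule markov_operator_uniformised)
  obtain c where c: "0 < c"
    "\<And>s f i. s \<in> energy_simplex E \<Longrightarrow> fst (s :: 'm state) $ i \<ge> \<delta> \<Longrightarrow> snd s \<ge> \<delta> \<Longrightarrow> f \<in> borel_measurable borel \<Longrightarrow>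
      ennreal c * (\<integral>\<^sup>+w. f (reset_particles {i} (\<lambda>_. w) s) \<partial>U) \<le> uniformised \<Lambda> (uniformised \<Lambda> f) s"
    unfolding U_def by (rule double_ring_ge[where 'm = 'm, OF E \<Lambda>]) blast
  have "ennreal (c ^ card I) * (\<integral>\<^sup>+w. f (reset_particles I w s) \<partial>Pi\<^sub>M I (\<lambda>_. U))
      \<le> (uniformised \<Lambda> ^^ (2 * card I)) f s"
    if "s \<in> energy_simplex E" "\<forall>i\<in>I. fst (s :: 'm state) $ i \<ge> \<delta>" "snd s \<ge> \<delta>" "f \<in> borel_measurable borel" for I s f
    using finite[of I] that
  proof (induction I arbitrary: s rule: finite_induct)
    case empty
    have "reset_particles {} w s = s" for w by (rule state_eqI) auto
    then show ?case by (simp add: PiM_empty nn_integral_count_space_finite)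
  next
    case (insert i I)
    note [measurable] = insert.prems(4)
    let ?n = "2 * card I"
    have meas: "(\<lambda>w. f (reset_particles I w t)) \<in> borel_measurable (Pi\<^sub>M I (\<lambda>_. U))" for I t
      using measurable_compose[OF measurable_reset_particles insert.prems(4)]
      by (subst measurable_cong_sets[OF sets_PiM_cong[OF refl sets_U] refl])
    have IH: "ennreal (c ^ card I) * (\<integral>\<^sup>+v. f (reset_particles (insert i I) (v(i := w)) s) \<partial>Pi\<^sub>M I (\<lambda>_. U))
        \<le> (uniformised \<Lambda> ^^ ?n) f (reset_particles {i} (\<lambda>_. w) s)" if w: "\<delta>/2 < w \<and> w < \<delta>" for w
    proof -
      have eq: "reset_particles I v (reset_particles {i} (\<lambda>_. w) s) = reset_particles (insert i I) (v(i := w)) s" for v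
      proof (rule state_eqI)
        have "(\<Sum>j\<in>I. fst (reset_particles {i} (\<lambda>_. w) s) $ j - v j) = (\<Sum>j\<in>I. fst s $ j - (v(i := w)) j)"
          using insert.hyps by (intro sum.cong) auto
        then show "snd (reset_particles I v (reset_particles {i} (\<lambda>_. w) s)) = snd (reset_particles (insert i I) (v(i := w)) s)"
          using insert.hyps by (simp del: fun_upd_apply) simp
      qed (use insert.hyps in auto)
      have "reset_particles {i} (\<lambda>_. w) s \<in> energy_simplex E"
        using w E insert.prems by (intro reset_particles_in_simplex) auto
      then have "ennreal (c ^ card I) * (\<integral>\<^sup>+v. f (reset_particles I v (reset_particles {i} (\<lambda>_. w) s)) \<partial>Pi\<^sub>M I (\<lambda>_. U))
        \<le> (uniformised \<Lambda> ^^ ?n) f (reset_particles {i} (\<lambda>_. w) s)"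
        using insert.prems insert.hyps w by (intro insert.IH) auto
      then show ?thesis unfolding eq .
    qed
    have "ennreal (c ^ card (insert i I)) * (\<integral>\<^sup>+w. f (reset_particles (insert i I) w s) \<partial>Pi\<^sub>M (insert i I) (\<lambda>_. U))
        = ennreal c * (ennreal (c ^ card I) * (\<integral>\<^sup>+w. (\<integral>\<^sup>+v. f (reset_particles (insert i I) (v(i := w)) s) \<partial>Pi\<^sub>M I (\<lambda>_. U)) \<partial>U))"
      using insert.hyps c(1) meas by (subst PU.product_nn_integral_insert_rev) (auto simp: ennreal_mult mult.assoc)
    also have "\<dots> = ennreal c * (\<integral>\<^sup>+w. ennreal (c ^ card I) * (\<integral>\<^sup>+v. f (reset_particles (insert i I) (v(i := w)) s) \<partial>Pi\<^sub>M I (\<lambda>_. U)) \<partial>U)"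
    proof (subst nn_integral_cmult)
      interpret I: prob_space "Pi\<^sub>M I (\<lambda>_. U)" by (rule prob_space_PiM) (rule U.prob_space_axioms)
      have "(\<lambda>(w, v). v(i := w)) \<in> U \<Otimes>\<^sub>M Pi\<^sub>M I (\<lambda>_. U) \<rightarrow>\<^sub>M Pi\<^sub>M (insert i I) (\<lambda>_. U)"
        by measurable
      from measurable_compose[OF this meas] have "(\<lambda>(w, v). f (reset_particles (insert i I) (v(i := w)) s)) \<in> borel_measurable (U \<Otimes>\<^sub>M Pi\<^sub>M I (\<lambda>_. U))"
        by (simp add: case_prod_unfold)
      then show "(\<lambda>w. \<integral>\<^sup>+v. f (reset_particles (insert i I) (v(i := w)) s) \<partial>Pi\<^sub>M I (\<lambda>_. U)) \<in> borel_measurable U"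
        by measurable
    qed simp
    also have "\<dots> \<le> ennreal c * (\<integral>\<^sup>+w. (uniformised \<Lambda> ^^ ?n) f (reset_particles {i} (\<lambda>_. w) s) \<partial>U)"
    proof (intro mult_left_mono nn_integral_mono_AE)
      show "AE w in U. ennreal (c ^ card I) * (\<integral>\<^sup>+v. f (reset_particles (insert i I) (v(i := w)) s) \<partial>Pi\<^sub>M I (\<lambda>_. U))
          \<le> (uniformised \<Lambda> ^^ ?n) f (reset_particles {i} (\<lambda>_. w) s)"
        using AE_U by eventually_elim (rule IH)
    qed simp
    also have "\<dots> \<le> uniformised \<Lambda> (uniformised \<Lambda> ((uniformised \<Lambda> ^^ ?n) f)) s"
      using insert.prems by (intro c(2)) (auto intro: markov_operator.measurable_op[OF Q.markov_operator_iterate])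
    also have "\<dots> = (uniformised \<Lambda> ^^ (2 * card (insert i I))) f s"
      using insert.hyps by simp
    finally show ?case .
  qed
  with c(1) show ?thesis unfolding U_def by (intro that[of c]) auto
qed

lemma lyapunov_le_imp_coord_ge:
  fixes s :: "'m::finite state"
  assumes s: "s \<in> energy_simplex E" and a: "1/2 < a" "a < 1" and K: "K > 0" and le: "lyapunov a K s \<le> R"
  shows "fst s $ i \<ge> R powr (- 1 / a)" "snd s \<ge> (R / K) powr (- 1 / (a - 1/2))"
proof -
  have pos: "fst s $ i > 0" "snd s > 0" using s by (auto simp: energy_simplex_iff)
  have "fst s $ i powr - a \<le> (\<Sum>i\<in>UNIV. fst s $ i powr - a)" by (rule member_le_sum) auto
  moreover have "0 \<le> K * snd s powr - (a - 1/2)" "0 \<le> (\<Sum>i\<in>UNIV. fst s $ i powr - a)" using K by (auto intro: sum_nonneg)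
  ultimately have 1: "fst s $ i powr - a \<le> R" and "K * snd s powr - (a - 1/2) \<le> R"
    using le unfolding lyapunov_def by linarith+
  then have 2: "snd s powr - (a - 1/2) \<le> R / K" using K by (simp add: field_simps)
  have "R powr (- 1 / a) \<le> (fst s $ i powr - a) powr (- 1 / a)" using 1 pos a by (intro powr_mono2') auto
  then show "fst s $ i \<ge> R powr (- 1 / a)" using a pos by (simp add: powr_powr)
  have "(R / K) powr (- 1 / (a - 1/2)) \<le> (snd s powr - (a - 1/2)) powr (- 1 / (a - 1/2))"
    using 2 pos a by (intro powr_mono2') auto
  also have "\<dots> = snd s powr 1" unfolding powr_powr using a by (intro arg_cong2[where f = "(powr)"]) (auto simp: field_simps)
  finally show "snd s \<ge> (R / K) powr (- 1 / (a - 1/2))" using pos by simp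
qed

text \<open>
  Once all particles have been reset, the tank contains what is left of \<open>E\<close>, so the state no longer
  depends on the starting point.
\<close>
lemma lyapunov_minorisation:
  fixes E a \<Lambda> K R :: real
  assumes E: "E > 0" and a: "1/2 < a" "a < 1" and \<Lambda>: "\<Lambda> > 0" and K: "K > 0"
    and rate: "\<And>s::'m::finite state. s \<in> energy_simplex E \<Longrightarrow> total_rate s \<le> \<Lambda>"
  shows "\<exists>n \<eta> \<nu>. 0 < \<eta> \<and> \<eta> < 1 \<and> prob_space \<nu> \<and> sets \<nu> = sets borel \<and> (AE z in \<nu>. z \<in> energy_simplex E) \<and>
      (\<forall>s\<in>energy_simplex E. lyapunov a K s \<le> R \<longrightarrow>
        (\<forall>f\<in>borel_measurable borel. ennreal \<eta> * (\<integral>\<^sup>+z. f z \<partial>\<nu>) \<le> (uniformised \<Lambda> ^^ n) f (s :: 'm state)))"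
proof -
  define R' where "R' = max R 1"
  define \<delta> where "\<delta> = min (E / (CARD('m) + 1)) (min (R' powr (- 1 / a)) ((R' / K) powr (- 1 / (a - 1/2))))"
  have R': "R' > 0" "R \<le> R'" by (auto simp: R'_def)
  have \<delta>: "0 < \<delta>" "\<delta> \<le> E / (CARD('m) + 1)" using E R' K by (auto simp: \<delta>_def)
  have "\<delta> \<le> E" by (rule order_trans[OF \<delta>(2)]) (use E in \<open>simp add: field_simps\<close>)
  then obtain c where c: "0 < c"
    "\<And>I s f. s \<in> energy_simplex E \<Longrightarrow> \<forall>i\<in>I. fst (s :: 'm state) $ i \<ge> \<delta> \<Longrightarrow> snd s \<ge> \<delta> \<Longrightarrow> f \<in> borel_measurable borel \<Longrightarrow>
      ennreal (c ^ card I) * (\<integral>\<^sup>+w. f (reset_particles I w s) \<partial>Pi\<^sub>M I (\<lambda>_. uniform_measure lborel {\<delta>/2<..<\<delta>}))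
      \<le> (uniformised \<Lambda> ^^ (2 * card I)) f s"
    using sweep_ge[where 'm = 'm, OF \<delta>(1) _ \<Lambda> rate] by blast
  define U where "U = uniform_measure lborel {\<delta>/2<..<\<delta>}"
  interpret U: prob_space U unfolding U_def using \<delta> by (intro prob_space_uniform_measure) auto
  have sets_U [measurable_cong]: "sets U = sets borel" by (simp add: U_def)
  have AE_U: "AE w in U. \<delta>/2 < w \<and> w < \<delta>" unfolding U_def by (rule AE_uniform_measureI) auto
  define PU where "PU = Pi\<^sub>M (UNIV :: 'm set) (\<lambda>_. U)"
  interpret PU: prob_space PU unfolding PU_def by (rule prob_space_PiM) (rule U.prob_space_axioms)
  \<comment> \<open>all particles are reset, so any state of total energy \<open>E\<close> can be the starting point\<close>
  define s0 :: "'m state" where "s0 = (0, E)"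
  let ?r = "\<lambda>w. reset_particles UNIV w s0"
  have re: "reset_particles UNIV w s = ?r w" if "s \<in> energy_simplex E" for w and s :: "'m state"
    using that by (intro state_eqI) (auto simp: s0_def energy_simplex_iff sum_subtractf sum_negf)
  have r[measurable]: "?r \<in> PU \<rightarrow>\<^sub>M borel"
    using measurable_reset_particles[of UNIV s0] unfolding PU_def
    by (subst measurable_cong_sets[OF sets_PiM_cong[OF refl sets_U] refl])
  define \<nu> where "\<nu> = distr PU borel ?r"
  have "prob_space \<nu>" unfolding \<nu>_def by (rule PU.prob_space_distr) measurable
  moreover have "sets \<nu> = sets borel" by (simp add: \<nu>_def)
  moreover have "AE z in \<nu>. z \<in> energy_simplex E"
  proof -
    have comp: "AE w in PU. \<delta>/2 < w i \<and> w i < \<delta>" for i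
      unfolding PU_def by (rule AE_PiM_component[OF U.prob_space_axioms _ AE_U]) simp
    have "AE w in PU. \<forall>i\<in>UNIV. \<delta>/2 < w i \<and> w i < \<delta>"
      by (rule AE_finite_allI) (use comp in auto)
    then have "AE w in PU. ?r w \<in> energy_simplex E"
    proof eventually_elim
      case (elim w)
      have "(\<Sum>j\<in>UNIV. w j) \<le> (\<Sum>j\<in>(UNIV::'m set). \<delta>)" using elim by (intro sum_mono) (auto intro: less_imp_le)
      also have "\<dots> = CARD('m) * \<delta>" by simp
      also have "\<dots> \<le> CARD('m) * (E / (CARD('m) + 1))" using \<delta> by (intro mult_left_mono) auto
      also have "\<dots> < E" using E by (simp add: field_simps)
      finally have "(\<Sum>j\<in>UNIV. w j) < E" .
      moreover have "0 < w j" for j using elim[rule_format, of j] \<delta> by auto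
      ultimately show ?case by (auto simp: energy_simplex_iff s0_def sum_negf)
    qed
    then show ?thesis unfolding \<nu>_def by (subst AE_distr_iff) auto
  qed
  moreover have "ennreal (min (c ^ CARD('m)) (1/2)) * (\<integral>\<^sup>+z. f z \<partial>\<nu>) \<le> (uniformised \<Lambda> ^^ (2 * CARD('m))) f s"
    if s: "s \<in> energy_simplex E" and "lyapunov a K s \<le> R" and f[measurable]: "f \<in> borel_measurable borel" for s :: "'m state" and f
  proof -
    have le: "lyapunov a K s \<le> R'" using that R' by simp
    have big: "\<forall>i\<in>UNIV. fst s $ i \<ge> \<delta>" "snd s \<ge> \<delta>"
      using lyapunov_le_imp_coord_ge[OF s a K le] by (auto simp: \<delta>_def min_le_iff_disj)
    have "(\<integral>\<^sup>+z. f z \<partial>\<nu>) = (\<integral>\<^sup>+w. f (reset_particles UNIV w s) \<partial>PU)"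
      unfolding \<nu>_def re[OF s] by (rule nn_integral_distr) auto
    then have "ennreal (c ^ CARD('m)) * (\<integral>\<^sup>+z. f z \<partial>\<nu>) \<le> (uniformised \<Lambda> ^^ (2 * CARD('m))) f s"
      using c(2)[OF s big f] by (simp add: PU_def U_def)
    moreover have "ennreal (min (c ^ CARD('m)) (1/2)) * (\<integral>\<^sup>+z. f z \<partial>\<nu>) \<le> ennreal (c ^ CARD('m)) * (\<integral>\<^sup>+z. f z \<partial>\<nu>)"
      by (intro mult_right_mono ennreal_leI) auto
    ultimately show ?thesis by (rule order_trans[rotated])
  qed
  moreover have "0 < min (c ^ CARD('m)) (1/2)" "min (c ^ CARD('m)) (1/2) < 1" using c by auto
  ultimately show ?thesis by blast
qed

section \<open>The equilibrium measure\<close>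

lemma lborel_eq_distr_PiM:
  "(lborel :: (real ^ 'm::finite) measure) = distr (\<Pi>\<^sub>M i\<in>(UNIV::'m set). lborel) borel (\<lambda>w. \<chi> i. w i)"
proof (rule lborel_eqI)
  interpret product_sigma_finite "\<lambda>_::'m. lborel :: real measure" by standard
  have m: "(\<lambda>w. (\<chi> i. w i) :: real ^ 'm) \<in> borel_measurable (\<Pi>\<^sub>M i\<in>(UNIV::'m set). lborel)"
    by (rule measurable_vec) simp
  fix l u :: "real ^ 'm" assume le: "\<And>b. b \<in> Basis \<Longrightarrow> l \<bullet> b \<le> u \<bullet> b"
  have le': "l $ i \<le> u $ i" for i
    using le[of "axis i 1"] by (simp add: axis_in_Basis_iff flip: cart_eq_inner_axis)
  have "(\<lambda>w. \<chi> i. w i) -` box l u \<inter> space (\<Pi>\<^sub>M i\<in>(UNIV::'m set). lborel) = (\<Pi>\<^sub>E i\<in>UNIV. {l $ i<..<u $ i})"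
    by (auto simp: mem_box_cart PiE_iff space_PiM)
  then have "emeasure (distr (\<Pi>\<^sub>M i\<in>(UNIV::'m set). lborel) borel (\<lambda>w. \<chi> i. w i)) (box l u)
      = emeasure (\<Pi>\<^sub>M i\<in>(UNIV::'m set). lborel) (\<Pi>\<^sub>E i\<in>UNIV. {l $ i<..<u $ i})"
    using m by (subst emeasure_distr) auto
  also have "\<dots> = (\<Prod>i\<in>UNIV. emeasure lborel {l $ i<..<u $ i})"
    by (rule emeasure_PiM) auto
  also have "\<dots> = ennreal (\<Prod>i\<in>UNIV. u $ i - l $ i)"
    using le' by (simp add: prod_ennreal)
  also have "(\<Prod>i\<in>UNIV. u $ i - l $ i) = (\<Prod>b\<in>Basis. (u - l) \<bullet> b)"
  proof -
    have B: "(Basis :: (real ^ 'm) set) = (\<lambda>i. axis i 1) ` UNIV" by (auto simp: Basis_vec_def)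
    show ?thesis unfolding B
      by (subst prod.reindex) (auto simp: inj_on_def axis_eq_axis simp flip: cart_eq_inner_axis)
  qed
  finally show "emeasure (distr (\<Pi>\<^sub>M i\<in>(UNIV::'m set). lborel) borel (\<lambda>w. \<chi> i. w i)) (box l u)
      = (\<Prod>b\<in>Basis. (u - l) \<bullet> b)" .
qed simp

lemma nn_integral_split_coord:
  fixes h :: "real ^ 'm::finite \<Rightarrow> ennreal"
  assumes h: "h \<in> borel_measurable borel"
  shows "(\<integral>\<^sup>+x. h x \<partial>lborel)
    = (\<integral>\<^sup>+w. (\<integral>\<^sup>+t. h (\<chi> j. if j = i then t else w j) \<partial>lborel) \<partial>(\<Pi>\<^sub>M j\<in>UNIV - {i}. lborel))"
proof -
  interpret product_sigma_finite "\<lambda>_::'m. lborel :: real measure" by standard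
  have m: "(\<lambda>w. (\<chi> i. w i) :: real ^ 'm) \<in> borel_measurable (\<Pi>\<^sub>M i\<in>(UNIV::'m set). lborel)"
    by (rule measurable_vec) simp
  have "(\<integral>\<^sup>+x. h x \<partial>lborel) = (\<integral>\<^sup>+w. h (\<chi> i. w i) \<partial>(\<Pi>\<^sub>M i\<in>(UNIV::'m set). lborel))"
    unfolding lborel_eq_distr_PiM by (rule nn_integral_distr[OF m]) (use h in simp)
  also have "\<dots> = (\<integral>\<^sup>+w. h (\<chi> i. w i) \<partial>(\<Pi>\<^sub>M j\<in>insert i (UNIV - {i}). lborel))"
    by (simp add: insert_absorb)
  also have "\<dots> = (\<integral>\<^sup>+w. (\<integral>\<^sup>+t. h (\<chi> j. (w(i := t)) j) \<partial>lborel) \<partial>(\<Pi>\<^sub>M j\<in>UNIV - {i}. lborel))"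
    using measurable_compose[OF m h] by (intro product_nn_integral_insert) (auto simp: insert_absorb)
  finally show ?thesis by (simp add: fun_upd_def)
qed

text \<open>
  Chart of the states in which the particles other than \<open>i\<close> have the energies \<open>w\<close>: particle \<open>i\<close> and the
  tank share the remaining energy, of which the particle has \<open>t\<close>. A ring of particle \<open>i\<close> moves along the
  fibre.
\<close>
definition fibre :: "real \<Rightarrow> 'm \<Rightarrow> ('m \<Rightarrow> real) \<Rightarrow> real \<Rightarrow> 'm::finite state" where
  "fibre E i w t = simplex_chart E (\<chi> j. if j = i then t else w j)"

lemma fibre_simps [simp]:
  "fst (fibre E i w t) $ j = (if j = i then t else w j)"
  "snd (fibre E i w t) = E - (\<Sum>j\<in>UNIV - {i}. w j) - t"
  unfolding fibre_def simplex_chart_def by (auto simp: sum.remove[of UNIV i])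

lemma fibre_in_simplex:
  "fibre E i w t \<in> energy_simplex E \<longleftrightarrow> (\<forall>j\<in>UNIV - {i}. 0 < w j) \<and> t \<in> {0<..<E - (\<Sum>j\<in>UNIV - {i}. w j)}"
  unfolding energy_simplex_iff by (auto simp: sum.remove[of UNIV i])

lemma measurable_simplex_chart [measurable]: "simplex_chart E \<in> borel_measurable borel"
  unfolding simplex_chart_def by (intro borel_measurable_continuous_onI continuous_intros)

lemma sets_simplex_lebesgue [simp, measurable_cong]: "sets (simplex_lebesgue E) = sets borel"
  by (simp add: simplex_lebesgue_def)

lemma nn_integral_simplex_lebesgue:
  fixes g :: "'m::finite state \<Rightarrow> ennreal"
  assumes [measurable]: "g \<in> borel_measurable borel"
  shows "(\<integral>\<^sup>+s. g s \<partial>simplex_lebesgue E)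
    = (\<integral>\<^sup>+x. g (simplex_chart E x) * indicator (energy_simplex E) (simplex_chart E x) \<partial>lborel)"
proof -
  let ?D = "simplex_chart E -` (energy_simplex E :: 'm state set)"
  have D[measurable]: "?D \<in> sets borel" using measurable_sets[OF measurable_simplex_chart energy_simplex_measurable] by simp
  have "(\<integral>\<^sup>+s. g s \<partial>simplex_lebesgue E) = (\<integral>\<^sup>+x. g (simplex_chart E x) \<partial>restrict_space lborel ?D)"
    unfolding simplex_lebesgue_def by (rule nn_integral_distr) (auto intro!: measurable_restrict_space1)
  also have "\<dots> = (\<integral>\<^sup>+x. g (simplex_chart E x) * indicator ?D x \<partial>lborel)"
    by (rule nn_integral_restrict_space) simp
  finally show ?thesis by (simp add: indicator_def)
qed

lemma nn_integral_simplex_fibre: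
  fixes g :: "'m::finite state \<Rightarrow> ennreal"
  assumes [measurable]: "g \<in> borel_measurable borel"
  shows "(\<integral>\<^sup>+s. g s \<partial>simplex_lebesgue E)
    = (\<integral>\<^sup>+w. indicator {w. \<forall>j\<in>UNIV - {i}. 0 < w j} w *
        (\<integral>\<^sup>+t. g (fibre E i w t) * indicator {0<..<E - (\<Sum>j\<in>UNIV - {i}. w j)} t \<partial>lborel) \<partial>(\<Pi>\<^sub>M j\<in>UNIV - {i}. lborel))"
proof -
  have "(\<lambda>x. g (simplex_chart E x) * indicator (energy_simplex E) (simplex_chart E x)) \<in> borel_measurable borel"
    by measurable
  note nn_integral_split_coord[OF this, of i]
  moreover have "(\<integral>\<^sup>+t. g (fibre E i w t) * indicator (energy_simplex E) (fibre E i w t) \<partial>lborel)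
    = indicator {w. \<forall>j\<in>UNIV - {i}. 0 < w j} w *
        (\<integral>\<^sup>+t. g (fibre E i w t) * indicator {0<..<E - (\<Sum>j\<in>UNIV - {i}. w j)} t \<partial>lborel)" for w
  proof (cases "\<forall>j\<in>UNIV - {i}. 0 < w j")
    case True
    then show ?thesis by (simp add: fibre_in_simplex indicator_def)
  next
    case False
    then have "fibre E i w t \<notin> energy_simplex E" for t by (simp add: fibre_in_simplex)
    with False show ?thesis by simp
  qed
  ultimately show ?thesis by (simp add: nn_integral_simplex_lebesgue fibre_def)
qed

text \<open>
  Invariance for one particle and the tank sharing the energy \<open>S\<close>. The tank has energy \<open>z\<close> after the
  ring if the particle had some energy \<open>t\<close> between \<open>z\<close> and \<open>S\<close> before; integrating \<open>t\<close> out gives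
  \<open>2 * sqrt (S - z)\<close>, and \<open>S - z\<close> is the new energy of the particle.
\<close>
lemma energy_exchange_invariant:
  fixes F :: "real \<Rightarrow> ennreal" and S :: real
  assumes [measurable]: "F \<in> borel_measurable borel" and S: "S > 0"
  shows "(\<integral>\<^sup>+t. (ennreal (sqrt t * (S - t) powr (-1/2)) * (\<integral>\<^sup>+u. F (S - u\<^sup>2 * t) \<partial>unit_uniform)) * indicator {0<..<S} t \<partial>lborel)
    = (\<integral>\<^sup>+t. (ennreal (sqrt t * (S - t) powr (-1/2)) * F t) * indicator {0<..<S} t \<partial>lborel)"
proof -
  let ?k = "\<lambda>t z. F (S - z) * ennreal (1 / (2 * sqrt z)) * ennreal ((S - t) powr (-1/2)) * (if 0 < z \<and> z < t \<and> t < S then 1 else 0)"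
  have "(\<integral>\<^sup>+t. (ennreal (sqrt t * (S - t) powr (-1/2)) * (\<integral>\<^sup>+u. F (S - u\<^sup>2 * t) \<partial>unit_uniform)) * indicator {0<..<S} t \<partial>lborel)
      = (\<integral>\<^sup>+t. (\<integral>\<^sup>+z. ?k t z \<partial>lborel) \<partial>lborel)"
  proof (rule nn_integral_cong)
    fix t :: real
    show "(ennreal (sqrt t * (S - t) powr (-1/2)) * (\<integral>\<^sup>+u. F (S - u\<^sup>2 * t) \<partial>unit_uniform)) * indicator {0<..<S} t
        = (\<integral>\<^sup>+z. ?k t z \<partial>lborel)"
    proof (cases "t \<in> {0<..<S}")
      case True
      have "(\<integral>\<^sup>+u. F (S - u\<^sup>2 * t) \<partial>unit_uniform)
          = (\<integral>\<^sup>+z. F (S - z) * ennreal (1 / (2 * sqrt (t * z))) * indicator {0<..<t} z \<partial>lborel)"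
        using True by (intro nn_integral_square_law) auto
      then have "ennreal (sqrt t * (S - t) powr (-1/2)) * (\<integral>\<^sup>+u. F (S - u\<^sup>2 * t) \<partial>unit_uniform)
          = (\<integral>\<^sup>+z. ennreal (sqrt t * (S - t) powr (-1/2)) * (F (S - z) * ennreal (1 / (2 * sqrt (t * z))) * indicator {0<..<t} z) \<partial>lborel)"
        by (simp add: nn_integral_cmult)
      also have "\<dots> = (\<integral>\<^sup>+z. ?k t z \<partial>lborel)"
      proof (rule nn_integral_cong)
        fix z :: real
        show "ennreal (sqrt t * (S - t) powr (-1/2)) * (F (S - z) * ennreal (1 / (2 * sqrt (t * z))) * indicator {0<..<t} z) = ?k t z"
        proof (cases "0 < z \<and> z < t")
          case z: True
          have "sqrt t * (S - t) powr (-1/2) * (1 / (2 * sqrt (t * z))) = 1 / (2 * sqrt z) * (S - t) powr (-1/2)"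
            using z True by (simp add: real_sqrt_mult)
          then have "ennreal (sqrt t * (S - t) powr (-1/2)) * ennreal (1 / (2 * sqrt (t * z))) = ennreal (1 / (2 * sqrt z)) * ennreal ((S - t) powr (-1/2))"
            using z True by (simp only: ennreal_mult[symmetric] real_sqrt_ge_zero powr_ge_zero mult_nonneg_nonneg less_imp_le divide_nonneg_nonneg zero_le_one zero_le_numeral mult_pos_pos greaterThanLessThan_iff)
          with z True show ?thesis by (simp add: mult_ac)
        qed (auto simp: indicator_def)
      qed
      finally show ?thesis using True by simp
    qed (auto intro!: nn_integral_zero')
  qed
  also have "\<dots> = (\<integral>\<^sup>+z. (\<integral>\<^sup>+t. ?k t z \<partial>lborel) \<partial>lborel)"
    by (rule lborel_pair.Fubini') measurable
  also have "\<dots> = (\<integral>\<^sup>+z. (\<lambda>t. (ennreal (sqrt t * (S - t) powr (-1/2)) * F t) * indicator {0<..<S} t) (S - z) \<partial>lborel)"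
  proof (rule nn_integral_cong)
    fix z :: real
    show "(\<integral>\<^sup>+t. ?k t z \<partial>lborel) = (\<lambda>t. (ennreal (sqrt t * (S - t) powr (-1/2)) * F t) * indicator {0<..<S} t) (S - z)"
    proof (cases "0 < z \<and> z < S")
      case True
      have "(\<integral>\<^sup>+t. ?k t z \<partial>lborel) = (\<integral>\<^sup>+t. (F (S - z) * ennreal (1 / (2 * sqrt z))) * (ennreal ((S - t) powr (-1/2)) * indicator {z<..<S} t) \<partial>lborel)"
        using True by (intro nn_integral_cong) (auto simp: indicator_def)
      also have "\<dots> = (F (S - z) * ennreal (1 / (2 * sqrt z))) * (\<integral>\<^sup>+t. ennreal ((S - t) powr (-1/2)) * indicator {z<..<S} t \<partial>lborel)"
        by (rule nn_integral_cmult) measurable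
      also have "(\<integral>\<^sup>+t. ennreal ((S - t) powr (-1/2)) * indicator {z<..<S} t \<partial>lborel)
          = (\<integral>\<^sup>+t. (\<lambda>r. ennreal (r powr (-1/2)) * indicator {0<..<S - z} r) (S - t) \<partial>lborel)"
        by (intro nn_integral_cong) (auto simp: indicator_def)
      also have "\<dots> = (\<integral>\<^sup>+r. ennreal (r powr (-1/2)) * indicator {0<..<S - z} r \<partial>lborel)"
        by (rule nn_integral_reflect) measurable
      also have "\<dots> = ennreal (2 * sqrt (S - z))"
        using True by (subst nn_integral_powr_from_0) (auto simp: powr_half_sqrt)
      also have "(F (S - z) * ennreal (1 / (2 * sqrt z))) * ennreal (2 * sqrt (S - z)) = ennreal (sqrt (S - z) * z powr (-1/2)) * F (S - z)"
      proof -
        have "1 / (2 * sqrt z) * (2 * sqrt (S - z)) = sqrt (S - z) * z powr (-1/2)"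
          using True by (simp add: powr_minus powr_half_sqrt field_simps)
        moreover have "1 / (2 * sqrt z) \<ge> 0" "2 * sqrt (S - z) \<ge> 0" using True by auto
        ultimately show ?thesis by (metis ennreal_mult mult.assoc mult.commute)
      qed
      finally show ?thesis using True by simp
    qed (auto simp: indicator_def intro!: nn_integral_zero')
  qed
  also have "\<dots> = (\<integral>\<^sup>+t. (ennreal (sqrt t * (S - t) powr (-1/2)) * F t) * indicator {0<..<S} t \<partial>lborel)"
    by (rule nn_integral_reflect) measurable
  finally show ?thesis .
qed


lemma AE_simplex_lebesgue: "AE s in simplex_lebesgue E. s \<in> (energy_simplex E :: 'm::finite state set)"
proof -
  have "(\<integral>\<^sup>+s. indicator (- energy_simplex E) s \<partial>simplex_lebesgue E) = (0::ennreal)"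
    by (subst nn_integral_simplex_lebesgue) (auto simp: indicator_def intro!: nn_integral_zero')
  then have "AE s in simplex_lebesgue E. indicator (- energy_simplex E :: 'm state set) s = (0::ennreal)"
    by (subst (asm) nn_integral_0_iff_AE) auto
  then show ?thesis by eventually_elim (auto simp: indicator_def split: if_splits)
qed

text \<open>
  Integrating out the energy of particle \<open>j\<close> first removes the singularity at \<open>y = 0\<close>; the other energies
  then range over a box.
\<close>
lemma simplex_integral_box_bound:
  fixes \<phi> :: "'m::finite \<Rightarrow> real \<Rightarrow> ennreal"
  assumes p: "p < 1" and E: "E > 0" and [measurable]: "\<And>k. \<phi> k \<in> borel_measurable borel"
  shows "(\<integral>\<^sup>+s. (\<Prod>k\<in>UNIV - {j}. \<phi> k (fst s $ k)) * ennreal (snd s powr - p) \<partial>simplex_lebesgue E)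
    \<le> ennreal (E powr (1 - p) / (1 - p)) * (\<Prod>k\<in>UNIV - {j}. \<integral>\<^sup>+t. \<phi> k t * indicator {0<..<E} t \<partial>lborel)"
proof -
  interpret product_sigma_finite "\<lambda>_::'m. lborel :: real measure" by standard
  let ?C = "ennreal (E powr (1 - p) / (1 - p))"
  let ?P = "\<lambda>w. \<Prod>k\<in>UNIV - {j}. \<phi> k (w k)"
  have "(\<integral>\<^sup>+s. (\<Prod>k\<in>UNIV - {j}. \<phi> k (fst s $ k)) * ennreal (snd s powr - p) \<partial>simplex_lebesgue E)
    = (\<integral>\<^sup>+w. indicator {w. \<forall>k\<in>UNIV - {j}. 0 < w k} w *
        (\<integral>\<^sup>+t. (\<Prod>k\<in>UNIV - {j}. \<phi> k (fst (fibre E j w t) $ k)) * ennreal (snd (fibre E j w t) powr - p)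
           * indicator {0<..<E - (\<Sum>k\<in>UNIV - {j}. w k)} t \<partial>lborel) \<partial>(\<Pi>\<^sub>M k\<in>UNIV - {j}. lborel))"
    by (rule nn_integral_simplex_fibre) measurable
  also have "\<dots> \<le> (\<integral>\<^sup>+w. ?C * (\<Prod>k\<in>UNIV - {j}. \<phi> k (w k) * indicator {0<..<E} (w k)) \<partial>(\<Pi>\<^sub>M k\<in>UNIV - {j}. lborel))"
  proof (rule nn_integral_mono)
    fix w :: "'m \<Rightarrow> real"
    define S where "S = E - (\<Sum>k\<in>UNIV - {j}. w k)"
    have eq: "(\<integral>\<^sup>+t. (\<Prod>k\<in>UNIV - {j}. \<phi> k (fst (fibre E j w t) $ k)) * ennreal (snd (fibre E j w t) powr - p)
           * indicator {0<..<E - (\<Sum>k\<in>UNIV - {j}. w k)} t \<partial>lborel)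
        = ?P w * (\<integral>\<^sup>+t. ennreal ((S - t) powr - p) * indicator {0<..<S} t \<partial>lborel)"
      by (subst nn_integral_cmult[symmetric]) (auto simp: S_def mult.assoc intro!: nn_integral_cong prod.cong)
    show "indicator {w. \<forall>k\<in>UNIV - {j}. 0 < w k} w *
        (\<integral>\<^sup>+t. (\<Prod>k\<in>UNIV - {j}. \<phi> k (fst (fibre E j w t) $ k)) * ennreal (snd (fibre E j w t) powr - p)
           * indicator {0<..<E - (\<Sum>k\<in>UNIV - {j}. w k)} t \<partial>lborel)
      \<le> ?C * (\<Prod>k\<in>UNIV - {j}. \<phi> k (w k) * indicator {0<..<E} (w k))"
    proof (cases "(\<forall>k\<in>UNIV - {j}. 0 < w k) \<and> S > 0")
      case True
      have "w k < E" if "k \<in> UNIV - {j}" for k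
      proof -
        have "w k \<le> (\<Sum>k\<in>UNIV - {j}. w k)" using True that by (intro member_le_sum) (auto intro: less_imp_le)
        then show ?thesis using True by (simp add: S_def)
      qed
      then have P: "(\<Prod>k\<in>UNIV - {j}. \<phi> k (w k) * indicator {0<..<E} (w k)) = ?P w"
        using True by (intro prod.cong) auto
      have "(\<Sum>k\<in>UNIV - {j}. w k) \<ge> 0" using True by (intro sum_nonneg) (auto intro: less_imp_le)
      then have "S \<le> E" by (simp add: S_def)
      then have "S powr (1 - p) / (1 - p) \<le> E powr (1 - p) / (1 - p)"
        using True p by (intro divide_right_mono powr_mono2) auto
      moreover have "(\<integral>\<^sup>+t. ennreal ((S - t) powr - p) * indicator {0<..<S} t \<partial>lborel) = ennreal (S powr (1 - p) / (1 - p))"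
        using nn_integral_powr_upto[of "- p" S] True p by simp
      ultimately have "?P w * (\<integral>\<^sup>+t. ennreal ((S - t) powr - p) * indicator {0<..<S} t \<partial>lborel) \<le> ?P w * ?C"
        by (intro mult_left_mono) (auto intro: ennreal_leI)
      then show ?thesis unfolding eq P using True by (simp add: mult.commute)
    next
      case False
      then show ?thesis unfolding eq by (cases "S > 0") auto
    qed
  qed
  also have "\<dots> = ?C * (\<integral>\<^sup>+w. (\<Prod>k\<in>UNIV - {j}. \<phi> k (w k) * indicator {0<..<E} (w k)) \<partial>(\<Pi>\<^sub>M k\<in>UNIV - {j}. lborel))"
    by (rule nn_integral_cmult) measurable
  also have "\<dots> = ?C * (\<Prod>k\<in>UNIV - {j}. \<integral>\<^sup>+t. \<phi> k t * indicator {0<..<E} t \<partial>lborel)"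
    by (subst product_nn_integral_prod[where f = "\<lambda>k t. \<phi> k t * indicator {0<..<E} t"]) auto
  finally show ?thesis .
qed

lemma tank_power_integrable:
  assumes "p < 1" "E > 0"
  shows "(\<integral>\<^sup>+s. ennreal (snd (s :: 'm::finite state) powr - p) \<partial>simplex_lebesgue E) < \<top>"
proof -
  have "(\<integral>\<^sup>+s. ennreal (snd (s :: 'm::finite state) powr - p) \<partial>simplex_lebesgue E)
      \<le> ennreal (E powr (1 - p) / (1 - p)) * (\<Prod>k\<in>(UNIV::'m set) - {undefined}. ennreal E)"
    using simplex_integral_box_bound[OF assms, of "\<lambda>_ _. 1" "undefined :: 'm"] assms by simp
  also have "\<dots> < \<top>" using assms by (simp add: ennreal_mult_less_top prod_ennreal power_less_top_ennreal)
  finally show ?thesis .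
qed

text \<open>
  A second particle \<open>j\<close> separates the two singularities, as one can integrate over its energy first. For
  a single particle the energies sum to \<open>E\<close>, so only one of the two factors is large at a time.
\<close>
lemma particle_tank_power_integrable:
  assumes a: "0 < a" "a < 1" and E: "E > 0"
  shows "(\<integral>\<^sup>+s. ennreal (fst (s :: 'm::finite state) $ i powr - a) * ennreal (snd s powr - (1/2)) \<partial>simplex_lebesgue E) < \<top>"
proof (cases "\<exists>j. j \<noteq> i")
  case True
  then obtain j where j: "j \<noteq> i" by blast
  define \<phi> :: "'m \<Rightarrow> real \<Rightarrow> ennreal" where "\<phi> k t = (if k = i then ennreal (t powr - a) else 1)" for k t
  have \<phi>m: "\<phi> k \<in> borel_measurable borel" for k by (cases "k = i") (auto simp: \<phi>_def[abs_def])
  have "(\<Prod>k\<in>UNIV - {j}. \<phi> k (fst s $ k)) = ennreal (fst s $ i powr - a)" for s :: "'m state"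
    using j by (simp add: \<phi>_def prod.delta)
  then have "(\<integral>\<^sup>+s. ennreal (fst (s :: 'm::finite state) $ i powr - a) * ennreal (snd s powr - (1/2)) \<partial>simplex_lebesgue E)
      \<le> ennreal (E powr (1 - 1/2) / (1 - 1/2)) * (\<Prod>k\<in>UNIV - {j}. \<integral>\<^sup>+t. \<phi> k t * indicator {0<..<E} t \<partial>lborel)"
    using simplex_integral_box_bound[where p = "1/2" and \<phi> = \<phi> and j = j, OF _ E \<phi>m] by simp
  also have "(\<Prod>k\<in>UNIV - {j}. \<integral>\<^sup>+t. \<phi> k t * indicator {0<..<E} t \<partial>lborel)
      = (\<Prod>k\<in>UNIV - {j}. ennreal (if k = i then E powr (1 - a) / (1 - a) else E))"
    using nn_integral_powr_from_0[of "- a" E] a E by (intro prod.cong) (auto simp: \<phi>_def)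
  also have "\<dots> = ennreal (\<Prod>k\<in>UNIV - {j}. if k = i then E powr (1 - a) / (1 - a) else E)"
    using a E by (intro prod_ennreal) auto
  also have "ennreal (E powr (1 - 1/2) / (1 - 1/2)) * \<dots> < \<top>" by (simp add: ennreal_mult_less_top)
  finally show ?thesis .
next
  case False
  then have UN: "(UNIV :: 'm set) = {i}" by auto
  have x: "(\<integral>\<^sup>+s. ennreal (fst (s :: 'm state) $ i powr - a) \<partial>simplex_lebesgue E) < \<top>"
  proof -
    have "(\<integral>\<^sup>+s. ennreal (fst (s :: 'm state) $ i powr - a) \<partial>simplex_lebesgue E)
        = (\<integral>\<^sup>+t. ennreal (t powr - a) * indicator {0<..<E} t \<partial>lborel)"
      by (subst nn_integral_simplex_fibre[of _ _ i]) (simp_all add: UN PiM_empty nn_integral_count_space_finite)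
    then show ?thesis using nn_integral_powr_from_0[of "- a" E] a E by simp
  qed
  have "(\<integral>\<^sup>+s. ennreal (fst (s :: 'm state) $ i powr - a) * ennreal (snd s powr - (1/2)) \<partial>simplex_lebesgue E)
      \<le> (\<integral>\<^sup>+s. ennreal ((E/2) powr - (1/2)) * ennreal (fst (s :: 'm state) $ i powr - a) + ennreal ((E/2) powr - a) * ennreal (snd s powr - (1/2)) \<partial>simplex_lebesgue E)"
  proof (rule nn_integral_mono_AE)
    show "AE s in simplex_lebesgue E. ennreal (fst (s :: 'm state) $ i powr - a) * ennreal (snd s powr - (1/2))
      \<le> ennreal ((E/2) powr - (1/2)) * ennreal (fst s $ i powr - a) + ennreal ((E/2) powr - a) * ennreal (snd s powr - (1/2))"
      using AE_simplex_lebesgue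
    proof eventually_elim
      case (elim s)
      then have s: "0 < fst s $ i" "0 < snd s" "snd s + fst s $ i = E"
        by (auto simp: energy_simplex_iff UN)
      show ?case
      proof (cases "fst s $ i \<le> E/2")
        case True
        then have "ennreal (snd s powr - (1/2)) \<le> ennreal ((E/2) powr - (1/2))"
          using s E by (intro ennreal_leI powr_mono2') auto
        from mult_right_mono[OF this, of "ennreal (fst s $ i powr - a)"] show ?thesis
          by (simp add: mult.commute add_increasing2)
      next
        case False
        then have "ennreal (fst s $ i powr - a) \<le> ennreal ((E/2) powr - a)"
          using s E a by (intro ennreal_leI powr_mono2') auto
        from mult_right_mono[OF this, of "ennreal (snd s powr - (1/2))"] show ?thesis
          by (simp add: add_increasing)
      qed
    qed
  qed
  also have "\<dots> = ennreal ((E/2) powr - (1/2)) * (\<integral>\<^sup>+s. ennreal (fst (s :: 'm state) $ i powr - a) \<partial>simplex_lebesgue E)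
      + ennreal ((E/2) powr - a) * (\<integral>\<^sup>+s. ennreal (snd (s :: 'm state) powr - (1/2)) \<partial>simplex_lebesgue E)"
    by (subst nn_integral_add) (auto simp: nn_integral_cmult)
  also have "\<dots> < \<top>" using x tank_power_integrable[where 'm = 'm, of "1/2" E] E by (simp add: ennreal_mult_less_top)
  finally show ?thesis .
qed

lemma tank_weight_positive:
  assumes E: "E > 0"
  shows "(\<integral>\<^sup>+s. ennreal (snd (s :: 'm::finite state) powr - (1/2)) \<partial>simplex_lebesgue E) \<noteq> 0"
proof
  assume "(\<integral>\<^sup>+s. ennreal (snd (s :: 'm::finite state) powr - (1/2)) \<partial>simplex_lebesgue E) = 0"
  then have "(\<integral>\<^sup>+x. ennreal (snd (simplex_chart E x :: 'm state) powr - (1/2)) * indicator (energy_simplex E) (simplex_chart E x) \<partial>lborel) = 0"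
    by (subst (asm) nn_integral_simplex_lebesgue) auto
  then have AE: "AE x in lborel. ennreal (snd (simplex_chart E x :: 'm state) powr - (1/2)) * indicator (energy_simplex E) (simplex_chart E x) = 0"
    by (subst (asm) nn_integral_0_iff_AE) auto
  define c :: "real ^ 'm" where "c = (\<chi> i. E / CARD('m))"
  have in_simplex: "simplex_chart E x \<in> energy_simplex E" if "x \<in> box 0 c" for x
  proof -
    have x: "0 < x $ i" "x $ i < E / CARD('m)" for i using that by (auto simp: mem_box_cart c_def)
    have "(\<Sum>i\<in>UNIV. x $ i) < (\<Sum>i\<in>(UNIV::'m set). E / CARD('m))" using x by (intro sum_strict_mono) auto
    then show ?thesis using x by (simp add: energy_simplex_iff simplex_chart_def)
  qed
  have "AE x in lborel. x \<notin> box 0 c"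
    using AE
  proof eventually_elim
    case (elim x)
    show ?case
    proof
      assume "x \<in> box 0 c"
      from in_simplex[OF this] elim show False by (simp add: energy_simplex_iff)
    qed
  qed
  then have "emeasure lborel (box 0 c) = 0"
    by (subst (asm) AE_iff_measurable[of "box 0 c"]) auto
  moreover have "emeasure lborel (box 0 c) = ennreal (\<Prod>b\<in>Basis. c \<bullet> b)"
  proof -
    have "\<forall>b\<in>Basis. 0 \<bullet> b \<le> c \<bullet> b"
      using E by (auto simp: Basis_vec_def c_def simp flip: cart_eq_inner_axis)
    then show ?thesis by (simp add: emeasure_lborel_box_eq)
  qed
  moreover have "(\<Prod>b\<in>Basis. c \<bullet> b) > 0"
    using E by (intro prod_pos) (auto simp: Basis_vec_def c_def simp flip: cart_eq_inner_axis)
  ultimately show False by (metis ennreal_eq_0_iff not_le)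
qed

text \<open>
  The normalising integral is finite and positive, so \<open>equilibrium E\<close> is the normalised measure and not an
  artefact of the value \<open>0\<close> of divergent integrals or of division by \<open>0\<close>.
\<close>
lemma nn_integral_equilibrium:
  fixes E :: real
  assumes E: "E > 0"
  obtains c :: real where "c > 0"
    "\<And>g :: 'm::finite state \<Rightarrow> ennreal. g \<in> borel_measurable borel \<Longrightarrow>
      (\<integral>\<^sup>+s. g s \<partial>equilibrium E) = ennreal c * (\<integral>\<^sup>+s. g s * ennreal (snd s powr - (1/2)) \<partial>simplex_lebesgue E)"
    "ennreal c * (\<integral>\<^sup>+s. ennreal (snd (s :: 'm state) powr - (1/2)) \<partial>simplex_lebesgue E) = 1"
proof -
  define Zn where "Zn = (\<integral>\<^sup>+s. ennreal (snd (s :: 'm state) powr - (1/2)) \<partial>simplex_lebesgue E)"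
  define Z where "Z = (LINT s|simplex_lebesgue E. snd (s :: 'm state) powr (-1/2))"
  have "Zn < \<top>" unfolding Zn_def using E by (intro tank_power_integrable) auto
  moreover have "Zn \<noteq> 0" unfolding Zn_def by (rule tank_weight_positive[OF E])
  moreover have "Z = enn2real Zn" unfolding Z_def Zn_def by (subst integral_eq_nn_integral) auto
  ultimately have Z: "Z > 0" "Zn = ennreal Z"
    by (auto simp: enn2real_positive_iff zero_less_iff_neq_zero)
  have "(\<integral>\<^sup>+s. g s \<partial>equilibrium E) = ennreal (1/Z) * (\<integral>\<^sup>+s. g s * ennreal (snd s powr - (1/2)) \<partial>simplex_lebesgue E)"
    if [measurable]: "g \<in> borel_measurable borel" for g :: "'m state \<Rightarrow> ennreal"
  proof -
    have "(\<integral>\<^sup>+s. g s \<partial>equilibrium E) = (\<integral>\<^sup>+s. ennreal (1/Z * snd s powr - (1/2)) * g s \<partial>simplex_lebesgue E)"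
      unfolding equilibrium_def Let_def Z_def[symmetric] case_prod_unfold by (subst nn_integral_density) auto
    also have "\<dots> = (\<integral>\<^sup>+s. ennreal (1/Z) * (g s * ennreal (snd s powr - (1/2))) \<partial>simplex_lebesgue E)"
      using Z by (intro nn_integral_cong) (simp only: ennreal_mult[of "1/Z"] divide_nonneg_pos zero_le_one powr_ge_zero mult_ac)
    also have "\<dots> = ennreal (1/Z) * (\<integral>\<^sup>+s. g s * ennreal (snd s powr - (1/2)) \<partial>simplex_lebesgue E)"
      by (rule nn_integral_cmult) measurable
    finally show ?thesis .
  qed
  moreover have "ennreal (1/Z) * Zn = 1" using Z by (simp add: ennreal_mult[symmetric])
  ultimately show ?thesis using Z by (intro that[of "1/Z"]) (auto simp: Zn_def)
qed

lemma sets_equilibrium [simp, measurable_cong]: "sets (equilibrium E) = sets borel"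
  by (simp add: equilibrium_def Let_def)

lemma space_equilibrium [simp]: "space (equilibrium E) = UNIV"
  using sets_eq_imp_space_eq[OF sets_equilibrium[of E]] by simp

lemma prob_space_equilibrium:
  assumes "E > 0"
  shows "prob_space (equilibrium E :: 'm::finite state measure)"
proof
  obtain c :: real where "\<And>g :: 'm::finite state \<Rightarrow> ennreal. g \<in> borel_measurable borel \<Longrightarrow>
      (\<integral>\<^sup>+s. g s \<partial>equilibrium E) = ennreal c * (\<integral>\<^sup>+s. g s * ennreal (snd s powr - (1/2)) \<partial>simplex_lebesgue E)"
    "ennreal c * (\<integral>\<^sup>+s. ennreal (snd (s :: 'm state) powr - (1/2)) \<partial>simplex_lebesgue E) = 1"
    by (rule nn_integral_equilibrium[OF assms, where 'm = 'm]) blast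
  from this(1)[of "\<lambda>_. 1"] this(2) show "emeasure (equilibrium E :: 'm state measure) (space (equilibrium E)) = 1"
    by simp
qed

lemma AE_equilibrium:
  assumes "E > 0"
  shows "AE s in equilibrium E. s \<in> (energy_simplex E :: 'm::finite state set)"
proof -
  have "AE s in simplex_lebesgue E. s \<in> (energy_simplex E :: 'm::finite state set)" by (rule AE_simplex_lebesgue)
  then show ?thesis unfolding equilibrium_def Let_def by (subst AE_density) (auto elim!: AE_mp)
qed

lemma equilibrium_lyapunov_finite:
  fixes E :: real
  assumes E: "E > 0" and a: "1/2 < a" "a < 1" and K: "K > 0"
  shows "(\<integral>\<^sup>+s. ennreal (lyapunov a K s) \<partial>(equilibrium E :: 'm::finite state measure)) < \<top>"
proof -
  obtain c :: real where c: "\<And>g :: 'm::finite state \<Rightarrow> ennreal. g \<in> borel_measurable borel \<Longrightarrow>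
      (\<integral>\<^sup>+s. g s \<partial>equilibrium E) = ennreal c * (\<integral>\<^sup>+s. g s * ennreal (snd s powr - (1/2)) \<partial>simplex_lebesgue E)"
    by (rule nn_integral_equilibrium[OF E, where 'm = 'm]) blast
  have "(\<integral>\<^sup>+s. ennreal (lyapunov a K s) * ennreal (snd (s :: 'm state) powr - (1/2)) \<partial>simplex_lebesgue E)
      \<le> (\<integral>\<^sup>+s. (\<Sum>i\<in>UNIV. ennreal (fst (s :: 'm state) $ i powr - a) * ennreal (snd s powr - (1/2)))
          + (ennreal (snd s powr - (1/2)) + ennreal K * ennreal (snd s powr - a)) \<partial>simplex_lebesgue E)"
  proof (intro nn_integral_mono)
    fix s :: "'m state"
    let ?q = "snd s powr - (1/2)"
    have q: "snd s powr - (a - 1/2) * ?q = snd s powr - a" by (simp flip: powr_add)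
    have "lyapunov a K s * ?q = (\<Sum>i\<in>UNIV. fst s $ i powr - a * ?q) + (?q + K * snd s powr - a)"
      unfolding lyapunov_def q[symmetric] by (simp add: algebra_simps sum_distrib_left sum_distrib_right)
    then have "ennreal (lyapunov a K s * ?q) = (\<Sum>i\<in>UNIV. ennreal (fst s $ i powr - a * ?q)) + (ennreal ?q + ennreal (K * snd s powr - a))"
      using K by (simp add: sum_nonneg sum_ennreal)
    then show "ennreal (lyapunov a K s) * ennreal ?q \<le> (\<Sum>i\<in>UNIV. ennreal (fst s $ i powr - a) * ennreal ?q)
          + (ennreal ?q + ennreal K * ennreal (snd s powr - a))"
      using K lyapunov_ge_1[of K a s] by (simp add: ennreal_mult)
  qed
  also have "\<dots> = (\<Sum>i\<in>UNIV. \<integral>\<^sup>+s. ennreal (fst (s :: 'm state) $ i powr - a) * ennreal (snd s powr - (1/2)) \<partial>simplex_lebesgue E)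
      + ((\<integral>\<^sup>+s. ennreal (snd (s :: 'm state) powr - (1/2)) \<partial>simplex_lebesgue E)
      + ennreal K * (\<integral>\<^sup>+s. ennreal (snd (s :: 'm state) powr - a) \<partial>simplex_lebesgue E))"
    by (simp add: nn_integral_add nn_integral_sum nn_integral_cmult)
  also have "\<dots> < \<top>"
    using particle_tank_power_integrable[where 'm = 'm, of a E] tank_power_integrable[where 'm = 'm, of "1/2" E] tank_power_integrable[where 'm = 'm, of a E] a E
    by (simp add: ennreal_mult_less_top)
  finally show ?thesis by (subst c) (auto simp: ennreal_mult_less_top)
qed

text \<open>
  On each fibre this is \<open>energy_exchange_invariant\<close>.
\<close>
lemma equilibrium_ring_balance:
  fixes E :: real and f :: "'m::finite state \<Rightarrow> ennreal"
  assumes E: "E > 0" and [measurable]: "f \<in> borel_measurable borel"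
  shows "(\<integral>\<^sup>+s. ennreal (sqrt (fst s $ i)) * ring_average i f s \<partial>equilibrium E)
    = (\<integral>\<^sup>+s. ennreal (sqrt (fst s $ i)) * f s \<partial>equilibrium E)"
proof -
  obtain c :: real where c: "\<And>g :: 'm::finite state \<Rightarrow> ennreal. g \<in> borel_measurable borel \<Longrightarrow>
      (\<integral>\<^sup>+s. g s \<partial>equilibrium E) = ennreal c * (\<integral>\<^sup>+s. g s * ennreal (snd s powr - (1/2)) \<partial>simplex_lebesgue E)"
    by (rule nn_integral_equilibrium[OF E, where 'm = 'm]) blast
  have "(\<integral>\<^sup>+t. ennreal (sqrt (fst (fibre E i w t) $ i)) * ring_average i f (fibre E i w t) * ennreal (snd (fibre E i w t) powr - (1/2)) * indicator {0<..<S} t \<partial>lborel)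
      = (\<integral>\<^sup>+t. ennreal (sqrt (fst (fibre E i w t) $ i)) * f (fibre E i w t) * ennreal (snd (fibre E i w t) powr - (1/2)) * indicator {0<..<S} t \<partial>lborel)"
    if S: "S = E - (\<Sum>j\<in>UNIV - {i}. w j)" for w S
  proof (cases "S > 0")
    case True
    define F where "F t = f (fibre E i w t)" for t
    have "continuous_on UNIV (\<lambda>t::real. if j = i then t else w j)" for j by (cases "j = i") auto
    then have "continuous_on UNIV (\<lambda>t::real. (\<chi> j. if j = i then t else w j) :: real ^ 'm)"
      by (rule continuous_on_vec_lambda)
    then have "(\<lambda>t::real. (\<chi> j. if j = i then t else w j) :: real ^ 'm) \<in> borel_measurable borel"
      by (rule borel_measurable_continuous_onI)
    from measurable_compose[OF this measurable_simplex_chart[of E]]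
    have fm: "fibre E i w \<in> borel_measurable borel" unfolding fibre_def[abs_def] .
    have Fm: "F \<in> borel_measurable borel" unfolding F_def by (rule measurable_compose[OF fm]) simp
    have "ring_update i u (fibre E i w t) = fibre E i w (S - u\<^sup>2 * t)" for u t
      by (rule state_eqI) (auto simp: S algebra_simps)
    then have ra: "ring_average i f (fibre E i w t) = (\<integral>\<^sup>+u. F (S - u\<^sup>2 * t) \<partial>unit_uniform)" for t
      by (simp add: ring_average_def F_def)
    have "(\<integral>\<^sup>+t. ennreal (sqrt (fst (fibre E i w t) $ i)) * ring_average i f (fibre E i w t) * ennreal (snd (fibre E i w t) powr - (1/2)) * indicator {0<..<S} t \<partial>lborel)
        = (\<integral>\<^sup>+t. (ennreal (sqrt t * (S - t) powr (-1/2)) * (\<integral>\<^sup>+u. F (S - u\<^sup>2 * t) \<partial>unit_uniform)) * indicator {0<..<S} t \<partial>lborel)"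
      by (intro nn_integral_cong) (auto simp: ra S[symmetric] ennreal_mult mult_ac indicator_def)
    also have "\<dots> = (\<integral>\<^sup>+t. (ennreal (sqrt t * (S - t) powr (-1/2)) * F t) * indicator {0<..<S} t \<partial>lborel)"
      by (rule energy_exchange_invariant[OF Fm True])
    also have "\<dots> = (\<integral>\<^sup>+t. ennreal (sqrt (fst (fibre E i w t) $ i)) * f (fibre E i w t) * ennreal (snd (fibre E i w t) powr - (1/2)) * indicator {0<..<S} t \<partial>lborel)"
      by (intro nn_integral_cong) (auto simp: F_def S[symmetric] ennreal_mult mult_ac indicator_def)
    finally show ?thesis .
  qed simp
  from this[OF refl] show ?thesis by (simp add: c nn_integral_simplex_fibre[of _ _ i])
qed

lemma equilibrium_uniformised_invariant:
  fixes E \<Lambda> :: real and f :: "'m::finite state \<Rightarrow> ennreal"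
  assumes E: "E > 0" and \<Lambda>: "\<Lambda> > 0" and rate: "\<And>s::'m state. s \<in> energy_simplex E \<Longrightarrow> total_rate s \<le> \<Lambda>"
    and [measurable]: "f \<in> borel_measurable borel"
  shows "(\<integral>\<^sup>+s. uniformised \<Lambda> f s \<partial>equilibrium E) = (\<integral>\<^sup>+s. f s \<partial>equilibrium E)"
proof -
  have w: "ennreal (sqrt r / \<Lambda>) = ennreal (1 / \<Lambda>) * ennreal (sqrt r)" for r
    using \<Lambda> by (simp add: ennreal_mult'[symmetric])
  have bal: "(\<integral>\<^sup>+s. ennreal (sqrt (fst s $ i) / \<Lambda>) * ring_average i f s \<partial>equilibrium E)
      = (\<integral>\<^sup>+s. ennreal (sqrt (fst s $ i) / \<Lambda>) * f s \<partial>equilibrium E)" for i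
    using equilibrium_ring_balance[OF E, of f i] by (simp add: w mult.assoc nn_integral_cmult)
  have "(\<integral>\<^sup>+s. uniformised \<Lambda> f s \<partial>equilibrium E)
      = (\<integral>\<^sup>+s. ennreal (1 - total_rate s / \<Lambda>) * f s \<partial>equilibrium E)
        + (\<Sum>i\<in>UNIV. \<integral>\<^sup>+s. ennreal (sqrt (fst s $ i) / \<Lambda>) * ring_average i f s \<partial>equilibrium E)"
    unfolding uniformised_def by (simp add: nn_integral_add nn_integral_sum)
  also have "\<dots> = (\<integral>\<^sup>+s. ennreal (1 - total_rate s / \<Lambda>) * f s + (\<Sum>i\<in>UNIV. ennreal (sqrt (fst s $ i) / \<Lambda>) * f s) \<partial>equilibrium E)"
    unfolding bal by (simp add: nn_integral_add nn_integral_sum)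
  also have "\<dots> = (\<integral>\<^sup>+s. f s \<partial>equilibrium E)"
  proof (rule nn_integral_cong_AE)
    show "AE s in equilibrium E. ennreal (1 - total_rate s / \<Lambda>) * f s + (\<Sum>i\<in>UNIV. ennreal (sqrt (fst s $ i) / \<Lambda>) * f s) = f s"
      using AE_equilibrium[OF E]
    proof eventually_elim
      case (elim s)
      have "ennreal (1 - total_rate s / \<Lambda>) * f s + (\<Sum>i\<in>UNIV. ennreal (sqrt (fst s $ i) / \<Lambda>) * f s)
          = (ennreal (1 - total_rate s / \<Lambda>) + (\<Sum>i\<in>UNIV. ennreal (sqrt (fst s $ i) / \<Lambda>))) * f s"
        by (simp only: distrib_right sum_distrib_right)
      then show ?case using uniformised_weights[OF elim rate[OF elim] \<Lambda>] by simp
    qed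
  qed
  finally show ?thesis .
qed

section \<open>The Poisson semigroup\<close>

definition poisson_weight :: "real \<Rightarrow> nat \<Rightarrow> real" where
  "poisson_weight \<mu> k = exp (- \<mu>) * \<mu> ^ k / fact k"

text \<open>
  The uniformised chain observed at the times of a Poisson process with rate \<open>\<Lambda>\<close>, that is, the
  exponential of \<open>t\<close> times the generator of the jump process.
\<close>
definition poisson_semigroup :: "real \<Rightarrow> real \<Rightarrow> ('m::finite state \<Rightarrow> ennreal) \<Rightarrow> 'm state \<Rightarrow> ennreal" where
  "poisson_semigroup \<Lambda> t f s = (\<Sum>k. ennreal (poisson_weight (\<Lambda> * t) k) * (uniformised \<Lambda> ^^ k) f s)"

lemma exp_series_sums: "(\<lambda>k. x ^ k / fact k) sums exp (x::real)"
  using exp_converges[of x] by (simp add: divide_inverse mult.commute)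

lemma poisson_weight_sums: "poisson_weight \<mu> sums 1"
  using sums_mult[OF exp_series_sums[of \<mu>], of "exp (- \<mu>)"]
  by (simp add: poisson_weight_def[abs_def] flip: exp_add)

lemma poisson_weight_nonneg: "\<mu> \<ge> 0 \<Longrightarrow> poisson_weight \<mu> k \<ge> 0"
  by (simp add: poisson_weight_def)

lemma poisson_summable_bounded:
  fixes q :: "nat \<Rightarrow> real"
  assumes "\<And>k. \<bar>q k\<bar> \<le> B"
  shows "summable (\<lambda>k. x ^ k / fact k * q k)"
proof (rule summable_comparison_test')
  show "summable (\<lambda>k. \<bar>x\<bar> ^ k / fact k * B)"
    using exp_series_sums[of "\<bar>x\<bar>"] by (intro summable_mult2) (rule sums_summable)
  show "norm (x ^ k / fact k * q k) \<le> \<bar>x\<bar> ^ k / fact k * B" for k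
    using assms[of k] by (simp add: abs_mult power_abs divide_right_mono mult_left_mono)
qed

lemma measurable_uniformised [measurable]:
  assumes [measurable]: "f \<in> borel_measurable borel"
  shows "uniformised \<Lambda> f \<in> borel_measurable borel"
  unfolding uniformised_def by measurable

lemma measurable_uniformised_iterate [measurable]:
  "f \<in> borel_measurable borel \<Longrightarrow> (uniformised \<Lambda> ^^ k) f \<in> borel_measurable borel"
  by (induction k) auto

lemma ring_average_suminf:
  assumes "\<And>k. f k \<in> borel_measurable borel"
  shows "ring_average i (\<lambda>z. \<Sum>k. f k z) s = (\<Sum>k. ring_average i (f k) s)"
  unfolding ring_average_def by (rule nn_integral_suminf) (use assms in measurable)

text \<open>
  The two terms correspond to no ring up to time \<open>t\<close> and to a first ring at time \<open>r\<close>. With \<open>l\<close> the total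
  rate, the derivative in \<open>r\<close> of \<open>exp (- l * r)\<close> times the semigroup at time \<open>t - r\<close> contains only
  the ring terms, since the idle steps of the chain cancel against the exponential; integrating it
  from \<open>0\<close> to \<open>t\<close> gives the claim.
\<close>
lemma poisson_semigroup_renewal:
  fixes f :: "'m::finite state \<Rightarrow> ennreal"
  assumes f[measurable]: "f \<in> borel_measurable borel" and f1: "\<And>z. f z \<le> 1"
    and \<Lambda>: "\<Lambda> > 0" and rate: "\<And>s::'m state. s \<in> energy_simplex E \<Longrightarrow> total_rate s \<le> \<Lambda>"
    and s: "s \<in> energy_simplex E" and t: "t \<ge> 0"
  shows "poisson_semigroup \<Lambda> t f s = ennreal (exp (- total_rate s * t)) * f s
    + (\<integral>\<^sup>+r. ennreal (exp (- total_rate s * r)) *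
        (\<Sum>i\<in>UNIV. ennreal (sqrt (fst s $ i)) * ring_average i (poisson_semigroup \<Lambda> (t - r) f) s) * indicator {0..t} r \<partial>lborel)"
proof -
  interpret Q: markov_operator "energy_simplex E :: 'm state set" borel "uniformised \<Lambda>"
    using rate \<Lambda> by (rule markov_operator_uniformised)
  define l where "l = total_rate s"
  have a: "fst s $ i > 0" for i using s by (auto simp: energy_simplex_iff)
  have l: "0 \<le> l" "l \<le> \<Lambda>"
    using rate[OF s] a by (auto simp: l_def total_rate_def intro!: sum_nonneg intro: less_imp_le)
  define q where "q k = enn2real ((uniformised \<Lambda> ^^ k) f s)" for k
  have Q1: "(uniformised \<Lambda> ^^ k) f z \<le> 1" if "z \<in> energy_simplex E" for k z
    using that f1 by (intro Q.iterate_le_1) auto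
  have q: "(uniformised \<Lambda> ^^ k) f s = ennreal (q k)" "0 \<le> q k" "q k \<le> 1" for k
  proof -
    have "(uniformised \<Lambda> ^^ k) f s < \<top>" using Q1[OF s] by (rule le_less_trans) simp
    then show e: "(uniformised \<Lambda> ^^ k) f s = ennreal (q k)" by (simp add: q_def)
    show "0 \<le> q k" by (simp add: q_def)
    then show "q k \<le> 1" using Q1[OF s, of k] unfolding e by simp
  qed
  define J where "J k = \<Lambda> * q (Suc k) - (\<Lambda> - l) * q k" for k
  have J: "(\<Sum>i\<in>UNIV. ennreal (sqrt (fst s $ i)) * ring_average i ((uniformised \<Lambda> ^^ k) f) s) = ennreal (J k)" "0 \<le> J k" for k
  proof -
    define r where "r i = enn2real (ring_average i ((uniformised \<Lambda> ^^ k) f) s)" for i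
    have r: "ring_average i ((uniformised \<Lambda> ^^ k) f) s = ennreal (r i)" "0 \<le> r i" for i
    proof -
      have "ring_average i ((uniformised \<Lambda> ^^ k) f) s \<le> ring_average i (\<lambda>_. 1) s"
        by (rule ring_average_mono[OF Q1 s])
      then have "ring_average i ((uniformised \<Lambda> ^^ k) f) s < \<top>"
        unfolding ring_average_one by (rule le_less_trans) simp
      then show "ring_average i ((uniformised \<Lambda> ^^ k) f) s = ennreal (r i)" by (simp add: r_def)
    qed (simp add: r_def)
    have e1: "(\<Sum>i\<in>UNIV. ennreal (sqrt (fst s $ i)) * ring_average i ((uniformised \<Lambda> ^^ k) f) s) = ennreal (\<Sum>i\<in>UNIV. sqrt (fst s $ i) * r i)"
      unfolding r using a r by (subst sum_ennreal[symmetric]) (auto simp: ennreal_mult less_imp_le)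
    have nn: "0 \<le> (\<Sum>i\<in>UNIV. sqrt (fst s $ i) * r i)" using a r by (auto intro!: sum_nonneg simp: less_imp_le)
    have "ennreal (q (Suc k)) = uniformised \<Lambda> ((uniformised \<Lambda> ^^ k) f) s" by (simp add: q(1)[symmetric])
    also have "\<dots> = ennreal (1 - l / \<Lambda>) * ennreal (q k) + (\<Sum>i\<in>UNIV. ennreal (1 / \<Lambda>) * (ennreal (sqrt (fst s $ i)) * ennreal (r i)))"
      unfolding uniformised_def q(1) r(1) l_def using \<Lambda> by (simp add: ennreal_mult'[symmetric] mult.assoc[symmetric])
    also have "\<dots> = ennreal ((1 - l / \<Lambda>) * q k + 1 / \<Lambda> * (\<Sum>i\<in>UNIV. sqrt (fst s $ i) * r i))"
      unfolding sum_distrib_left[symmetric] e1[unfolded r] using l \<Lambda> q(2) nn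
      by (simp add: ennreal_mult'[symmetric])
    finally have "q (Suc k) = (1 - l / \<Lambda>) * q k + 1 / \<Lambda> * (\<Sum>i\<in>UNIV. sqrt (fst s $ i) * r i)"
      using q(2) l \<Lambda> nn by (subst (asm) ennreal_inj) auto
    then have "\<Lambda> * q (Suc k) = (\<Lambda> * (1 - l / \<Lambda>)) * q k + (\<Lambda> * (1 / \<Lambda>)) * (\<Sum>i\<in>UNIV. sqrt (fst s $ i) * r i)"
      by (simp only: distrib_left mult.assoc)
    moreover have "\<Lambda> * (1 - l / \<Lambda>) = \<Lambda> - l" using \<Lambda> by (simp add: right_diff_distrib)
    ultimately have "J k = (\<Sum>i\<in>UNIV. sqrt (fst s $ i) * r i)" using \<Lambda> by (simp add: J_def)
    then show "(\<Sum>i\<in>UNIV. ennreal (sqrt (fst s $ i)) * ring_average i ((uniformised \<Lambda> ^^ k) f) s) = ennreal (J k)" "0 \<le> J k"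
      using e1 nn by auto
  qed
  have Jb: "\<bar>J k\<bar> \<le> \<Lambda>" for k
  proof -
    have "\<Lambda> * q (Suc k) \<le> \<Lambda> * 1" using q(3) \<Lambda> by (intro mult_left_mono) auto
    moreover have "0 \<le> (\<Lambda> - l) * q k" using q(2) l by (intro mult_nonneg_nonneg) auto
    ultimately have "J k \<le> \<Lambda>" unfolding J_def by linarith
    then show ?thesis using J(2)[of k] by simp
  qed
  have qb: "\<bar>q k\<bar> \<le> 1" for k using q by simp
  define H where "H x = (\<Sum>k. (\<Lambda> * x) ^ k / fact k * q k)" for x
  define G where "G x = (\<Sum>k. (\<Lambda> * x) ^ k / fact k * J k)" for x
  have sg: "poisson_semigroup \<Lambda> x f s = ennreal (exp (- \<Lambda> * x) * H x)" if "x \<ge> 0" for x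
  proof -
    have "(\<lambda>k. exp (- \<Lambda> * x) * ((\<Lambda> * x) ^ k / fact k * q k)) sums (exp (- \<Lambda> * x) * H x)"
      unfolding H_def using poisson_summable_bounded[OF qb] by (intro sums_mult summable_sums)
    then have "(\<Sum>k. ennreal (exp (- \<Lambda> * x) * ((\<Lambda> * x) ^ k / fact k * q k))) = ennreal (exp (- \<Lambda> * x) * H x)"
      using that \<Lambda> q by (intro suminf_ennreal_eq) auto
    then show ?thesis unfolding poisson_semigroup_def poisson_weight_def q(1)
      using that \<Lambda> q by (simp add: ennreal_mult[symmetric] mult.assoc)
  qed
  have G0: "0 \<le> G x" if "x \<ge> 0" for x
    unfolding G_def using that \<Lambda> J(2) poisson_summable_bounded[OF Jb] by (intro suminf_nonneg) auto
  have sG: "(\<Sum>i\<in>UNIV. ennreal (sqrt (fst s $ i)) * ring_average i (poisson_semigroup \<Lambda> x f) s) = ennreal (exp (- \<Lambda> * x) * G x)"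
    if "x \<ge> 0" for x
  proof -
    have "(\<Sum>i\<in>UNIV. ennreal (sqrt (fst s $ i)) * ring_average i (poisson_semigroup \<Lambda> x f) s)
        = (\<Sum>i\<in>UNIV. (\<Sum>k. ennreal (sqrt (fst s $ i)) * (ennreal (poisson_weight (\<Lambda> * x) k) * ring_average i ((uniformised \<Lambda> ^^ k) f) s)))"
      unfolding poisson_semigroup_def by (subst ring_average_suminf) (auto simp: ring_average_cmult)
    also have "\<dots> = (\<Sum>k. \<Sum>i\<in>UNIV. ennreal (sqrt (fst s $ i)) * (ennreal (poisson_weight (\<Lambda> * x) k) * ring_average i ((uniformised \<Lambda> ^^ k) f) s))"
      by (rule suminf_sum[symmetric]) auto
    also have "\<dots> = (\<Sum>k. ennreal (poisson_weight (\<Lambda> * x) k) * ennreal (J k))"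
      unfolding J(1)[symmetric] by (simp add: sum_distrib_left mult.left_commute)
    also have "\<dots> = (\<Sum>k. ennreal (exp (- \<Lambda> * x) * ((\<Lambda> * x) ^ k / fact k * J k)))"
      using that \<Lambda> J(2) by (simp add: poisson_weight_def ennreal_mult[symmetric] mult.assoc)
    also have "\<dots> = ennreal (exp (- \<Lambda> * x) * G x)"
    proof (rule suminf_ennreal_eq)
      show "(\<lambda>k. exp (- \<Lambda> * x) * ((\<Lambda> * x) ^ k / fact k * J k)) sums (exp (- \<Lambda> * x) * G x)"
        unfolding G_def using poisson_summable_bounded[OF Jb] by (intro sums_mult summable_sums)
    qed (use that \<Lambda> J(2) in auto)
    finally show ?thesis .
  qed
  have dH: "(H has_real_derivative (G x + (\<Lambda> - l) * H x)) (at x)" for x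
  proof -
    define c where "c k = \<Lambda> ^ k / fact k * q k" for k
    have Hc: "H x = (\<Sum>k. c k * x ^ k)" for x by (simp add: H_def c_def power_mult_distrib mult_ac)
    have sm: "summable (\<lambda>k. c k * y ^ k)" for y
      using poisson_summable_bounded[of q 1 "\<Lambda> * y", OF qb] by (simp add: c_def power_mult_distrib mult.assoc mult.commute mult.left_commute)
    have "(H has_real_derivative (\<Sum>k. diffs c k * x ^ k)) (at x)"
      unfolding Hc[abs_def] by (rule termdiffs_strong_converges_everywhere[OF sm])
    also have "(\<lambda>k. diffs c k * x ^ k) = (\<lambda>k. (\<Lambda> * x) ^ k / fact k * J k + (\<Lambda> - l) * ((\<Lambda> * x) ^ k / fact k * q k))"
    proof
      fix k
      have "diffs c k = \<Lambda> ^ Suc k / fact k * q (Suc k)"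
        unfolding diffs_def c_def by (simp add: field_simps del: of_nat_Suc)
      then show "diffs c k * x ^ k = (\<Lambda> * x) ^ k / fact k * J k + (\<Lambda> - l) * ((\<Lambda> * x) ^ k / fact k * q k)"
        by (simp add: J_def power_mult_distrib algebra_simps diff_divide_distrib add_divide_distrib)
    qed
    also have "(\<Sum>k. (\<Lambda> * x) ^ k / fact k * J k + (\<Lambda> - l) * ((\<Lambda> * x) ^ k / fact k * q k)) = G x + (\<Lambda> - l) * H x"
    proof (rule sums_unique[symmetric])
      have "(\<lambda>k. (\<Lambda> * x) ^ k / fact k * J k) sums G x"
        unfolding G_def by (rule summable_sums[OF poisson_summable_bounded[OF Jb]])
      moreover have "(\<lambda>k. (\<Lambda> * x) ^ k / fact k * q k) sums H x"
        unfolding H_def by (rule summable_sums[OF poisson_summable_bounded[OF qb]])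
      ultimately show "(\<lambda>k. (\<Lambda> * x) ^ k / fact k * J k + (\<Lambda> - l) * ((\<Lambda> * x) ^ k / fact k * q k)) sums (G x + (\<Lambda> - l) * H x)"
        by (intro sums_add sums_mult)
    qed
    finally show ?thesis .
  qed
  have Gm: "G \<in> borel_measurable borel" unfolding G_def[abs_def] by measurable
  define \<Phi> where "\<Phi> r = - exp (- l * r) * (exp (- \<Lambda> * (t - r)) * H (t - r))" for r
  define \<phi> where "\<phi> r = exp (- l * r) * (exp (- \<Lambda> * (t - r)) * G (t - r))" for r
  have d\<Phi>: "(\<Phi> has_real_derivative \<phi> r) (at r)" for r
  proof -
    have "((\<lambda>r. t - r) has_real_derivative - 1) (at r)" by (auto intro!: derivative_eq_intros)
    from DERIV_chain2[where f = H and g = "\<lambda>r. t - r", OF dH this]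
    have "((\<lambda>r. H (t - r)) has_real_derivative - (G (t - r) + (\<Lambda> - l) * H (t - r))) (at r)" by simp
    then show ?thesis
      unfolding \<Phi>_def \<phi>_def by (auto intro!: derivative_eq_intros simp: algebra_simps)
  qed
  have int: "(\<integral>\<^sup>+r. ennreal (\<phi> r) * indicator {0..t} r \<partial>lborel) = ennreal (\<Phi> t - \<Phi> 0)"
  proof (rule nn_integral_FTC_Icc)
    show "\<phi> \<in> borel_measurable borel" unfolding \<phi>_def using Gm by measurable
    show "(\<Phi> has_real_derivative \<phi> r) (at r)" if "r \<in> {0..t}" for r by (rule d\<Phi>)
    show "0 \<le> \<phi> r" if "r \<in> {0..t}" for r unfolding \<phi>_def using that G0 by auto
  qed (use t in auto)
  have int': "(\<integral>\<^sup>+r. ennreal (\<phi> r) * indicator {0..t} r \<partial>lborel)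
    = (\<integral>\<^sup>+r. ennreal (exp (- l * r)) *
        (\<Sum>i\<in>UNIV. ennreal (sqrt (fst s $ i)) * ring_average i (poisson_semigroup \<Lambda> (t - r) f) s) * indicator {0..t} r \<partial>lborel)"
    using sG G0 by (intro nn_integral_cong) (auto simp: \<phi>_def indicator_def ennreal_mult)
  have "H 0 = q 0"
    unfolding H_def using suminf_finite[of "{0}" "\<lambda>k. (\<Lambda> * 0) ^ k / fact k * q k"] by simp
  then have \<Phi>t: "\<Phi> t = - (exp (- l * t) * q 0)" by (simp add: \<Phi>_def)
  have \<Phi>0: "\<Phi> 0 = - (exp (- \<Lambda> * t) * H t)" by (simp add: \<Phi>_def)
  have f0: "f s = ennreal (q 0)" using q(1)[of 0] by simp
  have mono: "\<Phi> 0 \<le> \<Phi> t"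
  proof (rule DERIV_nonneg_imp_nondecreasing[OF t])
    fix r assume r: "0 \<le> r" "r \<le> t"
    have "(\<Phi> has_real_derivative \<phi> r) (at r)" by (rule d\<Phi>)
    moreover have "0 \<le> \<phi> r" unfolding \<phi>_def using r G0 by auto
    ultimately show "\<exists>y. (\<Phi> has_real_derivative y) (at r) \<and> 0 \<le> y" by blast
  qed
  have "poisson_semigroup \<Lambda> t f s = ennreal (exp (- l * t) * q 0 + (\<Phi> t - \<Phi> 0))"
    unfolding sg[OF t] \<Phi>t \<Phi>0 by simp
  also have "\<dots> = ennreal (exp (- l * t) * q 0) + ennreal (\<Phi> t - \<Phi> 0)"
    using mono q(2) by (intro ennreal_plus) auto
  also have "ennreal (exp (- l * t) * q 0) = ennreal (exp (- l * t)) * f s"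
    unfolding f0 using q(2) by (intro ennreal_mult) auto
  finally show ?thesis unfolding int[symmetric] int' l_def .
qed

section \<open>Racing exponential clocks\<close>

lemma nn_integral_unit_exponential:
  assumes [measurable]: "h \<in> borel_measurable borel"
  shows "(\<integral>\<^sup>+y. h y \<partial>density lborel (exponential_density 1)) = (\<integral>\<^sup>+y. ennreal (exp (- y)) * h y * indicator {0..} y \<partial>lborel)"
  by (subst nn_integral_density)
     (auto simp: exponential_density_def indicator_def intro!: nn_integral_cong)

lemma unit_exponential_tail:
  assumes "a \<ge> 0"
  shows "emeasure (density lborel (exponential_density 1)) {a<..} = ennreal (exp (- a))"
proof -
  have "emeasure (density lborel (exponential_density 1)) {a<..} = (\<integral>\<^sup>+y. indicator {a<..} y \<partial>density lborel (exponential_density 1))"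
    by simp
  also have "\<dots> = (\<integral>\<^sup>+y. ennreal (exp (- y)) * indicator {a<..} y * indicator {0..} y \<partial>lborel)"
    by (rule nn_integral_unit_exponential) simp
  also have "\<dots> = (\<integral>\<^sup>+y. ennreal (exp (- y)) * indicator {a..} y \<partial>lborel)"
    using assms AE_lborel_singleton[of a]
    by (intro nn_integral_cong_AE) (auto elim!: eventually_mono simp: indicator_def)
  also have "\<dots> = ennreal (0 - (- exp (- a)))"
  proof (rule nn_integral_FTC_atLeast)
    show "((\<lambda>x. - exp (- x)) \<longlongrightarrow> (0::real)) at_top"
      using tendsto_minus[OF filterlim_compose[OF exp_at_bot filterlim_uminus_at_bot_at_top]] by simp
  qed (auto intro!: derivative_eq_intros)
  finally show ?thesis by simp
qed

definition clock_measure :: "('m \<Rightarrow> real) measure" where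
  "clock_measure = (\<Pi>\<^sub>M i\<in>UNIV. density lborel (exponential_density 1))"

text \<open>
  Excludes ties, so that the choice made by the minimiser in \<open>ringing_particle\<close> is irrelevant.
\<close>
definition rings_first :: "'m \<Rightarrow> ('m \<Rightarrow> real) \<Rightarrow> 'm::finite state \<Rightarrow> bool" where
  "rings_first i e s \<longleftrightarrow> (\<forall>j\<in>UNIV - {i}. ring_delay e s i < ring_delay e s j)"

lemma rings_first_ringing_particle:
  assumes "rings_first i e s"
  shows "ringing_particle e s = i"
proof -
  have "ring_delay e s (ringing_particle e s) = ring_delay e s i"
    unfolding ringing_particle_def
  proof (rule arg_min_equality)
    show "ring_delay e s i \<le> ring_delay e s j" for j
      using assms by (cases "j = i") (auto simp: rings_first_def intro: less_imp_le)
  qed simp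
  then show ?thesis using assms unfolding rings_first_def by (metis Diff_iff UNIV_I empty_iff insert_iff less_irrefl)
qed

text \<open>
  Condition on the clock of particle \<open>i\<close>: each other clock rings later with an exponentially small
  probability, and the exponents add up to the total rate.
\<close>
lemma exponential_race_single:
  fixes s :: "'m::finite state" and h :: "real \<Rightarrow> ennreal"
  assumes pos: "\<And>i. fst s $ i > 0" and [measurable]: "h \<in> borel_measurable borel"
  shows "(\<integral>\<^sup>+e. (if rings_first i e s then h (ring_delay e s i) else 0) \<partial>clock_measure)
    = (\<integral>\<^sup>+r. ennreal (sqrt (fst s $ i) * exp (- total_rate s * r)) * h r * indicator {0..} r \<partial>lborel)"
proof -
  let ?X = "density lborel (exponential_density 1)"
  interpret X: prob_space ?X by (rule prob_space_exponential_density) simp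
  interpret product_sigma_finite "\<lambda>_::'m. ?X" by standard
  define a where "a j = sqrt (fst s $ j)" for j
  have a: "a j > 0" for j using pos by (simp add: a_def)
  have del: "ring_delay e s j = e j / a j" for e j by (simp add: ring_delay_def a_def)
  have meas: "(\<lambda>e. if rings_first i e s then h (ring_delay e s i) else 0) \<in> borel_measurable (\<Pi>\<^sub>M i\<in>(UNIV::'m set). ?X)"
    unfolding rings_first_def del by measurable
  have "(\<integral>\<^sup>+e. (if rings_first i e s then h (ring_delay e s i) else 0) \<partial>clock_measure)
      = (\<integral>\<^sup>+e. (if rings_first i e s then h (ring_delay e s i) else 0) \<partial>(\<Pi>\<^sub>M j\<in>insert i (UNIV - {i}). ?X))"
    by (simp add: clock_measure_def insert_absorb)
  also have "\<dots> = (\<integral>\<^sup>+y. (\<integral>\<^sup>+e. (if rings_first i (e(i := y)) s then h (ring_delay (e(i := y)) s i) else 0) \<partial>(\<Pi>\<^sub>M j\<in>UNIV - {i}. ?X)) \<partial>?X)"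
    using meas by (intro product_nn_integral_insert_rev) (auto simp: insert_absorb)
  also have "\<dots> = (\<integral>\<^sup>+y. h (y / a i) * ennreal (\<Prod>j\<in>UNIV - {i}. exp (- (y * a j / a i))) \<partial>?X)"
  proof (rule nn_integral_cong_AE)
    have "AE y in ?X. 0 \<le> y"
      by (subst AE_density) (auto simp: exponential_density_def)
    then show "AE y in ?X. (\<integral>\<^sup>+e. (if rings_first i (e(i := y)) s then h (ring_delay (e(i := y)) s i) else 0) \<partial>(\<Pi>\<^sub>M j\<in>UNIV - {i}. ?X))
        = h (y / a i) * ennreal (\<Prod>j\<in>UNIV - {i}. exp (- (y * a j / a i)))"
    proof eventually_elim
      case (elim y)
      have "(\<integral>\<^sup>+e. (if rings_first i (e(i := y)) s then h (ring_delay (e(i := y)) s i) else 0) \<partial>(\<Pi>\<^sub>M j\<in>UNIV - {i}. ?X))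
          = (\<integral>\<^sup>+e. h (y / a i) * indicator (\<Pi>\<^sub>E j\<in>UNIV - {i}. {y * a j / a i<..}) e \<partial>(\<Pi>\<^sub>M j\<in>UNIV - {i}. ?X))"
      proof (rule nn_integral_cong)
        fix e assume e: "e \<in> space (\<Pi>\<^sub>M j\<in>UNIV - {i}. ?X)"
        have "y / a i < e j / a j \<longleftrightarrow> y * a j / a i < e j" for j
          using a[of i] a[of j] by (simp add: field_simps)
        then have "rings_first i (e(i := y)) s \<longleftrightarrow> e \<in> (\<Pi>\<^sub>E j\<in>UNIV - {i}. {y * a j / a i<..})"
          using e by (auto simp: rings_first_def del space_PiM PiE_iff)
        then show "(if rings_first i (e(i := y)) s then h (ring_delay (e(i := y)) s i) else 0)
            = h (y / a i) * indicator (\<Pi>\<^sub>E j\<in>UNIV - {i}. {y * a j / a i<..}) e"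
          by (simp add: del indicator_def)
      qed
      also have "\<dots> = h (y / a i) * emeasure (\<Pi>\<^sub>M j\<in>UNIV - {i}. ?X) (\<Pi>\<^sub>E j\<in>UNIV - {i}. {y * a j / a i<..})"
        by (rule nn_integral_cmult_indicator) (auto intro!: sets_PiM_I_finite)
      also have "emeasure (\<Pi>\<^sub>M j\<in>UNIV - {i}. ?X) (\<Pi>\<^sub>E j\<in>UNIV - {i}. {y * a j / a i<..}) = (\<Prod>j\<in>UNIV - {i}. emeasure ?X {y * a j / a i<..})"
        by (rule emeasure_PiM) auto
      also have "\<dots> = (\<Prod>j\<in>UNIV - {i}. ennreal (exp (- (y * a j / a i))))"
        using elim a by (intro prod.cong unit_exponential_tail) (auto simp: less_imp_le)
      also have "\<dots> = ennreal (\<Prod>j\<in>UNIV - {i}. exp (- (y * a j / a i)))"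
        by (rule prod_ennreal) simp
      finally show ?case .
    qed
  qed
  also have "\<dots> = (\<integral>\<^sup>+y. ennreal (exp (- y)) * (h (y / a i) * ennreal (\<Prod>j\<in>UNIV - {i}. exp (- (y * a j / a i)))) * indicator {0..} y \<partial>lborel)"
    by (rule nn_integral_unit_exponential) measurable
  also have "\<dots> = (\<integral>\<^sup>+y. (\<lambda>y. ennreal (exp (- (total_rate s * y / a i))) * h (y / a i) * indicator {0..} y) y \<partial>lborel)"
  proof (rule nn_integral_cong)
    fix y :: real
    have "exp (- y) * (\<Prod>j\<in>UNIV - {i}. exp (- (y * a j / a i))) = (\<Prod>j\<in>UNIV. exp (- (y * a j / a i)))"
      using a[of i] by (simp add: prod.remove[of UNIV i])
    also have "\<dots> = exp (- (total_rate s * y / a i))"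
      by (simp add: exp_sum[symmetric] total_rate_def a_def sum_negf sum_divide_distrib sum_distrib_left sum_distrib_right mult.commute)
    finally have e: "ennreal (exp (- y)) * ennreal (\<Prod>j\<in>UNIV - {i}. exp (- (y * a j / a i))) = ennreal (exp (- (total_rate s * y / a i)))"
      by (simp add: ennreal_mult[symmetric] prod_nonneg)
    have "X * (H * Y) * I = X * Y * H * I" for X H Y I :: ennreal by (simp only: ac_simps)
    then show "ennreal (exp (- y)) * (h (y / a i) * ennreal (\<Prod>j\<in>UNIV - {i}. exp (- (y * a j / a i)))) * indicator {0..} y
        = ennreal (exp (- (total_rate s * y / a i))) * h (y / a i) * indicator {0..} y"
      unfolding e[symmetric] .
  qed
  also have "\<dots> = ennreal \<bar>a i\<bar> * (\<integral>\<^sup>+r. (\<lambda>y. ennreal (exp (- (total_rate s * y / a i))) * h (y / a i) * indicator {0..} y) (0 + a i * r) \<partial>lborel)"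
    using a[of i] by (intro nn_integral_real_affine) auto
  also have "\<dots> = (\<integral>\<^sup>+r. ennreal \<bar>a i\<bar> * (ennreal (exp (- (total_rate s * r))) * h r * indicator {0..} r) \<partial>lborel)"
    using a[of i] by (subst nn_integral_cmult) (auto simp: indicator_def zero_le_mult_iff intro!: nn_integral_cong arg_cong2[where f = "(*)"])
  also have "\<dots> = (\<integral>\<^sup>+r. ennreal (a i * exp (- total_rate s * r)) * h r * indicator {0..} r \<partial>lborel)"
    using a[of i] by (intro nn_integral_cong) (simp add: ennreal_mult mult.assoc)
  finally show ?thesis by (simp add: a_def)
qed

lemma nn_integral_exponential_tail:
  assumes "l > 0"
  shows "(\<integral>\<^sup>+r. ennreal (l * exp (- l * r)) * indicator {t..} r \<partial>lborel) = ennreal (exp (- l * t))"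
proof -
  have "(\<integral>\<^sup>+r. ennreal (l * exp (- l * r)) * indicator {t..} r \<partial>lborel) = ennreal (0 - (- exp (- l * t)))"
  proof (rule nn_integral_FTC_atLeast)
    have "filterlim (\<lambda>x. - l * x) at_bot at_top"
      by (rule filterlim_tendsto_neg_mult_at_bot[OF tendsto_const _ filterlim_ident]) (use assms in simp)
    from tendsto_minus[OF filterlim_compose[OF exp_at_bot this]]
    show "((\<lambda>x. - exp (- l * x)) \<longlongrightarrow> 0) at_top" by simp
  qed (use assms in \<open>auto intro!: derivative_eq_intros\<close>)
  then show ?thesis by simp
qed

lemma total_rate_pos: "s \<in> energy_simplex E \<Longrightarrow> total_rate s > 0"
  unfolding total_rate_def by (intro sum_pos) (auto simp: energy_simplex_iff)

lemma prob_space_clock: "prob_space clock_measure"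
  unfolding clock_measure_def by (intro prob_space_PiM prob_space_exponential_density) simp

lemma measurable_rings_first [measurable]:
  "Measurable.pred (clock_measure :: ('m::finite \<Rightarrow> real) measure) (\<lambda>e. rings_first i e s)"
  unfolding rings_first_def ring_delay_def clock_measure_def by measurable

text \<open>
  The events that particle \<open>i\<close> rings strictly first are disjoint, and their probabilities, the quotients
  of the single rates by the total rate, sum to \<open>1\<close>. Hence ties have probability \<open>0\<close>.
\<close>
lemma AE_rings_first:
  fixes s :: "'m::finite state"
  assumes s: "s \<in> energy_simplex E"
  shows "AE e in clock_measure. \<exists>i. rings_first i e s"
proof -
  interpret C: prob_space "clock_measure :: ('m \<Rightarrow> real) measure" by (rule prob_space_clock)
  have pos: "fst s $ i > 0" for i using s by (auto simp: energy_simplex_iff)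
  let ?A = "\<lambda>i. {e \<in> space clock_measure. rings_first i e s}"
  have "emeasure clock_measure (?A i) = ennreal (sqrt (fst s $ i) / total_rate s)" for i
  proof -
    have "emeasure clock_measure (?A i) = (\<integral>\<^sup>+e. indicator (?A i) e \<partial>clock_measure)" by simp
    also have "\<dots> = (\<integral>\<^sup>+e. (if rings_first i e s then 1 else 0) \<partial>clock_measure)"
      by (intro nn_integral_cong) (auto simp: indicator_def)
    also have "\<dots> = (\<integral>\<^sup>+r. ennreal (sqrt (fst s $ i) * exp (- total_rate s * r)) * 1 * indicator {0..} r \<partial>lborel)"
      by (rule exponential_race_single[OF pos]) simp
    also have "\<dots> = (\<integral>\<^sup>+r. ennreal (sqrt (fst s $ i) / total_rate s) * (ennreal (total_rate s * exp (- total_rate s * r)) * indicator {0..} r) \<partial>lborel)"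
      using total_rate_pos[OF s] pos[of i]
      by (intro nn_integral_cong) (simp add: ennreal_mult[symmetric] mult.assoc[symmetric] less_imp_le)
    also have "\<dots> = ennreal (sqrt (fst s $ i) / total_rate s)"
      using nn_integral_exponential_tail[OF total_rate_pos[OF s], of 0] by (subst nn_integral_cmult) auto
    finally show ?thesis .
  qed
  then have "(\<Sum>i\<in>UNIV. emeasure clock_measure (?A i)) = ennreal (\<Sum>i\<in>UNIV. sqrt (fst s $ i) / total_rate s)"
    using total_rate_pos[OF s] pos by (simp add: sum_ennreal less_imp_le)
  also have "(\<Sum>i\<in>UNIV. sqrt (fst s $ i) / total_rate s) = 1"
    using total_rate_pos[OF s] by (simp add: total_rate_def flip: sum_divide_distrib)
  finally have "emeasure clock_measure (\<Union>i. ?A i) = 1"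
  proof (subst (asm) sum_emeasure)
    show "disjoint_family_on ?A UNIV"
      by (auto simp: disjoint_family_on_def dest!: rings_first_ringing_particle)
  qed auto
  then have "C.prob (\<Union>i. ?A i) = 1" by (simp add: measure_def)
  then have "AE e in clock_measure. e \<in> (\<Union>i. ?A i)" by (rule C.AE_prob_1)
  then show ?thesis by eventually_elim auto
qed

lemma exponential_race:
  fixes s :: "'m::finite state" and g :: "'m \<Rightarrow> real \<Rightarrow> ennreal"
  assumes s: "s \<in> energy_simplex E" and [measurable]: "\<And>i. g i \<in> borel_measurable borel"
  shows "(\<integral>\<^sup>+e. g (ringing_particle e s) (ring_delay e s (ringing_particle e s)) \<partial>clock_measure)
    = (\<Sum>i\<in>UNIV. \<integral>\<^sup>+r. ennreal (sqrt (fst s $ i) * exp (- total_rate s * r)) * g i r * indicator {0..} r \<partial>lborel)"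
proof -
  have pos: "fst s $ i > 0" for i using s by (auto simp: energy_simplex_iff)
  have "(\<integral>\<^sup>+e. g (ringing_particle e s) (ring_delay e s (ringing_particle e s)) \<partial>clock_measure)
      = (\<integral>\<^sup>+e. (\<Sum>i\<in>UNIV. if rings_first i e s then g i (ring_delay e s i) else 0) \<partial>clock_measure)"
  proof (rule nn_integral_cong_AE)
    show "AE e in clock_measure. g (ringing_particle e s) (ring_delay e s (ringing_particle e s))
        = (\<Sum>i\<in>UNIV. if rings_first i e s then g i (ring_delay e s i) else 0)"
      using AE_rings_first[OF s]
    proof eventually_elim
      case (elim e)
      then obtain i where i: "rings_first i e s" by blast
      have "rings_first j e s \<longleftrightarrow> j = i" for j
        using i rings_first_ringing_particle[OF i] rings_first_ringing_particle[of j e s] by auto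
      then show ?case using rings_first_ringing_particle[OF i] by (simp add: sum.delta)
    qed
  qed
  also have "\<dots> = (\<Sum>i\<in>UNIV. \<integral>\<^sup>+e. (if rings_first i e s then g i (ring_delay e s i) else 0) \<partial>clock_measure)"
  proof (rule nn_integral_sum)
    fix i
    have [measurable]: "(\<lambda>e. ring_delay e s i) \<in> borel_measurable (clock_measure :: ('m \<Rightarrow> real) measure)"
      unfolding ring_delay_def clock_measure_def by measurable
    show "(\<lambda>e. if rings_first i e s then g i (ring_delay e s i) else 0) \<in> borel_measurable clock_measure"
      by measurable
  qed
  also have "\<dots> = (\<Sum>i\<in>UNIV. \<integral>\<^sup>+r. ennreal (sqrt (fst s $ i) * exp (- total_rate s * r)) * g i r * indicator {0..} r \<partial>lborel)"
    by (intro sum.cong exponential_race_single pos) auto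
  finally show ?thesis .
qed

section \<open>The law of the process\<close>

lemma noise_measure_eq: "noise_measure = clock_measure \<Otimes>\<^sub>M unit_uniform"
  by (simp add: noise_measure_def clock_measure_def unit_uniform_def)

lemma prob_space_noise: "prob_space (noise_measure :: 'm::finite noise measure)"
proof -
  interpret C: prob_space "clock_measure :: ('m \<Rightarrow> real) measure" by (rule prob_space_clock)
  interpret U: prob_space unit_uniform by simp
  interpret P: pair_prob_space "clock_measure :: ('m \<Rightarrow> real) measure" unit_uniform ..
  show ?thesis unfolding noise_measure_eq by (rule P.prob_space_axioms)
qed

lemma measurable_clock_component: "(\<lambda>e. e j) \<in> borel_measurable (clock_measure :: ('m::finite \<Rightarrow> real) measure)"
  unfolding clock_measure_def by measurable

text \<open>
  The minimiser picked by the choice operator depends only on the set of all minimisers, which takes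
  finitely many values.
\<close>
lemma measurable_arg_min_finite:
  fixes d :: "'m::finite \<Rightarrow> 'a \<Rightarrow> real"
  assumes [measurable]: "\<And>j. d j \<in> borel_measurable M"
  shows "(\<lambda>x. ARG_MIN (\<lambda>i. d i x) i. True) \<in> M \<rightarrow>\<^sub>M count_space UNIV"
proof -
  define A where "A x = {i. \<forall>j. \<not> d j x < d i x}" for x
  have "A \<in> M \<rightarrow>\<^sub>M count_space UNIV"
  proof (subst measurable_count_space_eq2, simp, intro conjI ballI)
    fix B :: "'m set"
    have "A -` {B} \<inter> space M = {x \<in> space M. \<forall>i. i \<in> B \<longleftrightarrow> (\<forall>j. \<not> d j x < d i x)}"
      by (auto simp: A_def)
    also have "\<dots> \<in> sets M" by measurable
    finally show "A -` {B} \<inter> space M \<in> sets M" .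
  qed simp
  then have "(\<lambda>x. SOME i. i \<in> A x) \<in> M \<rightarrow>\<^sub>M count_space UNIV"
    by (rule measurable_compose) simp
  then show ?thesis by (simp add: arg_min_def is_arg_min_def A_def)
qed

definition next_state :: "'m noise \<Rightarrow> 'm::finite state \<Rightarrow> 'm state" where
  "next_state z s = ring_update (ringing_particle (fst z) s) (snd z) s"

definition next_delay :: "'m noise \<Rightarrow> 'm::finite state \<Rightarrow> real" where
  "next_delay z s = ring_delay (fst z) s (ringing_particle (fst z) s)"

lemma measurable_ringing_particle:
  fixes s :: "'a \<Rightarrow> 'm::finite state"
  assumes [measurable]: "\<And>j. (\<lambda>x. e x j) \<in> borel_measurable M" "s \<in> borel_measurable M"
  shows "(\<lambda>x. ringing_particle (e x) (s x)) \<in> M \<rightarrow>\<^sub>M count_space UNIV"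
proof -
  have "(\<lambda>x. ring_delay (e x) (s x) j) \<in> borel_measurable M" for j
    unfolding ring_delay_def by measurable
  from measurable_arg_min_finite[OF this] show ?thesis by (simp add: ringing_particle_def)
qed

lemma measurable_next_state:
  fixes s :: "'a \<Rightarrow> 'm::finite state"
  assumes [measurable]: "\<And>j. (\<lambda>x. fst (z x) j) \<in> borel_measurable M" "(\<lambda>x. snd (z x)) \<in> borel_measurable M" "s \<in> borel_measurable M"
  shows "(\<lambda>x. next_state (z x) (s x)) \<in> borel_measurable M"
proof -
  have [measurable]: "(\<lambda>x. ring_update i (snd (z x)) (s x)) \<in> borel_measurable M" for i
    using measurable_compose[OF measurable_Pair[OF assms(2,3)] measurable_ring_update, of i] by simp
  show ?thesis unfolding next_state_def
    by (rule measurable_compose_countable[OF _ measurable_ringing_particle]) measurable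
qed

lemma measurable_next_delay:
  fixes s :: "'a \<Rightarrow> 'm::finite state"
  assumes [measurable]: "\<And>j. (\<lambda>x. fst (z x) j) \<in> borel_measurable M" "s \<in> borel_measurable M"
  shows "(\<lambda>x. next_delay (z x) (s x)) \<in> borel_measurable M"
proof -
  have [measurable]: "(\<lambda>x. ring_delay (fst (z x)) (s x) j) \<in> borel_measurable M" for j
    unfolding ring_delay_def by measurable
  show ?thesis unfolding next_delay_def
    by (rule measurable_compose_countable[OF _ measurable_ringing_particle]) measurable
qed

lemma measurable_noise_components:
  "(\<lambda>z. fst z j) \<in> borel_measurable (noise_measure :: 'm::finite noise measure)"
  "snd \<in> borel_measurable (noise_measure :: 'm noise measure)"
proof -
  note [measurable] = measurable_clock_component
  show "(\<lambda>z. fst z j) \<in> borel_measurable (noise_measure :: 'm::finite noise measure)"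
    "snd \<in> borel_measurable (noise_measure :: 'm noise measure)"
    unfolding noise_measure_eq by measurable
qed

lemma ring_chain_Suc:
  "ring_chain s \<omega> (Suc n) = (next_state (\<omega> !! n) (fst (ring_chain s \<omega> n)),
    snd (ring_chain s \<omega> n) + next_delay (\<omega> !! n) (fst (ring_chain s \<omega> n)))"
  by (simp add: next_state_def next_delay_def Let_def split: prod.split)

declare ring_chain.simps(2) [simp del]

lemma measurable_ring_chain:
  "(\<lambda>\<omega>. fst (ring_chain s \<omega> n)) \<in> borel_measurable (stream_space (noise_measure :: 'm::finite noise measure))"
  "(\<lambda>\<omega>. snd (ring_chain s \<omega> n)) \<in> borel_measurable (stream_space (noise_measure :: 'm noise measure))"
proof (induction n)
  case 0
  {
    case 1 then show ?case by simp
  next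
    case 2 then show ?case by simp
  }
next
  case (Suc n)
  note [measurable] = measurable_noise_components
  have c [measurable]: "(\<lambda>\<omega>. fst (\<omega> !! n) j) \<in> borel_measurable (stream_space (noise_measure :: 'm::finite noise measure))"
    "(\<lambda>\<omega>. snd (\<omega> !! n)) \<in> borel_measurable (stream_space (noise_measure :: 'm::finite noise measure))" for j
    by measurable
  {
    case 1 then show ?case unfolding ring_chain_Suc fst_conv by (intro measurable_next_state c Suc)
  next
    case 2
    have "(\<lambda>\<omega>. next_delay (\<omega> !! n) (fst (ring_chain s \<omega> n))) \<in> borel_measurable (stream_space (noise_measure :: 'm::finite noise measure))"
      by (intro measurable_next_delay c Suc)
    then show ?case unfolding ring_chain_Suc snd_conv using Suc(2) by measurable
  }
qed

lemma measurable_state_at: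
  "(\<lambda>\<omega>. state_at s \<omega> t) \<in> borel_measurable (stream_space (noise_measure :: 'm::finite noise measure))"
proof -
  note [measurable] = measurable_ring_chain
  show ?thesis unfolding state_at_def
    by (rule measurable_compose_countable[where f = "\<lambda>n \<omega>. fst (ring_chain s \<omega> n)"]) measurable
qed

lemma ring_chain_shift:
  "ring_chain s (z ## \<omega>) (Suc n) =
    (fst (ring_chain (next_state z s) \<omega> n), next_delay z s + snd (ring_chain (next_state z s) \<omega> n))"
  by (induction n) (simp_all add: ring_chain_Suc add.assoc)

text \<open>
  Restricts to the event that fewer than \<open>n\<close> rings occur up to time \<open>t\<close>. There the number of rings is
  well defined, and a recursion in \<open>n\<close> replaces an argument about explosion.
\<close>
definition truncated :: "nat \<Rightarrow> ('m::finite state \<Rightarrow> ennreal) \<Rightarrow> real \<Rightarrow> 'm state \<Rightarrow> 'm noise stream \<Rightarrow> ennreal" where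
  "truncated n f t s \<omega> = (if \<exists>k\<le>n. t < snd (ring_chain s \<omega> k) then f (state_at s \<omega> t) else 0)"

text \<open>
  Splits off the first ring; for \<open>t \<ge> 0\<close> the index \<open>k = 0\<close> never witnesses the event.
\<close>
lemma truncated_shift:
  assumes t: "t \<ge> 0"
  shows "truncated (Suc n) f t s (z ## \<omega>)
    = (if t < next_delay z s then f s else truncated n f (t - next_delay z s) (next_state z s) \<omega>)"
proof (cases "t < next_delay z s")
  case True
  have 1: "t < snd (ring_chain s (z ## \<omega>) (Suc 0))" using True by (simp add: ring_chain_shift)
  then have "(LEAST k. t < snd (ring_chain s (z ## \<omega>) (Suc k))) = 0" by (rule Least_eq_0)
  then have "state_at s (z ## \<omega>) t = s" by (simp add: state_at_def)
  moreover have "\<exists>k\<le>Suc n. t < snd (ring_chain s (z ## \<omega>) k)" using 1 by (intro exI[of _ "Suc 0"]) auto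
  ultimately show ?thesis using True by (simp add: truncated_def)
next
  case False
  let ?T = "\<lambda>k. snd (ring_chain (next_state z s) \<omega> k)" and ?t = "t - next_delay z s"
  have shift: "t < snd (ring_chain s (z ## \<omega>) (Suc k)) \<longleftrightarrow> ?t < ?T k" for k
    by (auto simp: ring_chain_shift)
  have ex: "(\<exists>k\<le>Suc n. t < snd (ring_chain s (z ## \<omega>) k)) \<longleftrightarrow> (\<exists>k\<le>n. ?t < ?T k)"
  proof
    assume "\<exists>k\<le>Suc n. t < snd (ring_chain s (z ## \<omega>) k)"
    then obtain k where k: "k \<le> Suc n" "t < snd (ring_chain s (z ## \<omega>) k)" by blast
    then obtain l where "k = Suc l" using t by (cases k) auto
    with k shift show "\<exists>k\<le>n. ?t < ?T k" by auto
  qed (use shift in blast)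
  have "state_at s (z ## \<omega>) t = state_at (next_state z s) \<omega> ?t" if "\<exists>k\<le>n. ?t < ?T k"
  proof -
    have not0: "\<not> ?t < ?T 0" using False by simp
    from that obtain k where k: "?t < ?T k" by blast
    have "(LEAST k. ?t < ?T k) = Suc (LEAST k. ?t < ?T (Suc k))"
      by (rule Least_Suc[OF k not0])
    then have "(LEAST k. t < snd (ring_chain s (z ## \<omega>) (Suc k))) = Suc (LEAST k. ?t < ?T (Suc k))"
      unfolding shift .
    then show ?thesis by (simp add: state_at_def ring_chain_shift)
  qed
  then show ?thesis using False
    by (cases "\<exists>k\<le>n. ?t < ?T k") (simp_all only: truncated_def ex if_True if_False)
qed

definition truncated_mean :: "nat \<Rightarrow> ('m::finite state \<Rightarrow> ennreal) \<Rightarrow> real \<Rightarrow> 'm state \<Rightarrow> ennreal" where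
  "truncated_mean n f t s = (\<integral>\<^sup>+\<omega>. truncated n f t s \<omega> \<partial>stream_space noise_measure)"

lemma measurable_truncated:
  assumes [measurable]: "f \<in> borel_measurable borel"
  shows "truncated n f t s \<in> borel_measurable (stream_space noise_measure)"
proof -
  note [measurable] = measurable_ring_chain measurable_state_at
  show ?thesis unfolding truncated_def[abs_def] by measurable
qed

lemma truncated_mean_0: "t \<ge> 0 \<Longrightarrow> truncated_mean 0 f t s = 0"
  by (simp add: truncated_mean_def truncated_def)

lemma truncated_mean_Suc:
  fixes s :: "'m::finite state"
  assumes f[measurable]: "f \<in> borel_measurable borel" and t: "t \<ge> 0"
  shows "truncated_mean (Suc n) f t s
    = (\<integral>\<^sup>+z. (if t < next_delay z s then f s else truncated_mean n f (t - next_delay z s) (next_state z s)) \<partial>noise_measure)" (is ?eq)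
    and "(\<lambda>z. if t < next_delay z s then f s else truncated_mean n f (t - next_delay z s) (next_state z s)) \<in> borel_measurable noise_measure" (is ?meas)
proof -
  interpret N: prob_space "noise_measure :: 'm noise measure" by (rule prob_space_noise)
  interpret S: prob_space "stream_space (noise_measure :: 'm noise measure)" by (rule N.prob_space_stream_space)
  have eq: "(\<integral>\<^sup>+\<omega>. truncated (Suc n) f t s (z ## \<omega>) \<partial>stream_space noise_measure)
      = (if t < next_delay z s then f s else truncated_mean n f (t - next_delay z s) (next_state z s))" for z
    by (simp add: truncated_shift[OF t] truncated_mean_def S.emeasure_space_1)
  note [measurable] = measurable_truncated[OF f]
  show ?eq unfolding truncated_mean_def[of "Suc n"] eq[symmetric]
    by (rule N.nn_integral_stream_space) measurable
  show ?meas unfolding eq[symmetric] by measurable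
qed

lemma nn_integral_next_ring:
  fixes s :: "'m::finite state" and G :: "real \<Rightarrow> 'm state \<Rightarrow> ennreal"
  assumes s: "s \<in> energy_simplex E"
    and G[measurable]: "case_prod G \<in> borel_measurable (borel \<Otimes>\<^sub>M borel)"
  shows "(\<integral>\<^sup>+z. G (next_delay z s) (next_state z s) \<partial>noise_measure)
    = (\<integral>\<^sup>+r. ennreal (exp (- total_rate s * r)) * (\<Sum>i\<in>UNIV. ennreal (sqrt (fst s $ i)) * ring_average i (G r) s) * indicator {0..} r \<partial>lborel)"
proof -
  interpret U: prob_space unit_uniform by simp
  have pos: "fst s $ i > 0" for i using s by (auto simp: energy_simplex_iff)
  have ra[measurable]: "(\<lambda>r. ring_average i (G r) s) \<in> borel_measurable borel" for i
  proof -
    have "(\<lambda>(r, u). (r, ring_update i u s)) \<in> borel \<Otimes>\<^sub>M unit_uniform \<rightarrow>\<^sub>M borel \<Otimes>\<^sub>M borel" by measurable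
    from measurable_compose[OF this G]
    have "(\<lambda>(r, u). G r (ring_update i u s)) \<in> borel_measurable (borel \<Otimes>\<^sub>M unit_uniform)"
      by (simp add: case_prod_unfold)
    then show ?thesis unfolding ring_average_def by (rule U.borel_measurable_nn_integral)
  qed
  have "(\<lambda>z. G (next_delay z s) (next_state z s)) \<in> borel_measurable noise_measure"
  proof -
    have "(\<lambda>z. (next_delay z s, next_state z s)) \<in> noise_measure \<rightarrow>\<^sub>M borel \<Otimes>\<^sub>M borel"
      by (intro measurable_Pair measurable_next_delay measurable_next_state measurable_noise_components) auto
    from measurable_compose[OF this G] show ?thesis by simp
  qed
  then have "(\<integral>\<^sup>+z. G (next_delay z s) (next_state z s) \<partial>noise_measure)
      = (\<integral>\<^sup>+e. (\<integral>\<^sup>+u. G (next_delay (e, u) s) (next_state (e, u) s) \<partial>unit_uniform) \<partial>clock_measure)"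
    unfolding noise_measure_eq by (rule U.nn_integral_fst[symmetric])
  also have "\<dots> = (\<integral>\<^sup>+e. (\<lambda>i r. ring_average i (G r) s) (ringing_particle e s) (ring_delay e s (ringing_particle e s)) \<partial>clock_measure)"
    by (simp add: next_delay_def next_state_def ring_average_def)
  also have "\<dots> = (\<Sum>i\<in>UNIV. \<integral>\<^sup>+r. ennreal (sqrt (fst s $ i) * exp (- total_rate s * r)) * ring_average i (G r) s * indicator {0..} r \<partial>lborel)"
    by (rule exponential_race[OF s ra])
  also have "\<dots> = (\<integral>\<^sup>+r. (\<Sum>i\<in>UNIV. ennreal (sqrt (fst s $ i) * exp (- total_rate s * r)) * ring_average i (G r) s * indicator {0..} r) \<partial>lborel)"
    by (rule nn_integral_sum[symmetric]) measurable
  also have "\<dots> = (\<integral>\<^sup>+r. ennreal (exp (- total_rate s * r)) * (\<Sum>i\<in>UNIV. ennreal (sqrt (fst s $ i)) * ring_average i (G r) s) * indicator {0..} r \<partial>lborel)"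
    using pos by (intro nn_integral_cong) (simp add: sum_distrib_left sum_distrib_right ennreal_mult less_imp_le mult_ac)
  finally show ?thesis .
qed


lemma suminf_poisson_weight:
  assumes "\<mu> \<ge> 0"
  shows "(\<Sum>k. ennreal (poisson_weight \<mu> k)) = 1"
proof -
  have "(\<Sum>k. ennreal (poisson_weight \<mu> k)) = ennreal 1"
    by (rule suminf_ennreal_eq[OF poisson_weight_nonneg[OF assms] poisson_weight_sums])
  then show ?thesis by (simp only: ennreal_1)
qed

lemma measurable_poisson_semigroup:
  assumes [measurable]: "f \<in> borel_measurable borel"
  shows "(\<lambda>(t, s). poisson_semigroup \<Lambda> t f s) \<in> borel_measurable (borel \<Otimes>\<^sub>M borel)"
proof -
  have [measurable]: "(uniformised \<Lambda> ^^ k) f \<in> borel_measurable borel" for k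
    using assms by (rule measurable_uniformised_iterate)
  show ?thesis unfolding poisson_semigroup_def poisson_weight_def case_prod_unfold by measurable
qed

lemma poisson_semigroup_first_ring:
  fixes f :: "'m::finite state \<Rightarrow> ennreal"
  assumes f[measurable]: "f \<in> borel_measurable borel" and f1: "\<And>z. f z \<le> 1"
    and \<Lambda>: "\<Lambda> > 0" and rate: "\<And>s::'m state. s \<in> energy_simplex E \<Longrightarrow> total_rate s \<le> \<Lambda>"
    and s: "s \<in> energy_simplex E" and t: "t \<ge> 0"
  shows "poisson_semigroup \<Lambda> t f s
    = (\<integral>\<^sup>+z. (if t < next_delay z s then f s else poisson_semigroup \<Lambda> (t - next_delay z s) f (next_state z s)) \<partial>noise_measure)"
proof -
  define l where "l = total_rate s"
  have l: "l > 0" using total_rate_pos[OF s] by (simp add: l_def)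
  have pos: "fst s $ i > 0" for i using s by (auto simp: energy_simplex_iff)
  define G where "G r z = (if t < r then f s else poisson_semigroup \<Lambda> (t - r) f z)" for r z
  define R where "R r = (\<Sum>i\<in>UNIV. ennreal (sqrt (fst s $ i)) * ring_average i (poisson_semigroup \<Lambda> (t - r) f) s)" for r
  have m: "(\<lambda>(r, z). poisson_semigroup \<Lambda> (t - r) f z) \<in> borel_measurable (borel \<Otimes>\<^sub>M borel)"
  proof -
    have "(\<lambda>(r, z). (t - r, z)) \<in> borel \<Otimes>\<^sub>M (borel :: 'm state measure) \<rightarrow>\<^sub>M borel \<Otimes>\<^sub>M borel" by measurable
    from measurable_compose[OF this measurable_poisson_semigroup[OF f]] show ?thesis by (simp add: case_prod_unfold)
  qed
  have G: "case_prod G \<in> borel_measurable (borel \<Otimes>\<^sub>M borel)"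
    unfolding G_def case_prod_unfold using m[unfolded case_prod_unfold] by measurable
  have R[measurable]: "R \<in> borel_measurable borel"
  proof -
    have "ring_average i (poisson_semigroup \<Lambda> (t - r) f) s = (\<Sum>k. ennreal (poisson_weight (\<Lambda> * (t - r)) k) * ring_average i ((uniformised \<Lambda> ^^ k) f) s)" for i r
      unfolding poisson_semigroup_def[abs_def] by (subst ring_average_suminf) (auto simp: ring_average_cmult)
    then show ?thesis unfolding R_def poisson_weight_def by simp
  qed
  have GR: "(\<Sum>i\<in>UNIV. ennreal (sqrt (fst s $ i)) * ring_average i (G r) s) = (if t < r then ennreal l * f s else R r)" for r
  proof (cases "t < r")
    case True
    have "ring_average i (G r) s = f s" for i
      using True ring_average_cmult[of "\<lambda>_. 1" i "f s" s] by (simp add: G_def[abs_def] ring_average_one)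
    then show ?thesis using True pos
      by (simp add: l_def total_rate_def sum_distrib_right[symmetric] sum_ennreal less_imp_le)
  next
    case False
    then show ?thesis by (simp add: G_def[abs_def] R_def)
  qed
  have "(\<integral>\<^sup>+z. G (next_delay z s) (next_state z s) \<partial>noise_measure)
      = (\<integral>\<^sup>+r. ennreal (exp (- l * r)) * (if t < r then ennreal l * f s else R r) * indicator {0..} r \<partial>lborel)"
    unfolding nn_integral_next_ring[OF s G] GR l_def ..
  also have "\<dots> = (\<integral>\<^sup>+r. f s * (ennreal (l * exp (- l * r)) * indicator {t..} r) + ennreal (exp (- l * r)) * R r * indicator {0..t} r \<partial>lborel)"
    using AE_lborel_singleton[of t] t l
    by (intro nn_integral_cong_AE) (auto elim!: eventually_mono simp: indicator_def ennreal_mult mult_ac)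
  also have "\<dots> = f s * ennreal (exp (- l * t)) + (\<integral>\<^sup>+r. ennreal (exp (- l * r)) * R r * indicator {0..t} r \<partial>lborel)"
    by (subst nn_integral_add) (auto simp: nn_integral_cmult nn_integral_exponential_tail[OF l, simplified])
  also have "\<dots> = poisson_semigroup \<Lambda> t f s"
    using poisson_semigroup_renewal[OF f f1 \<Lambda> rate s t] by (simp add: l_def R_def mult.commute)
  finally show ?thesis by (simp add: G_def)
qed

text \<open>
  The rings occur at rate at most \<open>\<Lambda>\<close>, so an error \<open>(\<Lambda> * t) ^ n / fact n\<close> after the first ring integrates
  to at most the next term of this sequence.
\<close>
lemma truncation_error_step:
  assumes \<Lambda>: "\<Lambda> > 0" and rate: "total_rate s \<le> \<Lambda>" and s: "s \<in> energy_simplex E" and t: "t \<ge> 0"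
  shows "(\<integral>\<^sup>+z. (if t < next_delay z s then 0 else ennreal ((\<Lambda> * (t - next_delay z s)) ^ n / fact n)) \<partial>noise_measure)
    \<le> ennreal ((\<Lambda> * t) ^ Suc n / fact (Suc n))"
proof -
  have pos: "fst s $ i > 0" for i using s by (auto simp: energy_simplex_iff)
  define l where "l = total_rate s"
  have l: "l > 0" "l \<le> \<Lambda>" using total_rate_pos[OF s] rate by (auto simp: l_def)
  define h where "h r = (if t < r then 0 else ennreal ((\<Lambda> * (t - r)) ^ n / fact n))" for r
  have [measurable]: "h \<in> borel_measurable borel" unfolding h_def by measurable
  have "ring_average i (\<lambda>_. h r) s = h r" for i r
    using ring_average_cmult[of "\<lambda>_. 1" i "h r" s] by (simp add: ring_average_one)
  then have "(\<Sum>i\<in>UNIV. ennreal (sqrt (fst s $ i)) * ring_average i (\<lambda>_. h r) s) = ennreal l * h r" for r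
    using pos by (simp add: l_def total_rate_def sum_distrib_right[symmetric] sum_ennreal less_imp_le)
  then have "(\<integral>\<^sup>+z. h (next_delay z s) \<partial>noise_measure)
      = (\<integral>\<^sup>+r. ennreal (exp (- l * r)) * (ennreal l * h r) * indicator {0..} r \<partial>lborel)"
    using nn_integral_next_ring[OF s, of "\<lambda>r _. h r"] by (simp add: l_def)
  also have "\<dots> \<le> (\<integral>\<^sup>+r. ennreal (\<Lambda> * ((\<Lambda> * (t - r)) ^ n / fact n)) * indicator {0..t} r \<partial>lborel)"
  proof (rule nn_integral_mono)
    fix r :: real
    show "ennreal (exp (- l * r)) * (ennreal l * h r) * indicator {0..} r
        \<le> ennreal (\<Lambda> * ((\<Lambda> * (t - r)) ^ n / fact n)) * indicator {0..t} r"
    proof (cases "0 \<le> r \<and> r \<le> t")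
      case True
      have "exp (- l * r) * (l * ((\<Lambda> * (t - r)) ^ n / fact n)) \<le> 1 * (\<Lambda> * ((\<Lambda> * (t - r)) ^ n / fact n))"
        using True l \<Lambda> by (intro mult_mono) auto
      then show ?thesis using True l \<Lambda> by (simp add: h_def ennreal_mult[symmetric])
    qed (auto simp: h_def indicator_def)
  qed
  also have "\<dots> = ennreal ((\<lambda>r. - ((\<Lambda> * (t - r)) ^ Suc n / fact (Suc n))) t - (\<lambda>r. - ((\<Lambda> * (t - r)) ^ Suc n / fact (Suc n))) 0)"
  proof (rule nn_integral_FTC_Icc)
    show "((\<lambda>r. - ((\<Lambda> * (t - r)) ^ Suc n / fact (Suc n))) has_real_derivative \<Lambda> * ((\<Lambda> * (t - r)) ^ n / fact n)) (at r)" if "r \<in> {0..t}" for r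
      by (rule derivative_eq_intros refl | simp del: fact_Suc power_Suc)+ (simp add: field_simps del: of_nat_Suc power_Suc, simp add: field_simps)
  qed (use t \<Lambda> in auto)
  also have "\<dots> = ennreal ((\<Lambda> * t) ^ Suc n / fact (Suc n))" by simp
  finally show ?thesis by (simp add: h_def)
qed

lemma AE_next_state:
  fixes s :: "'m::finite state"
  assumes s: "s \<in> energy_simplex E"
  shows "AE z in noise_measure. next_state z s \<in> energy_simplex E"
proof -
  interpret U: prob_space unit_uniform by simp
  interpret C: prob_space "clock_measure :: ('m \<Rightarrow> real) measure" by (rule prob_space_clock)
  interpret P: pair_sigma_finite "clock_measure :: ('m \<Rightarrow> real) measure" unit_uniform ..
  have "AE z in (clock_measure :: ('m \<Rightarrow> real) measure) \<Otimes>\<^sub>M unit_uniform. 0 < snd z \<and> snd z < 1"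
  proof (rule P.AE_pair_measure)
    show "AE x in clock_measure. AE y in unit_uniform. 0 < snd (x :: 'm \<Rightarrow> real, y) \<and> snd (x, y) < 1"
      using AE_unit_uniform by simp
  qed measurable
  then show ?thesis unfolding noise_measure_eq
    by eventually_elim (auto simp: next_state_def intro!: ring_update_in_simplex[OF s])
qed

text \<open>
  Both quantities satisfy the same recursion at the first ring, and initially they differ by at most
  \<open>1\<close>. The comparison is made inside the integral over the first ring and uses only its monotonicity.
\<close>
lemma truncated_mean_bounds:
  fixes f :: "'m::finite state \<Rightarrow> ennreal"
  assumes f[measurable]: "f \<in> borel_measurable borel" and f1: "\<And>z. f z \<le> 1"
    and \<Lambda>: "\<Lambda> > 0" and rate: "\<And>s::'m state. s \<in> energy_simplex E \<Longrightarrow> total_rate s \<le> \<Lambda>"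
    and "s \<in> energy_simplex E" and "t \<ge> 0"
  shows "truncated_mean n f t s \<le> poisson_semigroup \<Lambda> t f s
    \<and> poisson_semigroup \<Lambda> t f s \<le> truncated_mean n f t s + ennreal ((\<Lambda> * t) ^ n / fact n)"
  using assms(5,6)
proof (induction n arbitrary: s t)
  case 0
  interpret Q: markov_operator "energy_simplex E :: 'm state set" borel "uniformised \<Lambda>"
    using rate \<Lambda> by (rule markov_operator_uniformised)
  have "poisson_semigroup \<Lambda> t f s \<le> (\<Sum>k. ennreal (poisson_weight (\<Lambda> * t) k))"
    unfolding poisson_semigroup_def
  proof (intro suminf_le)
    show "ennreal (poisson_weight (\<Lambda> * t) k) * (uniformised \<Lambda> ^^ k) f s \<le> ennreal (poisson_weight (\<Lambda> * t) k)" for k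
      using mult_left_mono[OF Q.iterate_le_1[of f s k], of "ennreal (poisson_weight (\<Lambda> * t) k)"] f1 0 by simp
  qed auto
  also have "\<dots> = 1"
    by (rule suminf_poisson_weight) (use 0 \<Lambda> in simp)
  finally show ?case using 0 by (simp add: truncated_mean_0)
next
  case (Suc n)
  note s = Suc.prems(1) and t = Suc.prems(2)
  let ?if = "\<lambda>g z. if t < next_delay z s then f s else g (t - next_delay z s) (next_state z s)"
  have S: "poisson_semigroup \<Lambda> t f s = (\<integral>\<^sup>+z. ?if (\<lambda>t s. poisson_semigroup \<Lambda> t f s) z \<partial>noise_measure)"
    by (rule poisson_semigroup_first_ring[OF f f1 \<Lambda> rate s t])
  have T: "truncated_mean (Suc n) f t s = (\<integral>\<^sup>+z. ?if (\<lambda>t s. truncated_mean n f t s) z \<partial>noise_measure)"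
    by (rule truncated_mean_Suc[OF f t])
  have "truncated_mean (Suc n) f t s \<le> poisson_semigroup \<Lambda> t f s"
    unfolding S T
  proof (rule nn_integral_mono_AE)
    show "AE z in noise_measure. ?if (\<lambda>t s. truncated_mean n f t s) z \<le> ?if (\<lambda>t s. poisson_semigroup \<Lambda> t f s) z"
      using AE_next_state[OF s] by eventually_elim (use Suc.IH in auto)
  qed
  moreover have "poisson_semigroup \<Lambda> t f s \<le> truncated_mean (Suc n) f t s + ennreal ((\<Lambda> * t) ^ Suc n / fact (Suc n))"
  proof -
    let ?err = "\<lambda>z. if t < next_delay z s then 0 else ennreal ((\<Lambda> * (t - next_delay z s)) ^ n / fact n)"
    have [measurable]: "(\<lambda>z. next_delay z s) \<in> borel_measurable noise_measure"
      by (intro measurable_next_delay measurable_noise_components) auto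
    have "poisson_semigroup \<Lambda> t f s \<le> (\<integral>\<^sup>+z. ?if (\<lambda>t s. truncated_mean n f t s) z + ?err z \<partial>noise_measure)"
      unfolding S
    proof (rule nn_integral_mono_AE)
      show "AE z in noise_measure. ?if (\<lambda>t s. poisson_semigroup \<Lambda> t f s) z \<le> ?if (\<lambda>t s. truncated_mean n f t s) z + ?err z"
        using AE_next_state[OF s] by eventually_elim (use Suc.IH in auto)
    qed
    also have "\<dots> = (\<integral>\<^sup>+z. ?if (\<lambda>t s. truncated_mean n f t s) z \<partial>noise_measure) + (\<integral>\<^sup>+z. ?err z \<partial>noise_measure)"
      by (rule nn_integral_add[OF truncated_mean_Suc(2)[OF f t]]) measurable
    also have "\<dots> \<le> truncated_mean (Suc n) f t s + ennreal ((\<Lambda> * t) ^ Suc n / fact (Suc n))"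
      unfolding T by (intro add_left_mono truncation_error_step[OF \<Lambda> rate[OF s] s t])
    finally show ?thesis .
  qed
  ultimately show ?case by blast
qed

text \<open>
  Truncation only discards mass, and the bound on the error tends to \<open>0\<close>.
\<close>
lemma transition_prob_ge_semigroup:
  fixes s :: "'m::finite state"
  assumes A: "A \<in> sets borel"
    and \<Lambda>: "\<Lambda> > 0" and rate: "\<And>s::'m state. s \<in> energy_simplex E \<Longrightarrow> total_rate s \<le> \<Lambda>"
    and s: "s \<in> energy_simplex E" and t: "t \<ge> 0"
  shows "poisson_semigroup \<Lambda> t (indicator A) s \<le> emeasure (transition_prob t s) A"
proof -
  let ?X = "emeasure (transition_prob t s) A"
  have "truncated_mean n (indicator A) t s \<le> ?X" for n
  proof -
    have "truncated_mean n (indicator A) t s \<le> (\<integral>\<^sup>+\<omega>. indicator A (state_at s \<omega> t) \<partial>stream_space noise_measure)"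
      unfolding truncated_mean_def truncated_def by (intro nn_integral_mono) auto
    also have "\<dots> = (\<integral>\<^sup>+x. indicator A x \<partial>transition_prob t s)"
      unfolding transition_prob_def using A by (subst nn_integral_distr[OF measurable_state_at]) auto
    also have "\<dots> = ?X" using A by (simp add: transition_prob_def)
    finally show ?thesis .
  qed
  then have "truncated_mean n (indicator A) t s + ennreal ((\<Lambda> * t) ^ n / fact n) \<le> ?X + ennreal ((\<Lambda> * t) ^ n / fact n)" for n
    by (intro add_right_mono)
  moreover have "poisson_semigroup \<Lambda> t (indicator A) s \<le> truncated_mean n (indicator A) t s + ennreal ((\<Lambda> * t) ^ n / fact n)" for n
    by (rule truncated_mean_bounds[OF _ _ \<Lambda> rate s t, THEN conjunct2]) (use A in \<open>auto simp: indicator_def\<close>)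
  ultimately have "poisson_semigroup \<Lambda> t (indicator A) s \<le> ?X + ennreal ((\<Lambda> * t) ^ n / fact n)" for n
    by (rule order_trans[rotated])
  moreover have "(\<lambda>n. ?X + ennreal ((\<Lambda> * t) ^ n / fact n)) \<longlonglongrightarrow> ?X + ennreal 0"
    by (intro tendsto_add tendsto_const tendsto_ennrealI summable_LIMSEQ_zero sums_summable[OF exp_series_sums])
  ultimately show ?thesis by (intro LIMSEQ_le_const[of _ ?X]) auto
qed

text \<open>
  The lower bounds for \<open>A\<close> and its complement already sum to \<open>1\<close>, so they are equalities. In particular
  infinitely many rings in finite time have probability \<open>0\<close>.
\<close>
theorem transition_prob_eq_semigroup:
  fixes s :: "'m::finite state"
  assumes A: "A \<in> sets borel"
    and \<Lambda>: "\<Lambda> > 0" and rate: "\<And>s::'m state. s \<in> energy_simplex E \<Longrightarrow> total_rate s \<le> \<Lambda>"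
    and s: "s \<in> energy_simplex E" and t: "t \<ge> 0"
  shows "emeasure (transition_prob t s) A = poisson_semigroup \<Lambda> t (indicator A) s"
proof -
  interpret Q: markov_operator "energy_simplex E :: 'm state set" borel "uniformised \<Lambda>"
    using rate \<Lambda> by (rule markov_operator_uniformised)
  interpret N: prob_space "noise_measure :: 'm noise measure" by (rule prob_space_noise)
  interpret S: prob_space "stream_space (noise_measure :: 'm noise measure)" by (rule N.prob_space_stream_space)
  interpret T: prob_space "transition_prob t s"
    unfolding transition_prob_def by (rule S.prob_space_distr[OF measurable_state_at])
  have st: "sets (transition_prob t s) = sets borel" "space (transition_prob t s) = UNIV"
    by (auto simp: transition_prob_def)
  have B: "- A \<in> sets borel" using A by auto
  let ?S = "\<lambda>A. poisson_semigroup \<Lambda> t (indicator A) s"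
  have "?S A + ?S (- A) = (\<Sum>k. ennreal (poisson_weight (\<Lambda> * t) k))"
  proof -
    have "(uniformised \<Lambda> ^^ k) (indicator A) s + (uniformised \<Lambda> ^^ k) (indicator (- A)) s = 1" for k
    proof -
      interpret k: markov_operator "energy_simplex E :: 'm state set" borel "uniformised \<Lambda> ^^ k"
        by (rule Q.markov_operator_iterate)
      have "(\<lambda>z. indicator A z + indicator (- A) z) = (\<lambda>_. 1::ennreal)" by (auto simp: indicator_def)
      then show ?thesis using k.add_op[of "indicator A" "indicator (- A)" s] k.one_op[OF s] A B s by simp
    qed
    then have "ennreal w * (uniformised \<Lambda> ^^ k) (indicator A) s + ennreal w * (uniformised \<Lambda> ^^ k) (indicator (- A)) s = ennreal w" for k w
      by (simp flip: distrib_left)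
    then show ?thesis unfolding poisson_semigroup_def by (subst suminf_add) auto
  qed
  also have "\<dots> = 1"
    by (rule suminf_poisson_weight) (use t \<Lambda> in simp)
  finally have 1: "?S A + ?S (- A) = 1" .
  have 2: "emeasure (transition_prob t s) A + emeasure (transition_prob t s) (- A) = 1"
    using plus_emeasure[of A "transition_prob t s" "- A"] A B T.emeasure_space_1 by (simp add: st)
  have le: "?S A \<le> emeasure (transition_prob t s) A" "?S (- A) \<le> emeasure (transition_prob t s) (- A)"
    using transition_prob_ge_semigroup[OF _ \<Lambda> rate s t] A B by auto
  have fin: "?S (- A) \<noteq> \<top>" using 1 by (metis ennreal_add_eq_top ennreal_one_neq_top)
  have "emeasure (transition_prob t s) A + ?S (- A) \<le> ?S A + ?S (- A)"
    unfolding 1 2[symmetric] using le by (intro add_left_mono)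
  then have "emeasure (transition_prob t s) A \<le> ?S A"
    using fin by (simp add: ennreal_add_left_cancel_le add.commute)
  with le show ?thesis by simp
qed

section \<open>Convergence to equilibrium\<close>

text \<open>
  With \<open>q = \<mu> / (k + 1)\<close> one has \<open>q powr p \<le> 1 + q\<^sup>2\<close>, and the Poisson weight at \<open>k\<close> times
  \<open>\<mu>\<^sup>2 / ((k + 1) * (k + 2)) \<ge> q\<^sup>2 / 2\<close> is the weight at \<open>k + 2\<close>; so the mean of \<open>q powr p\<close> is at most \<open>3\<close>.
\<close>
lemma poisson_negative_moment:
  assumes \<mu>: "\<mu> > 0" and p: "0 \<le> p" "p \<le> 2"
  shows "(\<Sum>k. ennreal (poisson_weight \<mu> k * real (k + 1) powr - p)) \<le> ennreal (3 * \<mu> powr - p)"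
proof -
  let ?w = "poisson_weight \<mu>"
  have w0: "?w k \<ge> 0" for k using \<mu> by (simp add: poisson_weight_nonneg)
  have le: "?w k * real (k + 1) powr - p \<le> \<mu> powr - p * (?w k + 2 * ?w (k + 2))" for k
  proof -
    let ?q = "\<mu> / real (k + 1)"
    have q: "?q > 0" using \<mu> by simp
    have "?q powr p \<le> 1 + ?q\<^sup>2"
    proof (cases "?q \<le> 1")
      case True
      then have "?q powr p \<le> 1 powr p" using q p by (intro powr_mono2) auto
      then show ?thesis by (simp add: add_increasing2)
    next
      case False
      then have "?q powr p \<le> ?q powr 2" using p by (intro powr_mono) auto
      then show ?thesis using q by simp
    qed
    then have "?w k * (?q powr p) \<le> ?w k * (1 + ?q\<^sup>2)" using w0 by (intro mult_left_mono)
    also have "\<dots> \<le> ?w k + 2 * ?w (k + 2)"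
    proof -
      have "?w (k + 2) = ?w k * \<mu>\<^sup>2 / ((real k + 1) * (real k + 2))"
        by (simp add: poisson_weight_def power_add field_simps power2_eq_square)
      moreover have "1 / (real k + 1)\<^sup>2 \<le> 2 / ((real k + 1) * (real k + 2))"
        by (simp add: divide_simps power2_eq_square)
      then have "(?w k * \<mu>\<^sup>2) * (1 / (real k + 1)\<^sup>2) \<le> (?w k * \<mu>\<^sup>2) * (2 / ((real k + 1) * (real k + 2)))"
        using w0 by (intro mult_left_mono) auto
      ultimately show ?thesis by (simp add: power_divide algebra_simps)
    qed
    finally have "\<mu> powr - p * (?w k * ?q powr p) \<le> \<mu> powr - p * (?w k + 2 * ?w (k + 2))"
      by (intro mult_left_mono) auto
    moreover have "\<mu> powr - p * ?q powr p = real (k + 1) powr - p"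
      using \<mu> by (simp add: powr_divide powr_minus field_simps)
    ultimately show ?thesis by (simp add: mult.left_commute)
  qed
  have "(\<lambda>k. ?w (k + 2)) sums (1 - (?w 0 + ?w 1))"
    using poisson_weight_sums[of \<mu>] by (subst sums_iff_shift) (simp add: numeral_2_eq_2)
  then have s: "(\<lambda>k. \<mu> powr - p * (?w k + 2 * ?w (k + 2))) sums (\<mu> powr - p * (1 + 2 * (1 - (?w 0 + ?w 1))))"
    by (intro sums_mult sums_add poisson_weight_sums)
  have "(\<Sum>k. ennreal (?w k * real (k + 1) powr - p)) \<le> (\<Sum>k. ennreal (\<mu> powr - p * (?w k + 2 * ?w (k + 2))))"
    using le by (intro suminf_le ennreal_leI) auto
  also have "\<dots> = ennreal (\<mu> powr - p * (1 + 2 * (1 - (?w 0 + ?w 1))))"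
    by (rule suminf_ennreal_eq[OF _ s]) (use w0 in \<open>auto intro!: mult_nonneg_nonneg add_nonneg_nonneg\<close>)
  also have "\<dots> \<le> ennreal (\<mu> powr - p * 3)"
    using w0[of 0] w0[of 1] by (intro ennreal_leI mult_left_mono) auto
  finally show ?thesis by (simp add: mult.commute)
qed

text \<open>
  The sets of a partition on which the difference is nonnegative, and those on which it is negative,
  have unions to which the bound applies.
\<close>
lemma tv_norm_diff_bounds:
  fixes P Q :: "'a measure"
  assumes P: "finite_measure P" "sets P = sets M" and Q: "finite_measure Q" "sets Q = sets M"
    and M: "space M \<noteq> {}" and B: "\<And>A. A \<in> sets M \<Longrightarrow> \<bar>measure P A - measure Q A\<bar> \<le> B"
  shows "0 \<le> tv_norm M (\<lambda>A. measure P A - measure Q A)" "tv_norm M (\<lambda>A. measure P A - measure Q A) \<le> 2 * B"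
proof -
  interpret P: finite_measure P by fact
  interpret Q: finite_measure Q by fact
  let ?\<nu> = "\<lambda>A. measure P A - measure Q A"
  let ?F = "{\<A>. finite \<A> \<and> \<A> \<subseteq> sets M \<and> partition_on (space M) \<A>}"
  have bound: "(\<Sum>A\<in>\<A>. \<bar>?\<nu> A\<bar>) \<le> 2 * B" if "\<A> \<in> ?F" for \<A>
  proof -
    have \<A>: "finite \<A>" "\<A> \<subseteq> sets M" "disjoint \<A>" using that by (auto simp: partition_on_def)
    have add: "(\<Sum>A\<in>\<B>. ?\<nu> A) = ?\<nu> (\<Union>\<B>)" if "\<B> \<subseteq> \<A>" for \<B>
    proof -
      have fin: "finite \<B>" using that \<A>(1) by (rule finite_subset)
      have "disjoint_family_on (\<lambda>A. A) \<B>"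
        using \<A>(3) that by (auto simp: disjoint_family_on_def disjoint_def)
      moreover have "(\<lambda>A. A) ` \<B> \<subseteq> sets P" "(\<lambda>A. A) ` \<B> \<subseteq> sets Q" using that \<A>(2) P Q by auto
      ultimately have "measure P (\<Union>A\<in>\<B>. A) = (\<Sum>A\<in>\<B>. measure P A)" "measure Q (\<Union>A\<in>\<B>. A) = (\<Sum>A\<in>\<B>. measure Q A)"
        using fin P.finite_measure_finite_Union[of \<B> "\<lambda>A. A"] Q.finite_measure_finite_Union[of \<B> "\<lambda>A. A"] by auto
      then show ?thesis by (simp add: sum_subtractf)
    qed
    define pos where "pos = {A\<in>\<A>. ?\<nu> A \<ge> 0}"
    define neg where "neg = {A\<in>\<A>. ?\<nu> A < 0}"
    have "(\<Sum>A\<in>\<A>. \<bar>?\<nu> A\<bar>) = (\<Sum>A\<in>pos. \<bar>?\<nu> A\<bar>) + (\<Sum>A\<in>neg. \<bar>?\<nu> A\<bar>)"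
      using \<A>(1) by (subst sum.union_disjoint[symmetric]) (auto simp: pos_def neg_def intro!: sum.cong)
    also have "\<dots> = (\<Sum>A\<in>pos. ?\<nu> A) - (\<Sum>A\<in>neg. ?\<nu> A)"
    proof -
      have "(\<Sum>A\<in>pos. \<bar>?\<nu> A\<bar>) = (\<Sum>A\<in>pos. ?\<nu> A)" by (intro sum.cong) (auto simp: pos_def)
      moreover have "(\<Sum>A\<in>neg. \<bar>?\<nu> A\<bar>) = (\<Sum>A\<in>neg. - ?\<nu> A)" by (intro sum.cong) (auto simp: neg_def)
      ultimately show ?thesis by (simp only: sum_negf diff_conv_add_uminus)
    qed
    also have "\<dots> = ?\<nu> (\<Union>pos) - ?\<nu> (\<Union>neg)"
      using add[of pos] add[of neg] by (simp add: pos_def neg_def)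
    also have "\<dots> \<le> 2 * B"
    proof -
      have "\<Union>pos \<in> sets M" "\<Union>neg \<in> sets M"
        using \<A> by (auto simp: pos_def neg_def intro!: sets.finite_Union)
      from B[OF this(1)] B[OF this(2)] show ?thesis by linarith
    qed
    finally show ?thesis .
  qed
  have mem: "{space M} \<in> ?F" using M by (auto simp: partition_on_def disjoint_def)
  show "tv_norm M ?\<nu> \<le> 2 * B" unfolding tv_norm_def
    using bound by (intro cSUP_least) (use mem in blast)+
  have "(\<Sum>A\<in>{space M}. \<bar>?\<nu> A\<bar>) \<le> tv_norm M ?\<nu>" unfolding tv_norm_def
    using mem bound by (intro cSUP_upper) (auto intro!: bdd_aboveI2)
  then show "0 \<le> tv_norm M ?\<nu>" by (auto intro: order_trans[rotated])
qed

text \<open>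
  Averages the second starting point in \<open>polynomial_contraction\<close> over the equilibrium. This is possible
  because the Lyapunov function is integrable there.
\<close>
lemma uniformised_polynomial_ergodicity:
  fixes E a \<Lambda> :: real and s :: "'m::finite state"
  assumes E: "E > 0" and a: "1/2 < a" "a < 1" and \<Lambda>: "\<Lambda> > 0"
    and rate: "\<And>s::'m state. s \<in> energy_simplex E \<Longrightarrow> total_rate s \<le> \<Lambda>"
    and s: "s \<in> energy_simplex E"
  obtains D where "D \<ge> 0"
    "\<And>k f. f \<in> borel_measurable borel \<Longrightarrow> \<forall>z. f z \<le> 1 \<Longrightarrow>
      (uniformised \<Lambda> ^^ k) f s \<le> (\<integral>\<^sup>+z. f z \<partial>equilibrium E) + ennreal (D * real (k + 1) powr - (2 * a))"
    "\<And>k f. f \<in> borel_measurable borel \<Longrightarrow> \<forall>z. f z \<le> 1 \<Longrightarrow>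
      (\<integral>\<^sup>+z. f z \<partial>equilibrium E) \<le> (uniformised \<Lambda> ^^ k) f s + ennreal (D * real (k + 1) powr - (2 * a))"
proof -
  interpret pi: prob_space "equilibrium E :: 'm state measure" by (rule prob_space_equilibrium[OF E])
  obtain K c d where K: "K > 0" and cd: "0 < c" "c \<le> 1" "d > 0"
    "\<And>s::'m state. s \<in> energy_simplex E \<Longrightarrow> uniformised \<Lambda> (\<lambda>z. ennreal (lyapunov a K z)) s
      \<le> ennreal (lyapunov a K s - c * lyapunov a K s powr (1 - 1 / (2 * a)) + d)"
    by (rule lyapunov_drift[OF E a \<Lambda> rate]) blast+
  interpret Q: markov_operator "energy_simplex E :: 'm state set" borel "uniformised \<Lambda>"
    using rate \<Lambda> by (rule markov_operator_uniformised)
  interpret D: polynomial_drift "energy_simplex E :: 'm state set" borel "uniformised \<Lambda>" "lyapunov a K" "2 * a" c d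
  proof
    show "\<exists>n \<eta> \<nu>. 0 < \<eta> \<and> \<eta> < 1 \<and> prob_space \<nu> \<and> sets \<nu> = sets borel \<and> (AE z in \<nu>. z \<in> energy_simplex E) \<and>
      (\<forall>s\<in>energy_simplex E. lyapunov a K s \<le> R \<longrightarrow>
        (\<forall>f\<in>borel_measurable borel. ennreal \<eta> * (\<integral>\<^sup>+z. f z \<partial>\<nu>) \<le> (uniformised \<Lambda> ^^ n) f (s :: 'm state)))" for R
      by (rule lyapunov_minorisation[OF E a \<Lambda> K rate])
  qed (use K a cd lyapunov_ge_1[of K a] in \<open>auto intro: less_imp_le\<close>)
  let ?V = "lyapunov a K"
  obtain C where C: "C \<ge> 0" "\<And>f k x x'. f \<in> borel_measurable borel \<Longrightarrow> \<forall>z\<in>energy_simplex E. f z \<le> 1 \<Longrightarrow>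
      x \<in> energy_simplex E \<Longrightarrow> x' \<in> energy_simplex E \<Longrightarrow>
      (uniformised \<Lambda> ^^ k) f x \<le> (uniformised \<Lambda> ^^ k) f x' + ennreal (C * (?V x + ?V (x' :: 'm state)) * real (k + 1) powr - (2 * a))"
    by (rule D.polynomial_contraction) blast
  have V1: "?V z \<ge> 1" for z :: "'m state" using lyapunov_ge_1[of K a z] K by simp
  define v where "v = enn2real (\<integral>\<^sup>+z. ennreal (?V z) \<partial>(equilibrium E :: 'm state measure))"
  have v: "(\<integral>\<^sup>+z. ennreal (?V z) \<partial>(equilibrium E :: 'm state measure)) = ennreal v" "v \<ge> 0"
    using equilibrium_lyapunov_finite[OF E a K, where 'm = 'm] by (auto simp: v_def)
  define D where "D = C * (?V s + v)"
  have D0: "D \<ge> 0" using C(1) v V1[of s] by (simp add: D_def)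
  have inv: "(\<integral>\<^sup>+z. (uniformised \<Lambda> ^^ k) f z \<partial>equilibrium E) = (\<integral>\<^sup>+z. f z \<partial>equilibrium E)"
    if "f \<in> borel_measurable borel" for k and f :: "'m state \<Rightarrow> ennreal"
    using that
  proof (induction k)
    case (Suc k)
    then show ?case
      using equilibrium_uniformised_invariant[OF E \<Lambda> rate, of "(uniformised \<Lambda> ^^ k) f"]
      by (simp add: measurable_uniformised_iterate)
  qed simp
  have int_bound: "(\<integral>\<^sup>+z. g z + ennreal (C * (?V s + ?V z) * r) \<partial>equilibrium E) = (\<integral>\<^sup>+z. g z \<partial>equilibrium E) + ennreal (D * r)"
    if [measurable]: "g \<in> borel_measurable borel" and r: "r \<ge> 0" for r and g :: "'m state \<Rightarrow> ennreal"
  proof -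
    have "ennreal (C * (?V s + ?V z) * r) = ennreal (C * ?V s * r) + ennreal (C * r) * ennreal (?V z)" for z :: "'m state"
      using C(1) r V1[of s] V1[of z] by (simp add: ennreal_mult[symmetric] ennreal_plus[symmetric] algebra_simps del: ennreal_plus)
    then have "(\<integral>\<^sup>+z. g z + ennreal (C * (?V s + ?V z) * r) \<partial>equilibrium E)
        = (\<integral>\<^sup>+z. g z \<partial>equilibrium E) + (ennreal (C * ?V s * r) + ennreal (C * r) * ennreal v)"
      using pi.emeasure_space_1 by (simp add: nn_integral_add nn_integral_cmult v)
    also have "ennreal (C * ?V s * r) + ennreal (C * r) * ennreal v = ennreal (D * r)"
      using C(1) r V1[of s] v by (simp add: D_def ennreal_mult[symmetric] ennreal_plus[symmetric] algebra_simps del: ennreal_plus)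
    finally show ?thesis .
  qed
  show ?thesis
  proof (rule that[OF D0])
    fix k and f :: "'m state \<Rightarrow> ennreal" assume f[measurable]: "f \<in> borel_measurable borel" and "\<forall>z. f z \<le> 1"
    then have f1: "\<forall>z\<in>energy_simplex E. f z \<le> 1" by blast
    let ?r = "real (k + 1) powr - (2 * a)"
    note [measurable] = measurable_uniformised_iterate[OF f]
    have "(uniformised \<Lambda> ^^ k) f s = (\<integral>\<^sup>+z. (uniformised \<Lambda> ^^ k) f s \<partial>(equilibrium E :: 'm state measure))"
      using pi.emeasure_space_1 by simp
    also have "\<dots> \<le> (\<integral>\<^sup>+z. (uniformised \<Lambda> ^^ k) f z + ennreal (C * (?V s + ?V z) * ?r) \<partial>equilibrium E)"
    proof (rule nn_integral_mono_AE)
      show "AE z in equilibrium E. (uniformised \<Lambda> ^^ k) f s \<le> (uniformised \<Lambda> ^^ k) f z + ennreal (C * (?V s + ?V z) * ?r)"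
        using AE_equilibrium[OF E] by eventually_elim (rule C(2)[OF f f1 s])
    qed
    also have "\<dots> = (\<integral>\<^sup>+z. f z \<partial>equilibrium E) + ennreal (D * ?r)"
      by (subst int_bound) (auto simp: inv)
    finally show "(uniformised \<Lambda> ^^ k) f s \<le> (\<integral>\<^sup>+z. f z \<partial>equilibrium E) + ennreal (D * ?r)" .
    have "(\<integral>\<^sup>+z. f z \<partial>equilibrium E) = (\<integral>\<^sup>+z. (uniformised \<Lambda> ^^ k) f z \<partial>equilibrium E)" by (simp add: inv)
    also have "\<dots> \<le> (\<integral>\<^sup>+z. (uniformised \<Lambda> ^^ k) f s + ennreal (C * (?V s + ?V z) * ?r) \<partial>(equilibrium E :: 'm state measure))"
    proof (rule nn_integral_mono_AE)
      show "AE z in equilibrium E. (uniformised \<Lambda> ^^ k) f z \<le> (uniformised \<Lambda> ^^ k) f s + ennreal (C * (?V s + ?V z) * ?r)"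
        using AE_equilibrium[OF E]
      proof eventually_elim
        case (elim z)
        show ?case using C(2)[OF f f1 elim s, of k] by (simp add: add.commute)
      qed
    qed
    also have "\<dots> = (uniformised \<Lambda> ^^ k) f s + ennreal (D * ?r)"
      using pi.emeasure_space_1 by (subst int_bound) auto
    finally show "(\<integral>\<^sup>+z. f z \<partial>equilibrium E) \<le> (uniformised \<Lambda> ^^ k) f s + ennreal (D * ?r)" .
  qed
qed

text \<open>
  The Poisson average of the bounds after \<open>k\<close> steps.
\<close>
lemma transition_prob_polynomial_bound:
  fixes E a :: real and s :: "'m::finite state"
  assumes E: "E > 0" and a: "1/2 < a" "a < 1" and s: "s \<in> energy_simplex E"
  obtains D where "D \<ge> 0"
    "\<And>t A. t > 0 \<Longrightarrow> A \<in> sets borel \<Longrightarrow> \<bar>measure (transition_prob t s) A - measure (equilibrium E) A\<bar> \<le> D * t powr - (2 * a)"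
proof -
  define \<Lambda> where "\<Lambda> = CARD('m) * sqrt E"
  have \<Lambda>: "\<Lambda> > 0" using E by (simp add: \<Lambda>_def)
  have rate: "total_rate z \<le> \<Lambda>" if "z \<in> energy_simplex E" for z :: "'m state"
    using total_rate_le[OF that] by (simp add: \<Lambda>_def)
  interpret pi: prob_space "equilibrium E :: 'm state measure" by (rule prob_space_equilibrium[OF E])
  obtain D where D: "D \<ge> 0"
    "\<And>k f. f \<in> borel_measurable borel \<Longrightarrow> \<forall>z. f z \<le> 1 \<Longrightarrow>
      (uniformised \<Lambda> ^^ k) f s \<le> (\<integral>\<^sup>+z. f z \<partial>equilibrium E) + ennreal (D * real (k + 1) powr - (2 * a))"
    "\<And>k f. f \<in> borel_measurable borel \<Longrightarrow> \<forall>z. f z \<le> 1 \<Longrightarrow>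
      (\<integral>\<^sup>+z. f z \<partial>equilibrium E) \<le> (uniformised \<Lambda> ^^ k) f s + ennreal (D * real (k + 1) powr - (2 * a))"
    by (rule uniformised_polynomial_ergodicity[OF E a \<Lambda> rate s]) blast+
  have "\<bar>measure (transition_prob t s) A - measure (equilibrium E) A\<bar> \<le> (D * (3 * \<Lambda> powr - (2 * a))) * t powr - (2 * a)"
    if t: "t > 0" and A: "A \<in> sets borel" for t A
  proof -
    interpret N: prob_space "noise_measure :: 'm noise measure" by (rule prob_space_noise)
    interpret S: prob_space "stream_space (noise_measure :: 'm noise measure)" by (rule N.prob_space_stream_space)
    interpret T: prob_space "transition_prob t s"
      unfolding transition_prob_def by (rule S.prob_space_distr[OF measurable_state_at])
    let ?w = "poisson_weight (\<Lambda> * t)" and ?q = "\<lambda>k. (uniformised \<Lambda> ^^ k) (indicator A) s"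
    let ?\<pi> = "emeasure (equilibrium E) A" and ?r = "\<lambda>k. real (k + 1) powr - (2 * a)"
    have w0: "?w k \<ge> 0" for k using \<Lambda> t by (simp add: poisson_weight_nonneg)
    have w1: "(\<Sum>k. ennreal (?w k) * x) = x" for x
      using suminf_poisson_weight[of "\<Lambda> * t"] \<Lambda> t by simp
    have err: "(\<Sum>k. ennreal (?w k) * ennreal (D * ?r k)) \<le> ennreal ((D * (3 * \<Lambda> powr - (2 * a))) * t powr - (2 * a))"
    proof -
      have "(\<Sum>k. ennreal (?w k) * ennreal (D * ?r k)) = ennreal D * (\<Sum>k. ennreal (?w k * ?r k))"
        using D(1) w0 by (simp add: ennreal_mult[symmetric] mult.left_commute flip: ennreal_suminf_cmult)
      also have "\<dots> \<le> ennreal D * ennreal (3 * (\<Lambda> * t) powr - (2 * a))"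
        using \<Lambda> t a by (intro mult_left_mono poisson_negative_moment) auto
      also have "\<dots> = ennreal ((D * (3 * \<Lambda> powr - (2 * a))) * t powr - (2 * a))"
        using D(1) by (simp add: ennreal_mult[symmetric] powr_mult mult.assoc)
      finally show ?thesis .
    qed
    have q: "?q k \<le> ?\<pi> + ennreal (D * ?r k)" "?\<pi> \<le> ?q k + ennreal (D * ?r k)" for k
      using D(2,3)[of "indicator A" k] A by (auto simp: indicator_def[abs_def] nn_integral_indicator[symmetric] simp del: nn_integral_indicator)
    have eq: "emeasure (transition_prob t s) A = (\<Sum>k. ennreal (?w k) * ?q k)"
      using transition_prob_eq_semigroup[OF A \<Lambda> rate s, of t] t by (simp add: poisson_semigroup_def)
    let ?e = "(D * (3 * \<Lambda> powr - (2 * a))) * t powr - (2 * a)"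
    have e0: "?e \<ge> 0" using D(1) by simp
    have "emeasure (transition_prob t s) A \<le> (\<Sum>k. ennreal (?w k) * ?\<pi> + ennreal (?w k) * ennreal (D * ?r k))"
      unfolding eq distrib_left[symmetric] using q by (intro suminf_le mult_left_mono) auto
    also have "\<dots> = ?\<pi> + (\<Sum>k. ennreal (?w k) * ennreal (D * ?r k))"
      by (subst suminf_add[symmetric]) (simp_all only: w1 summableI)
    also have "\<dots> \<le> ?\<pi> + ennreal ?e" by (intro add_left_mono err)
    finally have 1: "measure (transition_prob t s) A \<le> measure (equilibrium E) A + ?e"
      using e0 by (simp add: T.emeasure_eq_measure pi.emeasure_eq_measure ennreal_plus[symmetric] del: ennreal_plus)
    have "?\<pi> = (\<Sum>k. ennreal (?w k) * ?\<pi>)" by (rule w1[symmetric])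
    also have "\<dots> \<le> (\<Sum>k. ennreal (?w k) * ?q k + ennreal (?w k) * ennreal (D * ?r k))"
      unfolding distrib_left[symmetric] using q by (intro suminf_le mult_left_mono) auto
    also have "\<dots> = emeasure (transition_prob t s) A + (\<Sum>k. ennreal (?w k) * ennreal (D * ?r k))"
      unfolding eq by (subst suminf_add[symmetric]) auto
    also have "\<dots> \<le> emeasure (transition_prob t s) A + ennreal ?e" by (intro add_left_mono err)
    finally have 2: "measure (equilibrium E) A \<le> measure (transition_prob t s) A + ?e"
      using e0 by (simp add: T.emeasure_eq_measure pi.emeasure_eq_measure ennreal_plus[symmetric] del: ennreal_plus)
    from 1 2 show ?thesis by linarith
  qed
  moreover have "D * (3 * \<Lambda> powr - (2 * a)) \<ge> 0" using D(1) by simp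
  ultimately show ?thesis by (rule that[rotated])
qed

theorem theorem2:
  fixes E \<gamma> :: real and s :: "'m::finite state"
  assumes "E > 0"
    and "s \<in> energy_simplex E"
    and "\<gamma> > 0"
  shows "((\<lambda>t. t powr (2 - \<gamma>) *
            tv_norm borel (\<lambda>A. measure (transition_prob t s) A - measure (equilibrium E) A))
          \<longlongrightarrow> 0) at_top"
proof -
  define a where "a = max (3/4) (1 - \<gamma> / 4)"
  have a: "1/2 < a" "a < 1" "2 - \<gamma> - 2 * a < 0"
    using \<open>\<gamma> > 0\<close> by (auto simp: a_def max_def)
  obtain D where D: "D \<ge> 0"
    "\<And>t A. t > 0 \<Longrightarrow> A \<in> sets borel \<Longrightarrow> \<bar>measure (transition_prob t s) A - measure (equilibrium E) A\<bar> \<le> D * t powr - (2 * a)"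
    by (rule transition_prob_polynomial_bound[OF assms(1) a(1,2) assms(2)]) (rule that)
  interpret N: prob_space "noise_measure :: 'm noise measure" by (rule prob_space_noise)
  interpret S: prob_space "stream_space (noise_measure :: 'm noise measure)" by (rule N.prob_space_stream_space)
  interpret pi: prob_space "equilibrium E :: 'm state measure" by (rule prob_space_equilibrium[OF assms(1)])
  let ?tv = "\<lambda>t. tv_norm borel (\<lambda>A. measure (transition_prob t s) A - measure (equilibrium E) A)"
  have tv: "0 \<le> ?tv t" "?tv t \<le> 2 * (D * t powr - (2 * a))" if "t > 0" for t
  proof -
    interpret T: prob_space "transition_prob t s"
      unfolding transition_prob_def by (rule S.prob_space_distr[OF measurable_state_at])
    have "sets (transition_prob t s) = sets borel" by (simp add: transition_prob_def)
    then show "0 \<le> ?tv t" "?tv t \<le> 2 * (D * t powr - (2 * a))"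
      using D(2)[OF that] T.finite_measure_axioms pi.finite_measure_axioms
      by (auto intro!: tv_norm_diff_bounds)
  qed
  show ?thesis
  proof (rule tendsto_sandwich)
    show "\<forall>\<^sub>F t in at_top. 0 \<le> t powr (2 - \<gamma>) * ?tv t"
      using eventually_gt_at_top[of 0] by eventually_elim (simp add: tv)
    show "\<forall>\<^sub>F t in at_top. t powr (2 - \<gamma>) * ?tv t \<le> 2 * D * t powr (2 - \<gamma> - 2 * a)"
      using eventually_gt_at_top[of 0]
    proof eventually_elim
      case (elim t)
      have "t powr (2 - \<gamma>) * ?tv t \<le> t powr (2 - \<gamma>) * (2 * (D * t powr - (2 * a)))"
        by (intro mult_left_mono tv elim) simp
      also have "\<dots> = 2 * D * (t powr (2 - \<gamma>) * t powr - (2 * a))" by simp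
      also have "t powr (2 - \<gamma>) * t powr - (2 * a) = t powr (2 - \<gamma> - 2 * a)" by (simp flip: powr_add)
      finally show ?case .
    qed
    show "((\<lambda>t. 2 * D * t powr (2 - \<gamma> - 2 * a)) \<longlongrightarrow> 0) at_top"
      by (intro tendsto_mult_right_zero tendsto_neg_powr a filterlim_ident)
  qed simp
qed

end
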